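(* Let $A$ be a Nakayama algebra and $R(A)$ its resolution quiver. Then $A$ is minimal Auslander-Gorenstein of even selfinjective dimension if and only if all of the following hold: (1) $\operatorname{dist} S=\operatorname{dist} A>0$ for every leaf $S$ in $R(A)$; (2) every noncyclic vertex of $R(A)$ has at most $1$ predecessor in $R(A)$; (3) every cyclic vertex of $R(A)$ has at most $2$ predecessors in $R(A)$; (4) all cyclic vertices in $R(A)$ are black.
   Context: Let $k$ be an algebraically closed field. Algebras are finite dimensional associative $k$-algebras, modules are finite dimensional left modules. For $n\ge 1$ let $\Delta_n$ be the quiver with vertices $1,\dots,n$ and arrows $1\to 2\to\cdots\to n\to 1$. A Nakayama algebra of rank $n$ is a finite dimensional algebra $A$ isomorphic to $k\Delta_n/(I)$, where $(I)$ is the ideal generated by a finite set $I$ of nontrivial paths ($I$ may contain one or several arrows, so $A$ may be disconnected); such a presentation is fixed. For a vertex $a$, $S(a)$, $P(a)$, $I(a)$ are the simple, indecomposable projective and indecomposable injective modules at $a$. Put $\tau(a)=b$ if there is an arrow $a\to b$ in $\Delta_n$; this induces a cyclic permutation $\tau$ of the (isoclasses of) simple $A$-modules. Convention: $P(a)$ is uniserial with composition factors, from the top, $S(a),S(\tau a),S(\tau^2a),\dots$. $P(M)$ is the projective cover of $M$. Resolution quiver $R(A)$: its vertices are the isoclasses of simple $A$-modules, with exactly one arrow $S\to\gamma(S)$ for each $S$, where $\gamma(S)=\tau\operatorname{soc}P(S)$. A predecessor of $S$ is a $T$ with $\gamma(T)=S$. A simple module is red if its projective dimension is exactly $1$, and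 black otherwise. A vertex is cyclic if it lies on a cycle of $R(A)$, and a leaf if no arrow of $R(A)$ ends at it. $\operatorname{dist}S$ is the minimal $d\ge 0$ such that $\gamma^d(S)$ is cyclic, and $\operatorname{dist}A=\max_S\operatorname{dist}S$. Dominant dimension $\mathrm{dom.dim}\,A$: the maximal integer $n$ (or $\infty$) such that in the minimal injective resolution $0\to A\to I^0\to I^1\to\cdots$ of the left module $A$ all $I^j$ with $j<n$ are projective. $A$ is minimal Auslander-Gorenstein (of selfinjective dimension $d$) if there is an integer $d\ge1$ with $\mathrm{dom.dim}\,A=d=\mathrm{id}_A\,A$. *)

theory Defs
  imports
    "HOL-Algebra.Module"
    "HOL-Algebra.QuotRing"
    "HOL-Computational_Algebra.Polynomial"
    "HOL-Library.Extended_Nat"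
begin

hide_const (open) Multiset.mult Polynomial.smult

section \<open>Algebras over a field and their finite dimensional left modules\<close>

text \<open>
  The ground field is a type of class \<^class>\<open>field\<close>. A (unital, associative, not necessarily
  commutative) algebra is a \<^type>\<open>module_ext\<close> record whose ring fields carry the ring structure
  and whose \<open>smult\<close> is the scalar action of the field.
\<close>

locale k_algebra = ring A for A :: "('k::field, 'a) module" (structure) +
  assumes scale_closed: "x \<in> carrier A \<Longrightarrow> c \<odot> x \<in> carrier A"
    and scale_add_left: "x \<in> carrier A \<Longrightarrow> (c + d) \<odot> x = c \<odot> x \<oplus> d \<odot> x"
    and scale_add_right:
      "x \<in> carrier A \<Longrightarrow> y \<in> carrier A \<Longrightarrow> c \<odot> (x \<oplus> y) = c \<odot> x \<oplus> c \<odot> y"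
    and scale_scale: "x \<in> carrier A \<Longrightarrow> (c * d) \<odot> x = c \<odot> (d \<odot> x)"
    and scale_one: "x \<in> carrier A \<Longrightarrow> 1 \<odot> x = x"
    and scale_mult_left:
      "x \<in> carrier A \<Longrightarrow> y \<in> carrier A \<Longrightarrow> (c \<odot> x) \<otimes> y = c \<odot> (x \<otimes> y)"
    and scale_mult_right:
      "x \<in> carrier A \<Longrightarrow> y \<in> carrier A \<Longrightarrow> x \<otimes> (c \<odot> y) = c \<odot> (x \<otimes> y)"

text \<open>
  The library's \<^locale>\<open>module\<close> requires a commutative ring. The ring fields \<open>mult\<close> and \<open>one\<close> of a
  record representing a module are irrelevant.
\<close>

locale left_module = R?: ring R + M?: abelian_group M for R (structure) and M (structure) +
  assumes smult_closed: "r \<in> carrier R \<Longrightarrow> x \<in> carrier M \<Longrightarrow> r \<odot>\<^bsub>M\<^esub> x \<in> carrier M"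
    and smult_l_distr: "r \<in> carrier R \<Longrightarrow> s \<in> carrier R \<Longrightarrow> x \<in> carrier M \<Longrightarrow>
      (r \<oplus> s) \<odot>\<^bsub>M\<^esub> x = r \<odot>\<^bsub>M\<^esub> x \<oplus>\<^bsub>M\<^esub> s \<odot>\<^bsub>M\<^esub> x"
    and smult_r_distr: "r \<in> carrier R \<Longrightarrow> x \<in> carrier M \<Longrightarrow> y \<in> carrier M \<Longrightarrow>
      r \<odot>\<^bsub>M\<^esub> (x \<oplus>\<^bsub>M\<^esub> y) = r \<odot>\<^bsub>M\<^esub> x \<oplus>\<^bsub>M\<^esub> r \<odot>\<^bsub>M\<^esub> y"
    and smult_assoc: "r \<in> carrier R \<Longrightarrow> s \<in> carrier R \<Longrightarrow> x \<in> carrier M \<Longrightarrow>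
      (r \<otimes> s) \<odot>\<^bsub>M\<^esub> x = r \<odot>\<^bsub>M\<^esub> (s \<odot>\<^bsub>M\<^esub> x)"
    and smult_one: "x \<in> carrier M \<Longrightarrow> \<one> \<odot>\<^bsub>M\<^esub> x = x"

text \<open>A left module is a vector space through \<open>c x = (c 1) x\<close>.\<close>

definition fin_dim :: "('k::field, 'a) module \<Rightarrow> ('a, 'm) module \<Rightarrow> bool" where
  "fin_dim A M \<longleftrightarrow> (\<exists>B. finite B \<and> B \<subseteq> carrier M \<and>
     (\<forall>x\<in>carrier M. \<exists>c. x = finsum M (\<lambda>b. (c b \<odot>\<^bsub>A\<^esub> \<one>\<^bsub>A\<^esub>) \<odot>\<^bsub>M\<^esub> b) B))"

definition fd_module :: "('k::field, 'a) module \<Rightarrow> ('a, 'm) module \<Rightarrow> bool" where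
  "fd_module A M \<longleftrightarrow> left_module A M \<and> fin_dim A M"

definition regular_module :: "('k, 'a) module \<Rightarrow> ('a, 'a) module" where
  "regular_module A = \<lparr>carrier = carrier A, mult = mult A, one = one A,
     zero = zero A, add = add A, smult = mult A\<rparr>"

definition left_hom ::
    "('k, 'a) module \<Rightarrow> ('a, 'm) module \<Rightarrow> ('a, 'n) module \<Rightarrow> ('m \<Rightarrow> 'n) set" where
  "left_hom A M N = {f. f \<in> carrier M \<rightarrow> carrier N \<and>
     (\<forall>x\<in>carrier M. \<forall>y\<in>carrier M. f (x \<oplus>\<^bsub>M\<^esub> y) = f x \<oplus>\<^bsub>N\<^esub> f y) \<and>
     (\<forall>r\<in>carrier A. \<forall>x\<in>carrier M. f (r \<odot>\<^bsub>M\<^esub> x) = r \<odot>\<^bsub>N\<^esub> f x)}"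

definition left_iso :: "('k, 'a) module \<Rightarrow> ('a, 'm) module \<Rightarrow> ('a, 'n) module \<Rightarrow> bool" where
  "left_iso A M N \<longleftrightarrow> (\<exists>f\<in>left_hom A M N. bij_betw f (carrier M) (carrier N))"

definition quotient_module :: "('a, 'm) module \<Rightarrow> 'm set \<Rightarrow> ('a, 'm set) module" where
  "quotient_module M N = \<lparr>carrier = a_rcosets\<^bsub>M\<^esub> N, mult = undefined, one = undefined,
     zero = N, add = set_add M, smult = (\<lambda>r X. \<Union>x\<in>X. N +>\<^bsub>M\<^esub> (r \<odot>\<^bsub>M\<^esub> x))\<rparr>"

definition simple_submodule :: "('k, 'a) module \<Rightarrow> ('a, 'm) module \<Rightarrow> 'm set \<Rightarrow> bool" where
  "simple_submodule A M T \<longleftrightarrow> submodule T A M \<and> T \<noteq> {\<zero>\<^bsub>M\<^esub>} \<and>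
     (\<forall>N. submodule N A M \<and> N \<subseteq> T \<longrightarrow> N = {\<zero>\<^bsub>M\<^esub>} \<or> N = T)"

definition maximal_submodule :: "('k, 'a) module \<Rightarrow> ('a, 'm) module \<Rightarrow> 'm set \<Rightarrow> bool" where
  "maximal_submodule A M T \<longleftrightarrow> submodule T A M \<and> T \<noteq> carrier M \<and>
     (\<forall>N. submodule N A M \<and> T \<subseteq> N \<longrightarrow> N = T \<or> N = carrier M)"

text \<open>The sum of all simple submodules, as a module.\<close>

definition soc :: "('k, 'a) module \<Rightarrow> ('a, 'm) module \<Rightarrow> ('a, 'm) module" where
  "soc A M = M\<lparr>carrier := \<Inter>{N. submodule N A M \<and> (\<forall>T. simple_submodule A M T \<longrightarrow> T \<subseteq> N)}\<rparr>"

definition rad :: "('k, 'a) module \<Rightarrow> ('a, 'm) module \<Rightarrow> 'm set" where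
  "rad A M = carrier M \<inter> \<Inter>{N. maximal_submodule A M N}"

definition essential_submodule :: "('k, 'a) module \<Rightarrow> ('a, 'm) module \<Rightarrow> 'm set \<Rightarrow> bool" where
  "essential_submodule A M N \<longleftrightarrow> submodule N A M \<and>
     (\<forall>X. submodule X A M \<and> X \<noteq> {\<zero>\<^bsub>M\<^esub>} \<longrightarrow> X \<inter> N \<noteq> {\<zero>\<^bsub>M\<^esub>})"


section \<open>Homological notions in the category of finite dimensional modules\<close>

text \<open>
  Quantification over all finite dimensional modules is quantification over modules whose carrier
  is a subset of \<open>nat \<Rightarrow> 'k\<close>: every finite dimensional vector space over \<open>'k\<close> is in bijection with a
  subset of this type, so every finite dimensional module has an isomorphic copy there.
  The operations of such a module need not be the pointwise ones.
\<close>

definition projective_module :: "('k::field, 'a) module \<Rightarrow> ('a, 'm) module \<Rightarrow> bool" where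
  "projective_module A P \<longleftrightarrow> fd_module A P \<and>
     (\<forall>(X :: ('a, nat \<Rightarrow> 'k) module) (Y :: ('a, nat \<Rightarrow> 'k) module) g f.
        fd_module A X \<and> fd_module A Y \<and> g \<in> left_hom A X Y \<and> g ` carrier X = carrier Y \<and>
        f \<in> left_hom A P Y \<longrightarrow>
        (\<exists>h\<in>left_hom A P X. \<forall>x\<in>carrier P. g (h x) = f x))"

definition injective_module :: "('k::field, 'a) module \<Rightarrow> ('a, 'm) module \<Rightarrow> bool" where
  "injective_module A Q \<longleftrightarrow> fd_module A Q \<and>
     (\<forall>(X :: ('a, nat \<Rightarrow> 'k) module) (Y :: ('a, nat \<Rightarrow> 'k) module) g f.
        fd_module A X \<and> fd_module A Y \<and> g \<in> left_hom A X Y \<and> inj_on g (carrier X) \<and>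
        f \<in> left_hom A X Q \<longrightarrow>
        (\<exists>h\<in>left_hom A Y Q. \<forall>x\<in>carrier X. h (g x) = f x))"

text \<open>\<open>\<dots> \<longrightarrow> P 1 \<longrightarrow> P 0 \<longrightarrow> M \<longrightarrow> 0\<close> with \<open>d j\<close> from \<open>P (j + 1)\<close> to \<open>P j\<close> and augmentation \<open>\<epsilon>\<close>.\<close>

definition projective_resolution ::
    "('k::field, 'a) module \<Rightarrow> ('a, 'm) module \<Rightarrow> (nat \<Rightarrow> ('a, nat \<Rightarrow> 'k) module) \<Rightarrow>
     ((nat \<Rightarrow> 'k) \<Rightarrow> 'm) \<Rightarrow> (nat \<Rightarrow> (nat \<Rightarrow> 'k) \<Rightarrow> (nat \<Rightarrow> 'k)) \<Rightarrow> bool" where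
  "projective_resolution A M P \<epsilon> d \<longleftrightarrow>
     (\<forall>j. projective_module A (P j)) \<and>
     \<epsilon> \<in> left_hom A (P 0) M \<and> (\<forall>j. d j \<in> left_hom A (P (Suc j)) (P j)) \<and>
     \<epsilon> ` carrier (P 0) = carrier M \<and>
     a_kernel (P 0) M \<epsilon> = d 0 ` carrier (P 1) \<and>
     (\<forall>j. a_kernel (P (Suc j)) (P j) (d j) = d (Suc j) ` carrier (P (Suc (Suc j))))"

text \<open>\<open>0 \<longrightarrow> M \<longrightarrow> Q 0 \<longrightarrow> Q 1 \<longrightarrow> \<dots>\<close> with \<open>d j\<close> from \<open>Q j\<close> to \<open>Q (j + 1)\<close> and coaugmentation \<open>\<eta>\<close>.\<close>

definition injective_resolution ::
    "('k::field, 'a) module \<Rightarrow> ('a, 'm) module \<Rightarrow> (nat \<Rightarrow> ('a, nat \<Rightarrow> 'k) module) \<Rightarrow>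
     ('m \<Rightarrow> (nat \<Rightarrow> 'k)) \<Rightarrow> (nat \<Rightarrow> (nat \<Rightarrow> 'k) \<Rightarrow> (nat \<Rightarrow> 'k)) \<Rightarrow> bool" where
  "injective_resolution A M Q \<eta> d \<longleftrightarrow>
     (\<forall>j. injective_module A (Q j)) \<and>
     \<eta> \<in> left_hom A M (Q 0) \<and> (\<forall>j. d j \<in> left_hom A (Q j) (Q (Suc j))) \<and>
     inj_on \<eta> (carrier M) \<and>
     a_kernel (Q 0) (Q 1) (d 0) = \<eta> ` carrier M \<and>
     (\<forall>j. a_kernel (Q (Suc j)) (Q (Suc (Suc j))) (d (Suc j)) = d j ` carrier (Q j))"

definition minimal_injective_resolution ::
    "('k::field, 'a) module \<Rightarrow> ('a, 'm) module \<Rightarrow> (nat \<Rightarrow> ('a, nat \<Rightarrow> 'k) module) \<Rightarrow>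
     ('m \<Rightarrow> (nat \<Rightarrow> 'k)) \<Rightarrow> (nat \<Rightarrow> (nat \<Rightarrow> 'k) \<Rightarrow> (nat \<Rightarrow> 'k)) \<Rightarrow> bool" where
  "minimal_injective_resolution A M Q \<eta> d \<longleftrightarrow>
     injective_resolution A M Q \<eta> d \<and>
     essential_submodule A (Q 0) (\<eta> ` carrier M) \<and>
     (\<forall>j. essential_submodule A (Q (Suc j)) (d j ` carrier (Q j)))"

definition proj_dim :: "('k::field, 'a) module \<Rightarrow> ('a, 'm) module \<Rightarrow> enat" where
  "proj_dim A M = Inf {enat m | m. \<exists>P \<epsilon> d. projective_resolution A M P \<epsilon> d \<and>
     (\<forall>j>m. carrier (P j) = {\<zero>\<^bsub>P j\<^esub>})}"

definition inj_dim :: "('k::field, 'a) module \<Rightarrow> ('a, 'm) module \<Rightarrow> enat" where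
  "inj_dim A M = Inf {enat m | m. \<exists>Q \<eta> d. injective_resolution A M Q \<eta> d \<and>
     (\<forall>j>m. carrier (Q j) = {\<zero>\<^bsub>Q j\<^esub>})}"

text \<open>
  Minimal injective resolutions are unique up to isomorphism. The set below contains \<open>0\<close> and is
  closed downwards, so its supremum is its maximum, or \<open>\<infinity>\<close> if it is unbounded.
\<close>

definition dom_dim :: "('k::field, 'a) module \<Rightarrow> enat" where
  "dom_dim A = Sup {enat m | m. \<exists>Q \<eta> d. minimal_injective_resolution A (regular_module A) Q \<eta> d \<and>
     (\<forall>j<m. projective_module A (Q j))}"

definition minimal_auslander_gorenstein :: "('k::field, 'a) module \<Rightarrow> nat \<Rightarrow> bool" where
  "minimal_auslander_gorenstein A d \<longleftrightarrow>
     d \<ge> 1 \<and> dom_dim A = enat d \<and> inj_dim A (regular_module A) = enat d"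


section \<open>Nakayama algebras\<close>

text \<open>
  The vertices of the cyclic quiver are the residues \<open>0, \<dots>, n - 1\<close>, with one arrow from each \<open>a\<close>
  to \<open>(a + 1) mod n\<close>. The pair \<open>(a, l)\<close> with \<open>a < n\<close> is the path of length \<open>l\<close> starting at \<open>a\<close>, so it
  ends at \<open>(a + l) mod n\<close>. In a product \<open>f g\<close> the path in \<open>g\<close> is travelled first; hence the left
  ideal generated by the trivial path at \<open>a\<close> is spanned by the paths starting at \<open>a\<close>.
\<close>

definition succ_vertex :: "nat \<Rightarrow> nat \<Rightarrow> nat" where
  "succ_vertex n a = Suc a mod n"

definition path_algebra :: "nat \<Rightarrow> ('k::field, nat \<times> nat \<Rightarrow> 'k) module" where
  "path_algebra n =
     \<lparr>carrier = {f. finite {p. f p \<noteq> 0} \<and> (\<forall>a l. f (a, l) \<noteq> 0 \<longrightarrow> a < n)},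
      mult = (\<lambda>f g (a, l). \<Sum>i\<le>l. f ((a + i) mod n, l - i) * g (a, i)),
      one = (\<lambda>(a, l). if a < n \<and> l = 0 then 1 else 0),
      zero = (\<lambda>p. 0),
      add = (\<lambda>f g p. f p + g p),
      smult = (\<lambda>c f p. c * f p)\<rparr>"

definition path :: "nat \<times> nat \<Rightarrow> (nat \<times> nat \<Rightarrow> 'k::field)" where
  "path p = (\<lambda>q. if q = p then 1 else 0)"

definition quotient_algebra :: "('k, 'a) module \<Rightarrow> 'a set \<Rightarrow> ('k, 'a set) module" where
  "quotient_algebra A J = ring.extend (A Quot J)
     \<lparr>smult = (\<lambda>c X. \<Union>x\<in>X. J +>\<^bsub>A\<^esub> (c \<odot>\<^bsub>A\<^esub> x))\<rparr>"

definition relation_ideal :: "nat \<Rightarrow> (nat \<times> nat) set \<Rightarrow> (nat \<times> nat \<Rightarrow> 'k::field) set" where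
  "relation_ideal n I = genideal (path_algebra n) (path ` I)"

definition bound_path_algebra ::
    "nat \<Rightarrow> (nat \<times> nat) set \<Rightarrow> ('k::field, (nat \<times> nat \<Rightarrow> 'k) set) module" where
  "bound_path_algebra n I = quotient_algebra (path_algebra n) (relation_ideal n I)"

text \<open>\<open>A\<close> is a Nakayama algebra of rank \<open>n\<close> with presentation \<open>\<phi>\<close> by the relations \<open>I\<close>.\<close>

definition nakayama_algebra ::
    "('k::field, 'a) module \<Rightarrow> nat \<Rightarrow> (nat \<times> nat) set \<Rightarrow>
     ((nat \<times> nat \<Rightarrow> 'k) set \<Rightarrow> 'a) \<Rightarrow> bool" where
  "nakayama_algebra A n I \<phi> \<longleftrightarrow>
     n \<ge> 1 \<and> finite I \<and> (\<forall>(a, l)\<in>I. a < n \<and> l \<ge> 1) \<and>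
     k_algebra A \<and> fin_dim A (regular_module A) \<and>
     \<phi> \<in> ring_iso (bound_path_algebra n I) A \<and>
     (\<forall>c. \<forall>X\<in>carrier (bound_path_algebra n I).
        \<phi> (c \<odot>\<^bsub>bound_path_algebra n I\<^esub> X) = c \<odot>\<^bsub>A\<^esub> \<phi> X)"

definition vertex_idempotent ::
    "nat \<Rightarrow> (nat \<times> nat) set \<Rightarrow> ((nat \<times> nat \<Rightarrow> 'k::field) set \<Rightarrow> 'a) \<Rightarrow> nat \<Rightarrow> 'a" where
  "vertex_idempotent n I \<phi> a = \<phi> (relation_ideal n I +>\<^bsub>path_algebra n\<^esub> path (a, 0))"

text \<open>The indecomposable projective \<open>A e\<close> and the simple module on top of it.\<close>

definition proj_at ::
    "('k::field, 'a) module \<Rightarrow> nat \<Rightarrow> (nat \<times> nat) set \<Rightarrow> ((nat \<times> nat \<Rightarrow> 'k) set \<Rightarrow> 'a) \<Rightarrow>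
     nat \<Rightarrow> ('a, 'a) module" where
  "proj_at A n I \<phi> a =
     (regular_module A)\<lparr>carrier := {x \<otimes>\<^bsub>A\<^esub> vertex_idempotent n I \<phi> a | x. x \<in> carrier A}\<rparr>"

definition simple_at ::
    "('k::field, 'a) module \<Rightarrow> nat \<Rightarrow> (nat \<times> nat) set \<Rightarrow> ((nat \<times> nat \<Rightarrow> 'k) set \<Rightarrow> 'a) \<Rightarrow>
     nat \<Rightarrow> ('a, 'a set) module" where
  "simple_at A n I \<phi> a = quotient_module (proj_at A n I \<phi> a) (rad A (proj_at A n I \<phi> a))"


section \<open>The resolution quiver\<close>

text \<open>
  The simple modules at the vertices \<open>a < n\<close> represent the isomorphism classes of simple modules,
  each once; the vertex \<open>a\<close> of the quiver \<open>0, \<dots>, n - 1\<close> stands for the class of the simple module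
  at \<open>a\<close>. The resolution quiver then has the arrows \<open>a \<rightarrow> \<gamma> a\<close> for \<open>a < n\<close>.
\<close>

definition resolution_map ::
    "('k::field, 'a) module \<Rightarrow> nat \<Rightarrow> (nat \<times> nat) set \<Rightarrow> ((nat \<times> nat \<Rightarrow> 'k) set \<Rightarrow> 'a) \<Rightarrow>
     nat \<Rightarrow> nat" where
  "resolution_map A n I \<phi> a = succ_vertex n
     (THE b. b < n \<and> left_iso A (soc A (proj_at A n I \<phi> a)) (simple_at A n I \<phi> b))"

definition red ::
    "('k::field, 'a) module \<Rightarrow> nat \<Rightarrow> (nat \<times> nat) set \<Rightarrow> ((nat \<times> nat \<Rightarrow> 'k) set \<Rightarrow> 'a) \<Rightarrow>
     nat \<Rightarrow> bool" where
  "red A n I \<phi> a \<longleftrightarrow> proj_dim A (simple_at A n I \<phi> a) = 1"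

definition black ::
    "('k::field, 'a) module \<Rightarrow> nat \<Rightarrow> (nat \<times> nat) set \<Rightarrow> ((nat \<times> nat \<Rightarrow> 'k) set \<Rightarrow> 'a) \<Rightarrow>
     nat \<Rightarrow> bool" where
  "black A n I \<phi> a \<longleftrightarrow> \<not> red A n I \<phi> a"

text \<open>Below, \<open>\<gamma>\<close> is a map from \<open>{..<n}\<close> to itself, regarded as a quiver with arrows \<open>a \<rightarrow> \<gamma> a\<close>.\<close>

definition predecessors :: "nat \<Rightarrow> (nat \<Rightarrow> nat) \<Rightarrow> nat \<Rightarrow> nat set" where
  "predecessors n \<gamma> a = {b. b < n \<and> \<gamma> b = a}"

definition leaf :: "nat \<Rightarrow> (nat \<Rightarrow> nat) \<Rightarrow> nat \<Rightarrow> bool" where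
  "leaf n \<gamma> a \<longleftrightarrow> predecessors n \<gamma> a = {}"

definition cyclic_vertex :: "(nat \<Rightarrow> nat) \<Rightarrow> nat \<Rightarrow> bool" where
  "cyclic_vertex \<gamma> a \<longleftrightarrow> (\<exists>m\<ge>1. (\<gamma> ^^ m) a = a)"

definition vertex_dist :: "(nat \<Rightarrow> nat) \<Rightarrow> nat \<Rightarrow> nat" where
  "vertex_dist \<gamma> a = (LEAST d. cyclic_vertex \<gamma> ((\<gamma> ^^ d) a))"

definition max_dist :: "nat \<Rightarrow> (nat \<Rightarrow> nat) \<Rightarrow> nat" where
  "max_dist n \<gamma> = Max (vertex_dist \<gamma> ` {..<n})"

end

theory Submission
  imports Defs
begin

text \<open>
  Lift the vertices to the integers and let \<open>f a\<close> be \<open>a\<close> plus the length of \<open>P(a)\<close>: a monotone map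
  with \<open>f (a + n) = f a + n\<close> and \<open>a < f a\<close>. Indecomposable modules are intervals \<open>[a, b)\<close> with
  \<open>a < b \<le> f a\<close>; the projective ones have \<open>b = f a\<close> and the injective ones \<open>a = g b\<close>, where \<open>g\<close> is
  the left adjoint of \<open>f\<close>. Modulo \<open>n\<close>, the map \<open>f\<close> is \<open>\<gamma>\<close>, and the simple module at \<open>a\<close> is red
  iff \<open>f a = f (a + 1)\<close>. The minimal injective resolution of \<open>P(a) = [a, f a)\<close> is read off the sequence
  \<open>f a, a, g (f a), g a, g (g (f a)), g (g a), \<dots>\<close>: its terms are the injective modules ending at these
  numbers, its cosyzygies the intervals between neighbours, and a term is projective iff its end lies
  in the image of \<open>f\<close>. So the algebra is minimal Auslander-Gorenstein of dimension \<open>2 m\<close> iff there is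
  an \<open>a\<close> with \<open>f (a - 1) = f a\<close> and for each of them \<open>g\<^sup>j a\<close> for \<open>j < m\<close> and \<open>g\<^sup>j (f a)\<close> for
  \<open>0 < j < m\<close> lie in the image of \<open>f\<close> and \<open>g\<^sup>m a = g\<^sup>m (g (f a))\<close>. As \<open>g\<close> walks against the
  arrows of \<open>\<gamma>\<close>, this says that the branches attached to the cycles of the quiver have length \<open>m\<close>.
\<close>

section \<open>Residues\<close>

text \<open>Both dimensions are defined over all resolutions with carriers in
  \<open>nat \<Rightarrow> 'k\<close>, so reading terms off one resolution is only half of the work.
  The other half sandwiches every nonzero interval of the sequence in the corresponding term of an
  arbitrary injective resolution: there are homomorphisms into the term and back whose composite
  acts on the top by a nonzero scalar. This forces the term to be nonzero and, if the term is
  projective, the interval to be projective. The integers replace the cyclic quiver because the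
  argument lives on order: monotonicity, the adjoint and gaps between neighbours have no meaning on
  residues. Even dimension enters because then the two interleaved orbits, of \<open>a\<close> and
  of \<open>g (f a)\<close>, have to meet at equal exponents of \<open>g\<close>; they merge when no
  value of \<open>f\<close> is left in the gap between them, which is where a branch of the quiver
  ends. That every branch arises in this way is a count: a self-map of a finite set misses as many
  points as it loses by coincidences of values.\<close>

definition residue :: "nat \<Rightarrow> int \<Rightarrow> nat" where "residue n z = nat (z mod int n)"

lemma residue_less: "n \<ge> 1 \<Longrightarrow> residue n z < n" by (simp add: residue_def nat_less_iff)

lemma residue_shift: "residue n (z + k * int n) = residue n z" by (simp add: residue_def)

lemma residue_int: "a < n \<Longrightarrow> residue n (int a) = a" by (simp add: residue_def)

lemma int_residue: "n \<ge> 1 \<Longrightarrow> int (residue n z) = z + (- (z div int n)) * int n"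
  using minus_div_mult_eq_mod[of z "int n"] by (simp add: residue_def)

lemma residue_add:
  assumes "n \<ge> 1" shows "residue n (z + int i) = (residue n z + i) mod n"
proof -
  have "int ((nat (z mod int n) + i) mod n) = (z mod int n + int i) mod int n"
    using assms by (simp add: zmod_int)
  also have "\<dots> = (z + int i) mod int n" by (rule mod_add_left_eq)
  finally show ?thesis unfolding residue_def by (metis nat_int)
qed

lemma residue_eq_iff:
  assumes "n \<ge> 1" shows "residue n w = residue n z \<longleftrightarrow> (\<exists>k. z = w + k * int n)"
proof
  assume eq: "residue n w = residue n z"
  have "z = w + (z div int n - w div int n) * int n"
    using int_residue[OF assms, of w] int_residue[OF assms, of z] eq by (simp add: algebra_simps)
  then show "\<exists>k. z = w + k * int n" by blast
qed (auto simp: residue_shift)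

lemma residue_eq_nat_iff:
  "n \<ge> 1 \<Longrightarrow> a < n \<Longrightarrow> residue n w = a \<longleftrightarrow> (\<exists>k. w = int a + k * int n)"
  using residue_eq_iff[of n "int a" w] residue_int[of a n] by auto

section \<open>Periodic monotone maps on the integers\<close>

text \<open>The numbers \<open>f z - z\<close> form the Kupisch series, the lengths of the
  indecomposable projectives. Monotonicity is its defining inequality: the radical of an
  indecomposable projective is zero or a quotient of the next projective, so the length drops by at
  most one from a vertex to the next.\<close>

locale kupisch_map =
  fixes n :: nat and f :: "int \<Rightarrow> int"
  assumes n_pos: "n \<ge> 1"
    and f_mono: "w \<le> z \<Longrightarrow> f w \<le> f z"
    and f_gt: "z < f z"
    and f_shift1: "f (z + int n) = f z + int n"
begin

lemma f_shift_nat: "f (z + int k * int n) = f z + int k * int n"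
proof (induction k)
  case (Suc k)
  have "z + int (Suc k) * int n = (z + int k * int n) + int n" by (simp add: algebra_simps)
  then show ?case using Suc f_shift1[of "z + int k * int n"] by (simp add: algebra_simps)
qed simp

lemma f_shift: "f (z + k * int n) = f z + k * int n"
proof (cases "k \<ge> 0")
  case True
  then show ?thesis using f_shift_nat[of z "nat k"] by simp
next
  case False
  then show ?thesis using f_shift_nat[of "z + k * int n" "nat (- k)"] by simp
qed

lemma pow_f_shift: "(f ^^ d) (z + k * int n) = (f ^^ d) z + k * int n"
  by (induction d) (simp_all add: f_shift)

section \<open>The left adjoint of \<open>f\<close>\<close>

lemma jump_exists: "\<exists>a. f (a - 1) < b \<and> b \<le> f a"
proof -
  \<comment> \<open>Moving left by \<open>f b - b + 1\<close> periods lowers the value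
    \<open>f b\<close> by at least \<open>f b - b + 1\<close>, hence to below \<open>b\<close>; the
    search for the first value reaching \<open>b\<close> starts there.\<close>
  define lo where "lo = b - (f b - b + 1) * int n"
  have "f lo = f b + (- (f b - b + 1)) * int n"
    using f_shift[of b "- (f b - b + 1)"] unfolding lo_def minus_mult_left[symmetric]
    by (simp only: add_uminus_conv_diff)
  moreover have "(f b - b + 1) * 1 \<le> (f b - b + 1) * int n"
    using f_gt[of b] n_pos by (intro mult_left_mono) auto
  ultimately have lo: "f lo < b" by (simp add: algebra_simps)
  have "lo < b" using lo f_gt[of lo] by linarith
  have ex: "\<exists>k::nat. b \<le> f (lo + int k)"
    using f_gt[of b] \<open>lo < b\<close> by (intro exI[of _ "nat (b - lo)"]) simp
  define k where "k = (LEAST k::nat. b \<le> f (lo + int k))"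
  have k: "b \<le> f (lo + int k)" unfolding k_def using ex by (rule LeastI_ex)
  have "k \<noteq> 0" using k lo by (intro notI) simp
  then obtain k' where k': "k = Suc k'" by (cases k) auto
  have "\<not> b \<le> f (lo + int k')" using not_less_Least[of k' "\<lambda>k. b \<le> f (lo + int k)"] k'
    unfolding k_def by simp
  then show ?thesis using k k' by (intro exI[of _ "lo + int k"]) simp
qed

text \<open>The integers are not well-ordered, so the least \<open>a\<close> with
  \<open>b \<le> f a\<close> is described by the jump of \<open>f\<close> at it. Among the
  admissible intervals ending at \<open>b\<close>, the one starting at \<open>g b\<close> is the
  longest.\<close>

definition g :: "int \<Rightarrow> int" where
  "g b = (SOME a. f (a - 1) < b \<and> b \<le> f a)"

lemma g_le_iff: "g b \<le> a \<longleftrightarrow> b \<le> f a"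
proof -
  have *: "f (g b - 1) < b" "b \<le> f (g b)"
    using someI_ex[OF jump_exists[of b]] by (auto simp: g_def)
  show ?thesis
  proof
    assume "g b \<le> a"
    then show "b \<le> f a" using f_mono *(2) by (meson order_trans)
  next
    assume "b \<le> f a"
    then show "g b \<le> a" using *(1) f_mono[of a "g b - 1"] by linarith
  qed
qed

lemma le_fg: "b \<le> f (g b)" using g_le_iff by blast
lemma gf_le: "g (f a) \<le> a" using g_le_iff by blast
lemma g_mono: "b \<le> c \<Longrightarrow> g b \<le> g c" using g_le_iff le_fg order_trans by blast
lemma fgf: "f (g (f a)) = f a" using gf_le f_mono le_fg by (simp add: order_antisym)

lemma fg_iff: "f (g b) = b \<longleftrightarrow> b \<in> range f" using fgf by (metis rangeE rangeI)

lemma g_shift: "g (b + k * int n) = g b + k * int n"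
proof (rule order_antisym)
  show "g (b + k * int n) \<le> g b + k * int n"
    using g_le_iff f_shift le_fg by simp
  have "b \<le> f (g (b + k * int n) + (- k) * int n)"
    using le_fg[of "b + k * int n"] f_shift[of "g (b + k * int n)" "- k"] by simp
  then show "g b + k * int n \<le> g (b + k * int n)"
    using g_le_iff[of b "g (b + k * int n) + (- k) * int n"] by simp
qed

text \<open>The adjunction, applied once per iterate. It turns the position of a point relative to
  two \<open>g\<close>-orbits into the position of its forward iterate, which is how gaps between
  orbits are examined.\<close>

lemma pow_g_le_iff: "(g ^^ d) b \<le> a \<longleftrightarrow> b \<le> (f ^^ d) a"
  by (induction d arbitrary: b) (simp_all add: g_le_iff funpow_swap1 del: funpow.simps add: funpow_Suc_right)

text \<open>On the image of \<open>f\<close> one has \<open>f (g b) = b\<close>, so \<open>g\<close>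
  cannot merge two points of the image. Two orbits of \<open>g\<close> can therefore meet only after
  one of them has left the image.\<close>

lemma g_strict: "b < c \<Longrightarrow> b \<in> range f \<Longrightarrow> c \<in> range f \<Longrightarrow> g b < g c"
proof -
  assume "b < c" "b \<in> range f" "c \<in> range f"
  then have "f (g b) < f (g c)" using fg_iff[of b] fg_iff[of c] by simp
  then show "g b < g c" using f_mono[of "g c" "g b"] by linarith
qed

text \<open>The interval of P(a) then extends to the left: P(a) is the radical of P(a - 1), hence
  not injective, and the simple module at \<open>a - 1\<close> is red.\<close>

definition doubled :: "int \<Rightarrow> bool" where "doubled a \<longleftrightarrow> f (a - 1) = f a"

lemma doubled_iff: "doubled a \<longleftrightarrow> g (f a) < a"
proof
  assume "doubled a"
  then have "g (f a) \<le> a - 1" unfolding doubled_def g_le_iff by simp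
  then show "g (f a) < a" by simp
next
  assume "g (f a) < a"
  then have "g (f a) \<le> a - 1" by simp
  then have "f a \<le> f (a - 1)" using g_le_iff by blast
  then show "doubled a" using f_mono[of "a - 1" a] unfolding doubled_def by simp
qed

lemma not_doubled_iff: "\<not> doubled a \<longleftrightarrow> g (f a) = a"
  by (simp add: doubled_iff not_less order.eq_iff gf_le)

lemma doubled_shift: "doubled (a + k * int n) \<longleftrightarrow> doubled a"
  using f_shift[of "a - 1" k] f_shift[of a k] by (simp add: doubled_def algebra_simps)

lemma not_doubled_gf: "\<not> doubled (g (f a))" by (simp add: not_doubled_iff fgf)

section \<open>Cyclic points, which return up to a multiple of \<open>n\<close>, and
  distances\<close>

definition cyc :: "int \<Rightarrow> bool" where
  "cyc x \<longleftrightarrow> (\<exists>p\<ge>1. \<exists>k. (f ^^ p) x = x + k * int n)"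

lemma cyc_shift: "cyc (x + k * int n) \<longleftrightarrow> cyc x"
  by (simp add: cyc_def pow_f_shift algebra_simps)

lemma cyc_f: "cyc x \<Longrightarrow> cyc (f x)"
  unfolding cyc_def by (metis funpow_swap1 f_shift)

lemma cyc_pow: "cyc x \<Longrightarrow> cyc ((f ^^ d) x)"
  by (induction d) (simp_all add: cyc_f)

lemma cyc_pred:
  assumes "cyc x" obtains w where "cyc w" "f w = x"
proof -
  obtain p k where p: "p \<ge> 1" "(f ^^ p) x = x + k * int n" using assms cyc_def by blast
  obtain q where q: "p = Suc q" using p by (cases p) auto
  have "f ((f ^^ q) x + (- k) * int n) = x" using f_shift[of "(f ^^ q) x" "- k"] p q by simp
  moreover have "cyc ((f ^^ q) x + (- k) * int n)" using cyc_shift cyc_pow assms by blast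
  ultimately show ?thesis using that by blast
qed

lemma cyc_pow_pred: "cyc x \<Longrightarrow> \<exists>w. (f ^^ d) w = x"
proof (induction d arbitrary: x)
  case (Suc d)
  then obtain w where "cyc w" "f w = x" using cyc_pred by blast
  then show ?case using Suc.IH by auto
qed simp

lemma eventually_cyc: "\<exists>d. cyc ((f ^^ d) x)"
proof -
  have "(\<lambda>d. (f ^^ d) x mod int n) ` UNIV \<subseteq> {0..<int n}" using n_pos by auto
  then have "finite (range (\<lambda>d. (f ^^ d) x mod int n))" using finite_subset by blast
  then have "\<not> inj (\<lambda>d. (f ^^ d) x mod int n)" using finite_imageD infinite_UNIV_nat by blast
  then obtain i j where ij: "i < j" "(f ^^ i) x mod int n = (f ^^ j) x mod int n"
    unfolding inj_def by (metis linorder_neqE_nat)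
  have "(f ^^ (j - i)) ((f ^^ i) x) = (f ^^ j) x"
    using ij by (simp flip: funpow_add comp_apply[of "f ^^ (j - i)" "f ^^ i"])
  moreover obtain k where "(f ^^ j) x = (f ^^ i) x + k * int n"
    using ij(2) by (metis mod_eqE mult.commute)
  ultimately show ?thesis unfolding cyc_def using ij(1)
    by (intro exI[of _ i] exI[of _ "j - i"]) auto
qed

definition dst :: "int \<Rightarrow> nat" where "dst x = (LEAST d. cyc ((f ^^ d) x))"

lemma dst_le_iff: "dst x \<le> d \<longleftrightarrow> cyc ((f ^^ d) x)"
proof
  assume "dst x \<le> d"
  moreover have "cyc ((f ^^ dst x) x)" unfolding dst_def using eventually_cyc by (rule LeastI_ex)
  ultimately have "cyc ((f ^^ (d - dst x)) ((f ^^ dst x) x))" using cyc_pow by blast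
  then show "cyc ((f ^^ d) x)"
    using \<open>dst x \<le> d\<close> by (simp flip: funpow_add comp_apply[of "f ^^ (d - dst x)" "f ^^ dst x"])
qed (simp add: dst_def Least_le)

lemma dst_0_iff: "dst x = 0 \<longleftrightarrow> cyc x" using dst_le_iff[of x 0] by simp

lemma dst_pred_le: "dst x \<le> Suc (dst (f x))"
  using dst_le_iff[of x "Suc (dst (f x))"] dst_le_iff[of "f x" "dst (f x)"] by (simp add: funpow_swap1)

lemma dst_pred: "\<not> cyc x \<Longrightarrow> dst x = Suc (dst (f x))"
proof (rule order_antisym[OF dst_pred_le])
  assume "\<not> cyc x"
  then obtain d where d: "dst x = Suc d" using dst_0_iff by (cases "dst x") auto
  then have "dst (f x) \<le> d"
    using dst_le_iff[of x "Suc d"] dst_le_iff[of "f x" d] by (simp add: funpow_swap1)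
  then show "Suc (dst (f x)) \<le> dst x" using d by simp
qed

lemma dst_pow: "\<not> cyc ((f ^^ t) x) \<Longrightarrow> dst x = t + dst ((f ^^ t) x)"
proof (induction t)
  case (Suc t)
  then have "\<not> cyc ((f ^^ t) x)" using cyc_f by auto
  then show ?case using Suc dst_pred by simp
qed simp

lemma dst_shift: "dst (x + k * int n) = dst x"
  by (simp add: dst_def pow_f_shift cyc_shift)

definition window :: "int set" where "window = {0..<int n}"

lemma finite_window: "finite window" by (simp add: window_def)

lemma window_rep: obtains k where "x + k * int n \<in> window" "(x + k * int n) = x mod int n"
proof
  show "x + (- (x div int n)) * int n = x mod int n" using minus_div_mult_eq_mod[of x "int n"] by simp
  then show "x + (- (x div int n)) * int n \<in> window" using n_pos by (simp add: window_def)
qed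

lemma dst_bounded: "\<exists>D. \<forall>x. dst x \<le> D"
proof -
  have "dst x \<le> Max (dst ` window)" for x
    by (metis window_rep dst_shift Max_ge finite_imageI finite_window imageI)
  then show ?thesis by blast
qed

text \<open>Off the cycles each step backwards raises the distance by one, and distances are bounded
  by periodicity. The walk back must stop at a point without predecessor.\<close>

lemma leaf_ancestor: "\<not> cyc x \<Longrightarrow> \<exists>L t. L \<notin> range f \<and> (f ^^ t) L = x"
proof -
  assume nc: "\<not> cyc x"
  obtain D where D: "\<And>y. dst y \<le> D" using dst_bounded by blast
  have "\<exists>t \<le> D. \<exists>z. (f ^^ t) z = x \<and> z \<notin> range f"
  proof (rule ccontr)
    assume neg: "\<not> ?thesis"
    have "\<exists>z. (f ^^ t) z = x" if "t \<le> Suc D" for t using that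
    proof (induction t)
      case (Suc t)
      then obtain z where z: "(f ^^ t) z = x" by auto
      then obtain w where "z = f w" using neg Suc.prems by (metis Suc_le_mono rangeE)
      then show ?case using z by (metis funpow_Suc_right comp_apply)
    qed simp
    then obtain z where "(f ^^ Suc D) z = x" by blast
    then have "dst z \<ge> Suc D" using dst_pow[of "Suc D" z] nc by simp
    then show False using D[of z] by simp
  qed
  then show ?thesis by blast
qed


section \<open>The two combinatorial conditions\<close>

text \<open>The orbit of \<open>a\<close> occupies the odd places of the sequence for P(a) and that
  of \<open>g (f a)\<close> the even places from 2 on, whence the ranges \<open>j < m\<close> and
  \<open>Suc j < m\<close>: both describe the places before \<open>2 * m\<close>. Place 0 holds
  \<open>f a\<close> itself.\<close>

definition sequence_cond :: "nat \<Rightarrow> bool" where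
  "sequence_cond m \<longleftrightarrow> m \<ge> 1 \<and> (\<exists>a. doubled a) \<and>
     (\<forall>a. doubled a \<longrightarrow> (\<forall>j<m. (g ^^ j) a \<in> range f) \<and>
        (\<forall>j. Suc j < m \<longrightarrow> (g ^^ j) (g (f a)) \<in> range f) \<and>
        (g ^^ m) a = (g ^^ m) (g (f a)))"

text \<open>Fibres of a monotone map are intervals, so a second predecessor shows as
  \<open>f w = f (w + 1)\<close> and a third as \<open>f w = f (w + 2)\<close>; the equation
  \<open>f w = f (w + 1)\<close> also expresses that the simple module at \<open>w\<close> is red.
  This turns the four conditions into statements about neighbours. \<open>D\<close> stands for the
  largest distance.\<close>

definition quiver_cond :: "nat \<Rightarrow> bool" where
  "quiver_cond D \<longleftrightarrow> D > 0 \<and> (\<forall>x. dst x \<le> D) \<and> (\<exists>x. dst x = D) \<and>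
     (\<forall>x. x \<notin> range f \<longrightarrow> dst x = D) \<and>
     (\<forall>w. f w = f (w + 1) \<longrightarrow> cyc (f w)) \<and>
     (\<forall>w. f w = f (w + 2) \<longrightarrow> \<not> cyc (f w)) \<and>
     (\<forall>w. f w = f (w + 1) \<longrightarrow> \<not> cyc w)"

text \<open>Without doubled points \<open>g\<close> is a left inverse of \<open>f\<close>, so all
  iterates of \<open>f\<close> are injective. A leaf walks down to a cyclic point, and that point
  also has an ancestor one level further up along its cycle; injectivity makes the leaf a value of
  \<open>f\<close>.\<close>

lemma inj_imp_cyc:
  assumes "\<And>a. \<not> doubled a"
  shows "cyc x"
proof (rule ccontr)
  assume nc: "\<not> cyc x"
  obtain L t where L: "L \<notin> range f" using leaf_ancestor[OF nc] by blast
  have gf: "g (f a) = a" for a using assms not_doubled_iff by blast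
  have "(g ^^ d) ((f ^^ d) a) = a" for d a
    by (induction d arbitrary: a) (simp_all add: gf funpow_swap1)
  then have "(f ^^ d) a = (f ^^ d) b \<Longrightarrow> a = b" for d a b by metis
  moreover obtain d where "cyc ((f ^^ d) L)" using eventually_cyc by blast
  then obtain w where "(f ^^ Suc d) w = (f ^^ d) L" using cyc_pow_pred by blast
  then have "(f ^^ d) (f w) = (f ^^ d) L" by (simp add: funpow_swap1)
  ultimately have "f w = L" by blast
  then show False using L by blast
qed

text \<open>For doubled \<open>a\<close> the fibre of \<open>f a\<close> is
  \<open>{a - 1, a}\<close> with \<open>a\<close> cyclic and \<open>a - 1\<close> not. Each
  application of \<open>g\<close> inside the image raises the distance by at most one, and a point
  of distance below \<open>m\<close> is no leaf, so both orbits stay in the image long enough. They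
  merge at exponent \<open>m\<close> because a value of \<open>f\<close> between them would start a
  walk of \<open>m\<close> steps to the noncyclic point \<open>a - 1\<close>.\<close>

lemma quiver_imp_sequence:
  assumes "quiver_cond m"
  shows "sequence_cond m"
proof -
  have m: "m > 0" "\<And>x. dst x \<le> m" "\<And>x. x \<notin> range f \<Longrightarrow> dst x = m"
    and c2: "\<And>w. f w = f (w + 1) \<Longrightarrow> cyc (f w)"
    and c3: "\<And>w. f w = f (w + 2) \<Longrightarrow> \<not> cyc (f w)"
    and c4: "\<And>w. f w = f (w + 1) \<Longrightarrow> \<not> cyc w"
    and ex: "\<exists>x. dst x = m"
    using assms unfolding quiver_cond_def by auto
  have "\<exists>a. doubled a" using ex m(1) inj_imp_cyc dst_0_iff by (metis less_irrefl)
  moreover have "(\<forall>j<m. (g ^^ j) a \<in> range f) \<and>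
        (\<forall>j. Suc j < m \<longrightarrow> (g ^^ j) (g (f a)) \<in> range f) \<and>
        (g ^^ m) a = (g ^^ m) (g (f a))" if a: "doubled a" for a
  proof -
    have fa: "f (a - 1) = f a" using a doubled_def by simp
    have cfa: "cyc (f a)" using c2[of "a - 1"] fa by simp
    have nd: "f (a - 2) \<noteq> f a" using c3[of "a - 2"] cfa by auto
    have nca1: "\<not> cyc (a - 1)" using c4[of "a - 1"] fa by simp
    obtain w where w: "cyc w" "f w = f a" using cfa cyc_pred by blast
    \<comment> \<open>A cyclic preimage elsewhere would make three neighbouring points share the
      cyclic value \<open>f a\<close>, against the bound of two predecessors.\<close>
    have w_in: "w = a - 1 \<or> w = a"
    proof (rule ccontr)
      assume "\<not> ?thesis"
      then consider "w \<le> a - 2" | "a < w" by linarith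
      then show False
      proof cases
        case 1
        then have "f (a - 2) = f a"
          using f_mono[of w "a - 2"] f_mono[of "a - 2" a] w(2) by simp
        then show False using nd by simp
      next
        case 2
        then have "f (a + 1) = f a" using f_mono[of "a + 1" w] f_mono[of a "a + 1"] w(2) by simp
        moreover have "a - 1 + 2 = a + 1" by simp
        ultimately show False using c3[of "a - 1"] fa cfa by metis
      qed
    qed
    then have ca: "cyc a" using w nca1 by auto
    have ga: "g (f a) = a - 1"
    proof -
      have "\<not> g (f a) \<le> a - 2" unfolding g_le_iff using f_mono[of "a - 2" a] nd by simp
      moreover have "g (f a) \<le> a - 1" unfolding g_le_iff using fa by simp
      ultimately show ?thesis by simp
    qed
    \<comment> \<open>The distance of the last point is carried along since the next step starts
      from it; it lies \<open>M - 1\<close> steps above \<open>b\<close>.\<close>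
    have climb: "(\<forall>j<M. (g ^^ j) b \<in> range f) \<and> (M > 0 \<longrightarrow> dst ((g ^^ (M - 1)) b) \<le> e + (M - 1))"
      if "dst b \<le> e" "e + M \<le> m" for b e M using that
    proof (induction M)
      case (Suc M)
      have d: "dst ((g ^^ M) b) \<le> e + M"
      proof (cases M)
        case 0 then show ?thesis using Suc by simp
      next
        case (Suc M')
        then have "f ((g ^^ M) b) = (g ^^ M') b" using Suc.IH Suc.prems fg_iff by simp
        then show ?thesis using dst_pred_le[of "(g ^^ M) b"] Suc.IH Suc.prems Suc by simp
      qed
      then have "dst ((g ^^ M) b) < m" using Suc.prems by simp
      then have "(g ^^ M) b \<in> range f" using m(3) by force
      then show ?case using Suc d less_Suc_eq by auto
    qed simp
    have A: "\<forall>j<m. (g ^^ j) a \<in> range f" using climb[of a 0 m] ca dst_0_iff by auto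
    have "dst (a - 1) \<le> 1" using dst_le_iff[of "a - 1" 1] fa cfa by simp
    then have B: "\<forall>j<m - 1. (g ^^ j) (a - 1) \<in> range f" using climb[of "a - 1" 1 "m - 1"] m(1) by auto
    obtain q where q: "m = Suc q" using m(1) by (cases m) auto
    \<comment> \<open>By adjunction the \<open>q\<close>-th iterate of such an \<open>x\<close> lies
      in \<open>[a - 1, a)\<close>, so it equals \<open>a - 1\<close>.\<close>
    have empty: "x \<notin> range f" if "(g ^^ q) (a - 1) \<le> x" "x < (g ^^ q) a" for x
    proof
      assume "x \<in> range f"
      then obtain w where w: "x = f w" by blast
      have "a - 1 \<le> (f ^^ q) x" "(f ^^ q) x < a"
        using that pow_g_le_iff[of q] by (simp_all add: not_le[symmetric])
      then have "(f ^^ m) w = a - 1" using w q by (simp add: funpow_swap1)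
      then have "\<not> dst w \<le> m" using dst_le_iff nca1 by simp
      then show False using m(2) by blast
    qed
    have "(g ^^ q) a \<le> f z \<longleftrightarrow> (g ^^ q) (a - 1) \<le> f z" for z
    proof
      assume "(g ^^ q) (a - 1) \<le> f z"
      then show "(g ^^ q) a \<le> f z" using empty[of "f z"] by (meson not_le rangeI)
    next
      assume "(g ^^ q) a \<le> f z"
      moreover have "(g ^^ q) (a - 1) \<le> (g ^^ q) a"
        by (simp add: mono_def funpow_mono g_mono)
      ultimately show "(g ^^ q) (a - 1) \<le> f z" by simp
    qed
    then have "g ((g ^^ q) a) = g ((g ^^ q) (a - 1))"
      by (metis g_le_iff le_fg order_antisym)
    then show ?thesis using A B ga q by auto
  qed
  ultimately show ?thesis unfolding sequence_cond_def using m(1) by auto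
qed

section \<open>From the sequence back to the quiver\<close>

context
  fixes m assumes seq: "sequence_cond m"
begin

lemma seq_a: "doubled a \<Longrightarrow> j < m \<Longrightarrow> (g ^^ j) a \<in> range f"
  and seq_a': "doubled a \<Longrightarrow> Suc j < m \<Longrightarrow> (g ^^ j) (g (f a)) \<in> range f"
  and seq_eq: "doubled a \<Longrightarrow> (g ^^ m) a = (g ^^ m) (g (f a))"
  and m_pos: "m \<ge> 1"
  and seq_ex: "\<exists>a. doubled a"
  using seq unfolding sequence_cond_def by blast+

text \<open>Two neighbouring doubled points have the same value under \<open>f\<close>, so the last
  clause sends both \<open>g\<close>-orbits to the same point at exponent \<open>m\<close>. But both
  stay in the image of \<open>f\<close> before that, which keeps them apart.\<close>

lemma not_doubled_pred:
  assumes a: "doubled a" shows "\<not> doubled (a - 1)"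
proof
  assume b: "doubled (a - 1)"
  have "(g ^^ j) (a - 1) < (g ^^ j) a" if "j \<le> m" for j using that
    by (induction j) (simp_all add: g_strict seq_a[OF a] seq_a[OF b])
  moreover have "g (f (a - 1)) = g (f a)" using a doubled_def by simp
  then have "(g ^^ m) (a - 1) = (g ^^ m) a" using seq_eq a b by simp
  ultimately show False by (metis le_refl less_irrefl)
qed

lemma gf_doubled: "doubled a \<Longrightarrow> g (f a) = a - 1"
  using not_doubled_pred[of a] not_doubled_iff[of "a - 1"] doubled_def by simp

text \<open>A cyclic point has ancestors of depth \<open>m\<close>. By adjunction such an ancestor
  of \<open>a - 1\<close> would separate \<open>g\<^sup>m (a - 1)\<close> from
  \<open>g\<^sup>m a\<close>, which the last clause makes equal.\<close>

lemma pred_not_cyc: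
  assumes a: "doubled a" shows "\<not> cyc (a - 1)"
proof
  assume "cyc (a - 1)"
  then obtain w where "(f ^^ m) w = a - 1" using cyc_pow_pred by blast
  then have "(g ^^ m) (a - 1) \<le> w" "\<not> (g ^^ m) a \<le> w" using pow_g_le_iff by auto
  then show False using seq_eq[OF a] gf_doubled[OF a] by simp
qed

text \<open>If the orbit of \<open>a - 1\<close> stayed in the image for one more exponent, it would
  remain strictly below that of \<open>a\<close> up to exponent \<open>m\<close>, where they have to
  agree. The point found is the leaf at the top of the branch through \<open>a - 1\<close>.\<close>

lemma seq_leaf:
  assumes a: "doubled a" shows "(g ^^ (m - 1)) (a - 1) \<notin> range f"
proof
  assume r: "(g ^^ (m - 1)) (a - 1) \<in> range f"
  have r': "j < m \<Longrightarrow> (g ^^ j) (a - 1) \<in> range f" for j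
    using seq_a'[OF a, of j] gf_doubled[OF a] r by (cases "Suc j = m") auto
  have "(g ^^ j) (a - 1) < (g ^^ j) a" if "j \<le> m" for j using that
    by (induction j) (simp_all add: g_strict seq_a[OF a] r')
  then show False using seq_eq[OF a] gf_doubled[OF a] by (metis le_refl less_irrefl)
qed

lemma seq_leaf_pow:
  assumes a: "doubled a" shows "(f ^^ (m - 1)) ((g ^^ (m - 1)) (a - 1)) = a - 1"
proof -
  have "(f ^^ j) ((g ^^ j) (a - 1)) = a - 1" if "j < m" for j using that
  proof (induction j)
    case (Suc j)
    then have "f (g ((g ^^ j) (a - 1))) = (g ^^ j) (a - 1)"
      using seq_a'[OF a, of j] gf_doubled[OF a] fg_iff by simp
    then show ?case using Suc by (simp add: funpow_swap1)
  qed simp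
  then show ?thesis using m_pos by simp
qed

text \<open>
  Modulo \<open>n\<close> there are as many doubled vertices as leaves: \<open>f\<close> is injective on the vertices that
  are not doubled, with the same image. Hence the injection of \<open>seq_leaf\<close> is onto.
\<close>

lemma leaf_pow:
  assumes L: "L \<notin> range f"
  shows "doubled ((f ^^ (m - 1)) L + 1)"
proof -
  define r where "r x = x mod int n" for x
  have r_eq: "\<exists>k. r x = x + k * int n" for x unfolding r_def using window_rep by metis
  have r_in: "r x \<in> window" for x using n_pos by (simp add: r_def window_def)
  have r_id: "r x = x" if "x \<in> window" for x using that by (simp add: r_def window_def)
  have r_shift: "r (x + k * int n) = r x" for x k by (simp add: r_def)
  have r_eqD: "\<exists>k. y = x + k * int n" if "r x = r y" for x y
    using that unfolding r_def by (metis mod_eqE mult.commute)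
  define W0 where "W0 = {a\<in>window. \<not> doubled a}"
  define W1 where "W1 = {a\<in>window. doubled a}"
  define R0 where "R0 = {y\<in>window. y \<in> range f}"
  define R1 where "R1 = {y\<in>window. y \<notin> range f}"
  have range_shift: "x + k * int n \<in> range f \<longleftrightarrow> x \<in> range f" for x k
    by (metis f_shift g_shift fg_iff add_right_cancel)
  have inj0: "inj_on (r \<circ> f) W0"
  proof (rule inj_onI)
    fix x y assume xy: "x \<in> W0" "y \<in> W0" "(r \<circ> f) x = (r \<circ> f) y"
    then obtain k where k: "f y = f x + k * int n" using r_eqD[of "f x" "f y"] by auto
    have "f (x + k * int n) = f y" using k f_shift by simp
    moreover have "\<not> doubled (x + k * int n)" "\<not> doubled y"
      using xy doubled_shift by (auto simp: W0_def)
    ultimately have "x + k * int n = y" by (metis not_doubled_iff)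
    then show "x = y" using r_id[of x] r_id[of y] r_shift[of x k] xy(1,2) by (simp add: W0_def)
  qed
  have im0: "(r \<circ> f) ` W0 = R0"
  proof (intro equalityI subsetI)
    fix y assume "y \<in> (r \<circ> f) ` W0"
    then obtain x where x: "y = r (f x)" by auto
    obtain k where "y = f x + k * int n" using r_eq x by blast
    then have "y \<in> range f" using range_shift by simp
    then show "y \<in> R0" using x r_in by (simp add: R0_def)
  next
    fix y assume y: "y \<in> R0"
    then obtain x where x: "y = f x" by (auto simp: R0_def)
    obtain k where k: "r (g (f x)) = g (f x) + k * int n" using r_eq by blast
    have "\<not> doubled (r (g (f x)))" unfolding k using doubled_shift not_doubled_gf by blast
    then have "r (g (f x)) \<in> W0" using r_in W0_def by blast
    moreover have "(r \<circ> f) (r (g (f x))) = y"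
      using k r_shift x y r_id by (simp add: f_shift fgf R0_def)
    ultimately show "y \<in> (r \<circ> f) ` W0" by (metis imageI)
  qed
  have fin: "finite W0" "finite W1" "finite R0" "finite R1"
    using finite_window by (auto simp: W0_def W1_def R0_def R1_def)
  have "W0 \<union> W1 = window" "W0 \<inter> W1 = {}" "R0 \<union> R1 = window" "R0 \<inter> R1 = {}"
    unfolding W0_def W1_def R0_def R1_def by blast+
  then have "card W0 + card W1 = card window" "card R0 + card R1 = card window"
    using card_Un_disjoint fin by metis+
  moreover have "card W0 = card R0" using card_image[OF inj0] im0 by simp
  ultimately have cards: "card W1 = card R1" by simp
  define h where "h a = r ((g ^^ (m - 1)) (a - 1))" for a
  have h_pow: "\<exists>k. (f ^^ (m - 1)) (h a) = a - 1 + k * int n" if "doubled a" for a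
    unfolding h_def using r_eq[of "(g ^^ (m - 1)) (a - 1)"] seq_leaf_pow[OF that]
    by (metis pow_f_shift)
  \<comment> \<open>The doubled point is recovered by walking \<open>m - 1\<close> steps down from
    its leaf.\<close>
  have "inj_on h W1"
  proof (rule inj_onI)
    fix x y assume xy: "x \<in> W1" "y \<in> W1" "h x = h y"
    obtain k l where "(f ^^ (m - 1)) (h x) = x - 1 + k * int n" "(f ^^ (m - 1)) (h y) = y - 1 + l * int n"
      using h_pow xy(1,2) unfolding W1_def by blast
    then have "y = x + (k - l) * int n" using xy(3) by (simp add: algebra_simps)
    then have "r x = r y" using r_shift by metis
    then show "x = y" using xy r_id by (simp add: W1_def)
  qed
  moreover have "h ` W1 \<subseteq> R1"
  proof
    fix y assume "y \<in> h ` W1"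
    then obtain a where a: "doubled a" "y = h a" by (auto simp: W1_def)
    obtain k where k: "h a = (g ^^ (m - 1)) (a - 1) + k * int n" unfolding h_def using r_eq by blast
    then have "h a \<notin> range f" using seq_leaf[OF a(1)] range_shift by simp
    moreover have "h a \<in> window" unfolding h_def by (rule r_in)
    ultimately show "y \<in> R1" using a(2) R1_def by blast
  qed
  ultimately have surj: "h ` W1 = R1"
    using card_subset_eq[OF fin(4), of "h ` W1"] card_image[of h W1] cards by simp
  obtain k where k: "r L = L + k * int n" using r_eq by blast
  then have "r L \<notin> range f" using L range_shift by simp
  then have "r L \<in> R1" using r_in R1_def by blast
  then obtain a where a: "doubled a" "r L = h a" using surj by (auto simp: W1_def)
  obtain l where l: "(f ^^ (m - 1)) (h a) = a - 1 + l * int n" using h_pow[OF a(1)] by blast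
  have "(f ^^ (m - 1)) L + k * int n = a - 1 + l * int n"
    using k a l pow_f_shift by simp
  then have "(f ^^ (m - 1)) L + 1 = a + (l - k) * int n" by (simp add: algebra_simps)
  then show ?thesis using doubled_shift a(1) by simp
qed

lemma pow_leaf_Suc:
  assumes L: "L \<notin> range f"
  shows "(f ^^ m) L = f ((f ^^ (m - 1)) L + 1)"
proof -
  have "(f ^^ m) L = f ((f ^^ (m - 1)) L)" using m_pos by (cases m) auto
  then show ?thesis using leaf_pow[OF L] doubled_def by simp
qed

text \<open>
  A noncyclic doubled vertex \<open>a\<close> has, at least \<open>m\<close> steps above it, a leaf; the doubled vertex below
  that leaf is an ancestor of \<open>a\<close> of larger distance.
\<close>

lemma doubled_cyc: "doubled a \<Longrightarrow> cyc a"
proof (rule ccontr)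
  assume "doubled a" "\<not> cyc a"
  then have ex: "doubled a \<and> \<not> cyc a" by blast
  obtain D where D: "\<And>x. dst x \<le> D" using dst_bounded by blast
  have "\<exists>a. (doubled a \<and> \<not> cyc a) \<and> (\<forall>b. doubled b \<and> \<not> cyc b \<longrightarrow> dst b \<le> dst a)"
  proof (rule ex_has_greatest_nat)
    show "doubled a \<and> \<not> cyc a" by (rule ex)
    show "\<forall>b. doubled b \<and> \<not> cyc b \<longrightarrow> dst b < Suc D" using D by (simp add: less_Suc_eq_le)
  qed
  then obtain a where a: "doubled a" "\<not> cyc a"
    and amax: "\<And>b. doubled b \<Longrightarrow> \<not> cyc b \<Longrightarrow> dst b \<le> dst a"
    by blast
  have pow: "(f ^^ j) ((g ^^ j) a) = a" if "j \<le> m" for j using that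
  proof (induction j)
    case (Suc j)
    then have "f (g ((g ^^ j) a)) = (g ^^ j) a" using seq_a[OF a(1), of j] fg_iff by simp
    then show ?case using Suc by (simp add: funpow_swap1)
  qed simp
  define w where "w = (g ^^ m) a"
  have w: "(f ^^ m) w = a" using pow w_def by simp
  then have "\<not> cyc w" using a cyc_pow by blast
  then obtain L t where L: "L \<notin> range f" "(f ^^ t) L = w" using leaf_ancestor by blast
  define b where "b = (f ^^ (m - 1)) L + 1"
  have b: "doubled b" unfolding b_def using leaf_pow[OF L(1)] .
  have "(f ^^ (t + 1)) b = (f ^^ t) ((f ^^ m) L)"
    using pow_leaf_Suc[OF L(1)] b_def by (simp add: funpow_swap1)
  also have "\<dots> = (f ^^ m) ((f ^^ t) L)" by (metis add.commute comp_apply funpow_add)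
  finally have ba: "(f ^^ (t + 1)) b = a" using L w by simp
  then have "\<not> cyc b" using a(2) cyc_pow by metis
  moreover have "dst b = (t + 1) + dst a" using dst_pow[of "t + 1" b] ba a(2) by simp
  ultimately show False using amax[OF b] by simp
qed

text \<open>After \<open>m - 1\<close> steps a leaf arrives at the noncyclic left neighbour of a
  doubled point \<open>a\<close>; the next step is \<open>f a\<close>, the image of the cyclic point
  \<open>a\<close>.\<close>

lemma dst_leaf:
  assumes L: "L \<notin> range f" shows "dst L = m"
proof -
  have d: "doubled ((f ^^ (m - 1)) L + 1)" using leaf_pow[OF L] .
  have "cyc ((f ^^ m) L)" using pow_leaf_Suc[OF L] doubled_cyc[OF d] cyc_f by simp
  moreover have "\<not> cyc ((f ^^ (m - 1)) L)" using pred_not_cyc[OF d] by simp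
  ultimately show ?thesis using dst_le_iff[of L m] dst_le_iff[of L "m - 1"] m_pos by linarith
qed

lemma sequence_imp_quiver: "quiver_cond m"
proof -
  have le: "dst x \<le> m" for x
  proof (cases "cyc x")
    case False
    then obtain L t where L: "L \<notin> range f" "(f ^^ t) L = x" using leaf_ancestor by blast
    then show ?thesis using dst_pow[of t L] dst_leaf[OF L(1)] False by simp
  qed (use dst_0_iff[of x] in simp)
  obtain a where a: "doubled a" using seq_ex by blast
  have "(g ^^ (m - 1)) (a - 1) \<notin> range f" using seq_leaf[OF a] .
  then have "\<exists>x. dst x = m" using dst_leaf by blast
  moreover have d: "doubled (w + 1)" if "f w = f (w + 1)" for w using that by (simp add: doubled_def)
  have "cyc (f w)" if "f w = f (w + 1)" for w
    using cyc_f[OF doubled_cyc[OF d[OF that]]] that by simp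
  moreover have "\<not> cyc w" if "f w = f (w + 1)" for w using pred_not_cyc[OF d[OF that]] by simp
  moreover have "f w \<noteq> f (w + 2)" for w
  proof
    assume eq: "f w = f (w + 2)"
    then have "f (w + 1) = f (w + 2)" "f w = f (w + 1)"
      using f_mono[of w "w + 1"] f_mono[of "w + 1" "w + 2"] by auto
    moreover have "w + 2 - 1 = w + 1" "w + 1 - 1 = w" by simp_all
    ultimately have "doubled (w + 2)" "doubled (w + 2 - 1)" by (simp_all only: doubled_def)
    then show False using not_doubled_pred by blast
  qed
  ultimately show ?thesis unfolding quiver_cond_def using m_pos le dst_leaf by auto
qed

end

lemma quiver_iff_sequence: "quiver_cond m \<longleftrightarrow> sequence_cond m"
  using quiver_imp_sequence sequence_imp_quiver by blast

text \<open>
  The minimal injective resolution of the interval module \<open>[a, f a)\<close> has terms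
  \<open>[u (j + 2), u j)\<close> and cosyzygies \<open>[u (j + 1), u j)\<close>; once a cosyzygy vanishes the
  sequence is constant, so that all later intervals are empty.
\<close>

fun u :: "int \<Rightarrow> nat \<Rightarrow> int" where
  "u a 0 = f a"
| "u a (Suc 0) = a"
| "u a (Suc (Suc j)) = (if u a (Suc j) = u a j then u a j else g (u a j))"

declare u.simps(3) [simp del]

lemma u_step: "u a (Suc j) \<noteq> u a j \<Longrightarrow> u a (Suc (Suc j)) = g (u a j)"
  by (simp add: u.simps(3))

lemma u_const: "u a (Suc j) = u a j \<Longrightarrow> u a (Suc (Suc j)) = u a (Suc j)"
  by (simp add: u.simps(3))

text \<open>Keeps the cosyzygies admissible: possibly empty, and no longer than the projective at
  their start. The second bound is what the adjunction needs to see that the next end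
  \<open>g (u a j)\<close> does not exceed \<open>u a (Suc j)\<close>.\<close>

lemma u_bounds: "u a (Suc j) \<le> u a j \<and> u a j \<le> f (u a (Suc j))"
proof (induction j)
  case 0 show ?case using f_gt[of a] by simp
next
  case (Suc j)
  show ?case
  proof (cases "u a (Suc j) = u a j")
    case True then show ?thesis using f_gt[of "u a j"] u_const by simp
  next
    case False
    then show ?thesis using Suc le_fg[of "u a j"] g_le_iff[of "u a j" "u a (Suc j)"] u_step by simp
  qed
qed

lemma u_dec: "u a (Suc j) \<le> u a j" using u_bounds by blast

lemma u_le_f: "u a j \<le> f (u a (Suc (Suc j)))"
  using le_fg[of "u a j"] f_gt[of "u a j"] by (simp add: u.simps(3) order_less_imp_le)

lemma u_0_neq: "u a (Suc 0) \<noteq> u a 0" using f_gt[of a] by simp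

lemma u_const_add: "u a (Suc j) = u a j \<Longrightarrow> u a (Suc (j + i)) = u a (j + i)"
  by (induction i) (use u_const in auto)

lemma u_const_le: "u a (Suc i) = u a i \<Longrightarrow> i \<le> j \<Longrightarrow> u a (Suc j) = u a j"
  using u_const_add[of a i "j - i"] by simp

text \<open>Once the cosyzygy vanishes the term is the zero module, which is projective; hence the
  first alternative.\<close>

definition proj_term :: "int \<Rightarrow> nat \<Rightarrow> bool" where
  "proj_term a j \<longleftrightarrow> u a (Suc j) = u a j \<or> f (u a (Suc (Suc j))) = u a j"

lemma proj_term_iff: "u a (Suc j) \<noteq> u a j \<Longrightarrow> proj_term a j \<longleftrightarrow> u a j \<in> range f"
  by (simp add: proj_term_def fg_iff u_step)

text \<open>Equality of neighbours says that term \<open>d + 1\<close> vanishes while term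
  \<open>d\<close> does not; \<open>proj_term\<close> says that the terms before \<open>d\<close>
  are projective and term \<open>d\<close> is not. A term is a sum over all vertices, so each
  negation asks for one vertex only.\<close>

definition resolution_cond :: "nat \<Rightarrow> bool" where
  "resolution_cond d \<longleftrightarrow> d \<ge> 1 \<and> (\<forall>a. u a (Suc (Suc d)) = u a (Suc d)) \<and>
     \<not> (\<forall>a. u a (Suc d) = u a d) \<and> (\<forall>a. \<forall>j<d. proj_term a j) \<and> \<not> (\<forall>a. proj_term a d)"

text \<open>One application of \<open>g\<close> advances \<open>u\<close> by two places, so
  strictness passes from a pair of neighbours to the pair two places later as long as both ends lie
  in the image of \<open>f\<close>. The induction therefore carries two consecutive pairs; it starts
  with \<open>a < f a\<close> and, \<open>a\<close> being doubled,
  \<open>g (f a) < a\<close>.\<close>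

lemma u_strict:
  assumes "doubled a" "\<forall>i<d. u a (Suc i) \<noteq> u a i \<longrightarrow> u a i \<in> range f" "j \<le> d"
  shows "u a (Suc j) \<noteq> u a j"
proof -
  have "u a (Suc j) \<noteq> u a j \<and> (j < d \<longrightarrow> u a (Suc (Suc j)) \<noteq> u a (Suc j))" using assms(3)
  proof (induction j)
    case 0
    then show ?case using assms(1) f_gt[of a] doubled_iff[of a] u_step[of a 0] by simp
  next
    case (Suc j)
    show ?case
    proof (intro conjI impI)
      show ne: "u a (Suc (Suc j)) \<noteq> u a (Suc j)" using Suc by simp
      assume "Suc j < d"
      have ne0: "u a (Suc j) \<noteq> u a j" using Suc by simp
      have "u a (Suc j) < u a j" using ne0 u_dec by (simp add: order_less_le)
      moreover have "u a j \<in> range f" using assms(2) ne0 \<open>Suc j < d\<close> by simp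
      moreover have "u a (Suc j) \<in> range f" using assms(2) ne \<open>Suc j < d\<close> by simp
      ultimately have "g (u a (Suc j)) < g (u a j)" using g_strict by blast
      then show "u a (Suc (Suc (Suc j))) \<noteq> u a (Suc (Suc j))"
        using ne0 ne by (simp add: u_step)
    qed
  qed
  then show ?thesis ..
qed

lemma u_pow:
  assumes "\<forall>j<d. u a (Suc j) \<noteq> u a j"
  shows "2 * j + 1 \<le> Suc d \<Longrightarrow> u a (2 * j + 1) = (g ^^ j) a"
    and "2 * j + 2 \<le> Suc d \<Longrightarrow> u a (2 * j + 2) = (g ^^ j) (g (f a))"
proof -
  have step: "u a (Suc (Suc i)) = g (u a i)" if "i < d" for i using u_step assms that by blast
  show "2 * j + 1 \<le> Suc d \<Longrightarrow> u a (2 * j + 1) = (g ^^ j) a"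
  proof (induction j)
    case (Suc j)
    then show ?case using step[of "2 * j + 1"] by simp
  qed simp
  show "2 * j + 2 \<le> Suc d \<Longrightarrow> u a (2 * j + 2) = (g ^^ j) (g (f a))"
  proof (induction j)
    case 0 then show ?case using step[of 0] by (simp add: numeral_2_eq_2)
  next
    case (Suc j)
    then show ?case using step[of "2 * j + 2"] by simp
  qed
qed

text \<open>P(a) is then injective: \<open>g (f a) = a\<close>, so places 1 and 2 agree and the
  resolution is over after its first term.\<close>

lemma not_doubled_u: "\<not> doubled a \<Longrightarrow> u a (Suc (Suc j)) = u a (Suc j)"
  using u_const_le[of a 1 "Suc j"] u_step[OF u_0_neq[of a]] not_doubled_iff[of a] by simp

lemma not_doubled_proj_term: "\<not> doubled a \<Longrightarrow> proj_term a j"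
  using not_doubled_u[of a] proj_term_iff[of a 0] u_0_neq[of a] by (cases j) (auto simp: proj_term_def)

lemma u_even_cases:
  assumes "doubled a" "m \<ge> 1"
    and "\<forall>i<2 * m. u a (Suc i) \<noteq> u a i \<longrightarrow> u a i \<in> range f"
  shows "u a (Suc (2 * m)) \<noteq> u a (2 * m)" "u a (2 * m) = (g ^^ (m - 1)) (g (f a))"
    "u a (Suc (Suc (2 * m))) = u a (Suc (2 * m)) \<longleftrightarrow> (g ^^ m) a = (g ^^ m) (g (f a))"
proof -
  have ne: "u a (Suc j) \<noteq> u a j" if "j \<le> 2 * m" for j using u_strict assms(1,3) that by blast
  then have ne': "\<forall>j<Suc (2 * m). u a (Suc j) \<noteq> u a j" by simp
  show "u a (Suc (2 * m)) \<noteq> u a (2 * m)" using ne by simp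
  show "u a (2 * m) = (g ^^ (m - 1)) (g (f a))"
    using u_pow(2)[OF ne', of "m - 1"] assms(2) by (cases m) auto
  show "u a (Suc (Suc (2 * m))) = u a (Suc (2 * m)) \<longleftrightarrow> (g ^^ m) a = (g ^^ m) (g (f a))"
    using u_pow(1)[OF ne', of m] u_pow(2)[OF ne', of m] by auto
qed

lemma resolution_iff_sequence: "resolution_cond (2 * m) \<longleftrightarrow> sequence_cond m"
proof
  assume L: "resolution_cond (2 * m)"
  then have m: "m \<ge> 1" and ends: "\<And>a. u a (Suc (Suc (2 * m))) = u a (Suc (2 * m))"
    and nz: "\<not> (\<forall>a. u a (Suc (2 * m)) = u a (2 * m))"
    and rows: "\<And>a j. j < 2 * m \<Longrightarrow> proj_term a j"
    unfolding resolution_cond_def by auto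
  have "\<exists>a. doubled a"
  proof (rule ccontr)
    assume "\<not> ?thesis"
    then have "u a (Suc (2 * m)) = u a (2 * m)" for a
      using not_doubled_u[of a "2 * m - 1"] m by (cases m) auto
    then show False using nz by blast
  qed
  moreover have "(\<forall>j<m. (g ^^ j) a \<in> range f) \<and>
        (\<forall>j. Suc j < m \<longrightarrow> (g ^^ j) (g (f a)) \<in> range f) \<and>
        (g ^^ m) a = (g ^^ m) (g (f a))" if a: "doubled a" for a
  proof -
    have pr': "\<forall>i<2 * m. u a (Suc i) \<noteq> u a i \<longrightarrow> u a i \<in> range f"
      using rows proj_term_iff by blast
    have ne: "\<forall>j<2 * m. u a (Suc j) \<noteq> u a j" using u_strict[OF a pr'] by simp
    have "(g ^^ j) a \<in> range f" if "j < m" for j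
    proof -
      have "2 * j + 1 < 2 * m" using that by simp
      then have "u a (2 * j + 1) \<in> range f" using pr' ne by blast
      then show ?thesis using u_pow(1)[OF ne, of j] that by simp
    qed
    moreover have "(g ^^ j) (g (f a)) \<in> range f" if "Suc j < m" for j
    proof -
      have "2 * j + 2 < 2 * m" using that by simp
      then have "u a (2 * j + 2) \<in> range f" using pr' ne by blast
      then show ?thesis using u_pow(2)[OF ne, of j] that by simp
    qed
    ultimately show ?thesis using u_even_cases(3)[OF a m pr'] ends by blast
  qed
  ultimately show "sequence_cond m" unfolding sequence_cond_def using m by blast
next
  assume R: "sequence_cond m"
  note m = m_pos[OF R]
  \<comment> \<open>Strong induction, because identifying \<open>u a i\<close> with a point of one
    of the two orbits requires all earlier neighbours to be distinct, and this comes from the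
    earlier places lying in the image.\<close>
  have pr': "u a i \<in> range f" if a: "doubled a" and "i < 2 * m" for a i using that(2)
  proof (induction i rule: less_induct)
    case (less i)
    then have "\<forall>j<i. u a (Suc j) \<noteq> u a j \<longrightarrow> u a j \<in> range f" by simp
    then have ne: "\<forall>j<i. u a (Suc j) \<noteq> u a j" using u_strict[OF a, of i] by simp
    consider "i = 0" | j where "i = 2 * j + 1" | j where "i = 2 * j + 2"
    proof (cases "even i")
      case True
      then obtain k where "i = 2 * k" by blast
      then show thesis using that(1) that(3)[of "k - 1"] by (cases k) auto
    next
      case False
      then show thesis using that(2) by (metis oddE)
    qed
    then show ?case
    proof cases
      case 1 then show ?thesis by simp
    next
      case (2 j)
      then show ?thesis using u_pow(1)[OF ne, of j] seq_a[OF R a, of j] less.prems by simp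
    next
      case (3 j)
      then show ?thesis using u_pow(2)[OF ne, of j] seq_a'[OF R a, of j] less.prems by simp
    qed
  qed
  have ends: "u a (Suc (Suc (2 * m))) = u a (Suc (2 * m))" for a
    using u_even_cases(3)[OF _ m] pr' seq_eq[OF R] not_doubled_u by (cases "doubled a") blast+
  obtain a where a: "doubled a" using seq_ex[OF R] by blast
  \<comment> \<open>Place \<open>2 * m\<close> is the leaf above \<open>a - 1\<close>; this bounds
    the dominant dimension from above.\<close>
  have "u a (2 * m) \<notin> range f"
    using u_even_cases(2)[OF a m] pr'[OF a] seq_leaf[OF R a] gf_doubled[OF R a] by simp
  then have "\<not> proj_term a (2 * m)" "u a (Suc (2 * m)) \<noteq> u a (2 * m)"
    using proj_term_iff u_even_cases(1)[OF a m] pr'[OF a] by blast+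
  moreover have "proj_term b j" if "j < 2 * m" for b j
    using that pr' proj_term_def proj_term_iff not_doubled_proj_term by (cases "doubled b") blast+
  ultimately show "resolution_cond (2 * m)" unfolding resolution_cond_def using m ends by auto
qed


section \<open>The functional graph modulo \<open>n\<close>\<close>

context
  fixes \<gamma> :: "nat \<Rightarrow> nat"
  assumes \<gamma>: "\<And>a. a < n \<Longrightarrow> \<gamma> a = nat (f (int a) mod int n)"
begin

abbreviation res :: "int \<Rightarrow> nat" where "res \<equiv> residue n"

lemma res_less: "res z < n" using residue_less[OF n_pos] .

lemma int_res: "\<exists>k. int (res z) = z + k * int n" using int_residue[OF n_pos] by blast

lemmas res_shift = residue_shift[of n]
lemmas res_int = residue_int[of _ n]

lemma res_eqD: "res w = res z \<Longrightarrow> \<exists>k. z = w + k * int n" using residue_eq_iff[OF n_pos] by blast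

lemma \<gamma>_res: "\<gamma> (res z) = res (f z)"
proof -
  obtain k where "int (res z) = z + k * int n" using int_res by blast
  then show ?thesis using \<gamma>[OF res_less[of z]] f_shift[of z k] by (simp add: residue_def)
qed

lemma pow_\<gamma>_res: "(\<gamma> ^^ d) (res z) = res ((f ^^ d) z)"
  by (induction d) (simp_all add: \<gamma>_res)

lemma cyclic_res: "cyclic_vertex \<gamma> (res z) \<longleftrightarrow> cyc z"
  unfolding cyclic_vertex_def cyc_def pow_\<gamma>_res using res_eqD res_shift by metis

lemma dist_res: "vertex_dist \<gamma> (res z) = dst z"
  unfolding vertex_dist_def dst_def pow_\<gamma>_res cyclic_res ..

lemma predecessors_res: "predecessors n \<gamma> (res y) = res ` {w. f w = y}"
proof (intro equalityI subsetI)
  fix b assume "b \<in> predecessors n \<gamma> (res y)"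
  then have b: "b < n" "res (f (int b)) = res y"
    using \<gamma>_res[of "int b"] by (auto simp: predecessors_def res_int)
  obtain k where "y = f (int b) + k * int n" using res_eqD[OF b(2)] by blast
  then have "f (int b + k * int n) = y" using f_shift by simp
  moreover have "res (int b + k * int n) = b" using b(1) res_shift res_int by simp
  ultimately show "b \<in> res ` {w. f w = y}" by (metis (mono_tags) imageI mem_Collect_eq)
next
  fix b assume "b \<in> res ` {w. f w = y}"
  then show "b \<in> predecessors n \<gamma> (res y)" using res_less \<gamma>_res by (auto simp: predecessors_def)
qed

lemma card_predecessors: "card (predecessors n \<gamma> (res y)) = card {w. f w = y}"
proof -
  \<comment> \<open>Points of one fibre in the same residue class differ by
    \<open>k * int n\<close>, and so do their images, which forces
    \<open>k * int n = 0\<close>.\<close>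
  have "inj_on res {w. f w = y}"
  proof (rule inj_onI)
    fix w z assume wz: "w \<in> {w. f w = y}" "z \<in> {w. f w = y}" "res w = res z"
    then obtain k where k: "z = w + k * int n" using res_eqD by blast
    then have "k * int n = 0" using wz f_shift[of w k] by simp
    then show "w = z" using k by simp
  qed
  then show ?thesis unfolding predecessors_res by (rule card_image)
qed

lemma finite_fibre: "finite {w. f w = y}"
proof (rule finite_subset)
  show "{w. f w = y} \<subseteq> {g y..y}"
    using g_le_iff f_gt by (auto simp: order_less_imp_le)
qed simp

lemma card_fibre_le_1: "card {w. f w = y} \<le> 1 \<longleftrightarrow> (\<forall>w. f w = y \<longrightarrow> f (w + 1) \<noteq> y)"
proof
  assume "card {w. f w = y} \<le> 1"
  then show "\<forall>w. f w = y \<longrightarrow> f (w + 1) \<noteq> y"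
    using card_le_Suc0_iff_eq[OF finite_fibre, of y] by force
next
  assume R: "\<forall>w. f w = y \<longrightarrow> f (w + 1) \<noteq> y"
  have "w = z" if "f w = y" "f z = y" "w \<le> z" for w z
    using R that f_mono[of w "w + 1"] f_mono[of "w + 1" z] by fastforce
  then have "\<forall>w\<in>{w. f w = y}. \<forall>z\<in>{w. f w = y}. w = z" by (metis linear mem_Collect_eq)
  then show "card {w. f w = y} \<le> 1" using card_le_Suc0_iff_eq[OF finite_fibre] by simp
qed

lemma card_fibre_le_2: "card {w. f w = y} \<le> 2 \<longleftrightarrow> (\<forall>w. f w = y \<longrightarrow> f (w + 2) \<noteq> y)"
proof
  assume c: "card {w. f w = y} \<le> 2"
  show "\<forall>w. f w = y \<longrightarrow> f (w + 2) \<noteq> y"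
  proof (intro allI impI notI)
    fix w assume "f w = y" "f (w + 2) = y"
    then have "{w, w + 1, w + 2} \<subseteq> {w. f w = y}"
      using f_mono[of w "w + 1"] f_mono[of "w + 1" "w + 2"] by auto
    then have "card {w, w + 1, w + 2} \<le> card {w. f w = y}" by (rule card_mono[OF finite_fibre])
    also have "\<dots> \<le> 2" by (rule c)
    finally
    show False by simp
  qed
next
  assume R: "\<forall>w. f w = y \<longrightarrow> f (w + 2) \<noteq> y"
  \<comment> \<open>By adjunction a nonempty fibre begins at \<open>g y\<close>; a point two or more
    places later would pull in \<open>g y + 2\<close> by monotonicity.\<close>
  have "{w. f w = y} \<subseteq> {g y, g y + 1}"
  proof
    fix w assume "w \<in> {w. f w = y}"
    then have w: "f w = y" by simp
    then have "g y \<le> w" "f (g y) = y" using g_le_iff fgf by auto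
    moreover have "\<not> g y + 2 \<le> w"
    proof
      assume "g y + 2 \<le> w"
      then have "f (g y + 2) = y"
        using f_mono[of "g y" "g y + 2"] f_mono[of "g y + 2" w] w \<open>f (g y) = y\<close> by simp
      then show False using R \<open>f (g y) = y\<close> by blast
    qed
    ultimately show "w \<in> {g y, g y + 1}" by auto
  qed
  then have "card {w. f w = y} \<le> card {g y, g y + 1}" by (intro card_mono) auto
  then show "card {w. f w = y} \<le> 2" by simp
qed

lemma leaf_res: "leaf n \<gamma> (res y) \<longleftrightarrow> y \<notin> range f"
  unfolding leaf_def predecessors_res by auto

lemma all_res: "(\<forall>a<n. P a) \<longleftrightarrow> (\<forall>z. P (res z))"
  using res_less res_int by metis

lemma max_dist_eq: "max_dist n \<gamma> = D \<longleftrightarrow> (\<forall>x. dst x \<le> D) \<and> (\<exists>x. dst x = D)"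
proof -
  have im: "vertex_dist \<gamma> ` {..<n} = range dst"
  proof (intro equalityI subsetI)
    fix d assume "d \<in> vertex_dist \<gamma> ` {..<n}"
    then obtain a where "a < n" "d = vertex_dist \<gamma> a" by auto
    then have "d = dst (int a)" using dist_res[of "int a"] res_int by simp
    then show "d \<in> range dst" by blast
  next
    fix d assume "d \<in> range dst"
    then obtain z where "d = dst z" by blast
    then have "d = vertex_dist \<gamma> (res z)" using dist_res by simp
    then show "d \<in> vertex_dist \<gamma> ` {..<n}" using res_less by blast
  qed
  have "finite (range dst)" "range dst \<noteq> {}" unfolding im[symmetric] using n_pos by (auto simp: lessThan_empty_iff)
  then show ?thesis unfolding max_dist_def im by (subst Max_eq_iff) auto
qed

lemma quiver_cond_iff:
  assumes "\<And>z. black A n I \<phi> (res z) \<longleftrightarrow> f z \<noteq> f (z + 1)"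
  shows "(max_dist n \<gamma> > 0 \<and> (\<forall>a<n. leaf n \<gamma> a \<longrightarrow> vertex_dist \<gamma> a = max_dist n \<gamma>)) \<and>
       (\<forall>a<n. \<not> cyclic_vertex \<gamma> a \<longrightarrow> card (predecessors n \<gamma> a) \<le> 1) \<and>
       (\<forall>a<n. cyclic_vertex \<gamma> a \<longrightarrow> card (predecessors n \<gamma> a) \<le> 2) \<and>
       (\<forall>a<n. cyclic_vertex \<gamma> a \<longrightarrow> black A n I \<phi> a) \<longleftrightarrow> (\<exists>D. quiver_cond D)"
    (is "?L \<longleftrightarrow> _")
proof -
  have "?L \<longleftrightarrow> (max_dist n \<gamma> > 0 \<and> (\<forall>x. x \<notin> range f \<longrightarrow> dst x = max_dist n \<gamma>)) \<and>
     (\<forall>y. \<not> cyc y \<longrightarrow> (\<forall>w. f w = y \<longrightarrow> f (w + 1) \<noteq> y)) \<and>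
     (\<forall>y. cyc y \<longrightarrow> (\<forall>w. f w = y \<longrightarrow> f (w + 2) \<noteq> y)) \<and>
     (\<forall>w. cyc w \<longrightarrow> f w \<noteq> f (w + 1))"
    unfolding all_res leaf_res dist_res cyclic_res card_predecessors card_fibre_le_1 card_fibre_le_2 assms ..
  also have "\<dots> \<longleftrightarrow> quiver_cond (max_dist n \<gamma>)"
    using max_dist_eq[of "max_dist n \<gamma>"] unfolding quiver_cond_def by (auto 0 3; metis)
  also have "\<dots> \<longleftrightarrow> (\<exists>D. quiver_cond D)"
  proof
    assume "\<exists>D. quiver_cond D"
    then obtain D where D: "quiver_cond D" by blast
    then have "max_dist n \<gamma> = D" unfolding max_dist_eq quiver_cond_def by blast
    then show "quiver_cond (max_dist n \<gamma>)" using D by simp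
  qed blast
  finally show ?thesis .
qed

end

end

section \<open>Modules over an algebra as vector spaces\<close>

locale algebra_module = R?: k_algebra A + left_module A M
  for A :: "('k::field, 'a) module" (structure) and M :: "('a, 'm) module" (structure)
begin

definition sc :: "'k \<Rightarrow> 'm \<Rightarrow> 'm" where "sc c x = (c \<odot>\<^bsub>A\<^esub> \<one>\<^bsub>A\<^esub>) \<odot>\<^bsub>M\<^esub> x"

lemma scalar_closed: "c \<odot>\<^bsub>A\<^esub> \<one>\<^bsub>A\<^esub> \<in> carrier A" by (simp add: scale_closed)

lemma sc_closed: "x \<in> carrier M \<Longrightarrow> sc c x \<in> carrier M"
  by (simp add: sc_def smult_closed scalar_closed)

lemma sc_add: "x \<in> carrier M \<Longrightarrow> sc (c + d) x = sc c x \<oplus>\<^bsub>M\<^esub> sc d x"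
  by (simp add: sc_def scale_add_left smult_l_distr scalar_closed)

lemma sc_sum: "x \<in> carrier M \<Longrightarrow> y \<in> carrier M \<Longrightarrow> sc c (x \<oplus>\<^bsub>M\<^esub> y) = sc c x \<oplus>\<^bsub>M\<^esub> sc c y"
  by (simp add: sc_def smult_r_distr scalar_closed)

lemma scalar_mult: "r \<in> carrier A \<Longrightarrow> (c \<odot>\<^bsub>A\<^esub> \<one>\<^bsub>A\<^esub>) \<otimes>\<^bsub>A\<^esub> r = c \<odot>\<^bsub>A\<^esub> r"
  by (simp add: scale_mult_left)

lemma sc_sc: "x \<in> carrier M \<Longrightarrow> sc c (sc d x) = sc (c * d) x"
  by (simp add: sc_def scale_scale scalar_closed flip: smult_assoc) (simp add: scalar_mult scalar_closed)

lemma sc_1: "x \<in> carrier M \<Longrightarrow> sc 1 x = x"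
  by (simp add: sc_def scale_one smult_one)

lemma smult_scale: "r \<in> carrier A \<Longrightarrow> x \<in> carrier M \<Longrightarrow> (c \<odot>\<^bsub>A\<^esub> r) \<odot>\<^bsub>M\<^esub> x = sc c (r \<odot>\<^bsub>M\<^esub> x)"
  by (simp add: sc_def scalar_closed flip: smult_assoc) (simp add: scalar_mult)

lemma smult_l_null: "x \<in> carrier M \<Longrightarrow> \<zero>\<^bsub>A\<^esub> \<odot>\<^bsub>M\<^esub> x = \<zero>\<^bsub>M\<^esub>"
proof -
  assume x: "x \<in> carrier M"
  have "\<zero>\<^bsub>A\<^esub> \<odot>\<^bsub>M\<^esub> x \<oplus>\<^bsub>M\<^esub> \<zero>\<^bsub>A\<^esub> \<odot>\<^bsub>M\<^esub> x = \<zero>\<^bsub>A\<^esub> \<odot>\<^bsub>M\<^esub> x"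
    using smult_l_distr[of "\<zero>\<^bsub>A\<^esub>" "\<zero>\<^bsub>A\<^esub>" x] x by simp
  then show ?thesis using smult_closed[of "\<zero>\<^bsub>A\<^esub>" x] x M.add.l_cancel_one by simp
qed

lemma smult_r_null: "r \<in> carrier A \<Longrightarrow> r \<odot>\<^bsub>M\<^esub> \<zero>\<^bsub>M\<^esub> = \<zero>\<^bsub>M\<^esub>"
proof -
  assume r: "r \<in> carrier A"
  have "r \<odot>\<^bsub>M\<^esub> \<zero>\<^bsub>M\<^esub> \<oplus>\<^bsub>M\<^esub> r \<odot>\<^bsub>M\<^esub> \<zero>\<^bsub>M\<^esub> = r \<odot>\<^bsub>M\<^esub> \<zero>\<^bsub>M\<^esub>"
    using smult_r_distr[of r "\<zero>\<^bsub>M\<^esub>" "\<zero>\<^bsub>M\<^esub>"] r by simp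
  then show ?thesis using smult_closed[of r "\<zero>\<^bsub>M\<^esub>"] r M.add.l_cancel_one by simp
qed

lemma scale_0: "r \<in> carrier A \<Longrightarrow> 0 \<odot>\<^bsub>A\<^esub> r = \<zero>\<^bsub>A\<^esub>"
proof -
  assume r: "r \<in> carrier A"
  have "0 \<odot>\<^bsub>A\<^esub> r \<oplus>\<^bsub>A\<^esub> 0 \<odot>\<^bsub>A\<^esub> r = 0 \<odot>\<^bsub>A\<^esub> r" using scale_add_left[of r 0 0] r by simp
  then show ?thesis using scale_closed[of r 0] r R.add.l_cancel_one by simp
qed

lemma sc_0: "x \<in> carrier M \<Longrightarrow> sc 0 x = \<zero>\<^bsub>M\<^esub>"
  by (simp add: sc_def scale_0 smult_l_null)

lemma smult_minus_1: "x \<in> carrier M \<Longrightarrow> (\<ominus>\<^bsub>A\<^esub> \<one>\<^bsub>A\<^esub>) \<odot>\<^bsub>M\<^esub> x = \<ominus>\<^bsub>M\<^esub> x"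
proof -
  assume x: "x \<in> carrier M"
  have "(\<ominus>\<^bsub>A\<^esub> \<one>\<^bsub>A\<^esub>) \<odot>\<^bsub>M\<^esub> x \<oplus>\<^bsub>M\<^esub> x = \<zero>\<^bsub>M\<^esub>"
    using smult_l_distr[of "\<ominus>\<^bsub>A\<^esub> \<one>\<^bsub>A\<^esub>" "\<one>\<^bsub>A\<^esub>" x] x by (simp add: smult_one R.l_neg smult_l_null)
  then show ?thesis using x smult_closed[of "\<ominus>\<^bsub>A\<^esub> \<one>\<^bsub>A\<^esub>" x] M.minus_equality by simp
qed

lemma submoduleI:
  assumes "H \<subseteq> carrier M" "\<zero>\<^bsub>M\<^esub> \<in> H"
    and "\<And>x y. x \<in> H \<Longrightarrow> y \<in> H \<Longrightarrow> x \<oplus>\<^bsub>M\<^esub> y \<in> H"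
    and "\<And>r x. r \<in> carrier A \<Longrightarrow> x \<in> H \<Longrightarrow> r \<odot>\<^bsub>M\<^esub> x \<in> H"
  shows "submodule H A M"
proof (intro submodule.intro subgroup.intro submodule_axioms.intro)
  fix x assume x: "x \<in> H"
  then have "\<ominus>\<^bsub>M\<^esub> x \<in> H"
    using assms(4)[of "\<ominus>\<^bsub>A\<^esub> \<one>\<^bsub>A\<^esub>" x] smult_minus_1[of x] assms(1) by auto
  then show "inv\<^bsub>add_monoid M\<^esub> x \<in> H" by (simp add: a_inv_def)
qed (use assms in auto)

lemma submoduleD:
  assumes "submodule H A M"
  shows "H \<subseteq> carrier M" "\<zero>\<^bsub>M\<^esub> \<in> H"
    and "\<And>x y. x \<in> H \<Longrightarrow> y \<in> H \<Longrightarrow> x \<oplus>\<^bsub>M\<^esub> y \<in> H"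
    and "\<And>r x. r \<in> carrier A \<Longrightarrow> x \<in> H \<Longrightarrow> r \<odot>\<^bsub>M\<^esub> x \<in> H"
proof -
  interpret s: submodule H A M by fact
  show "H \<subseteq> carrier M" "\<zero>\<^bsub>M\<^esub> \<in> H"
    and "\<And>x y. x \<in> H \<Longrightarrow> y \<in> H \<Longrightarrow> x \<oplus>\<^bsub>M\<^esub> y \<in> H"
    and "\<And>r x. r \<in> carrier A \<Longrightarrow> x \<in> H \<Longrightarrow> r \<odot>\<^bsub>M\<^esub> x \<in> H"
    using s.subset s.one_closed s.m_closed s.smult_closed by auto
qed

lemma submodule_module: "submodule H A M \<Longrightarrow> left_module A (M\<lparr>carrier := H\<rparr>)"
proof -
  assume "submodule H A M"
  note H = submoduleD[OF this]
  have minus: "\<exists>y\<in>H. y \<oplus>\<^bsub>M\<^esub> x = \<zero>\<^bsub>M\<^esub>" if "x \<in> H" for x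
    using H(4)[of "\<ominus>\<^bsub>A\<^esub> \<one>\<^bsub>A\<^esub>" x] smult_minus_1[of x] that H(1) M.l_neg
    by (intro bexI[of _ "\<ominus>\<^bsub>M\<^esub> x"]) auto
  have "abelian_group (M\<lparr>carrier := H\<rparr>)"
    using H minus by (intro abelian_groupI) (auto intro: M.a_assoc M.a_comm dest: subsetD)
  moreover have "left_module_axioms A (M\<lparr>carrier := H\<rparr>)"
    by (rule left_module_axioms.intro)
      (use H in \<open>auto intro: smult_l_distr smult_r_distr smult_assoc smult_one dest: subsetD\<close>)
  ultimately show ?thesis using R.ring_axioms left_module.intro by blast
qed

section \<open>Extension of linear functionals\<close>

definition linear_on :: "'m set \<Rightarrow> ('m \<Rightarrow> 'k) \<Rightarrow> bool" where
  "linear_on W \<mu> \<longleftrightarrow> W \<subseteq> carrier M \<and> \<zero>\<^bsub>M\<^esub> \<in> W \<and>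
     (\<forall>x\<in>W. \<forall>y\<in>W. x \<oplus>\<^bsub>M\<^esub> y \<in> W \<and> \<mu> (x \<oplus>\<^bsub>M\<^esub> y) = \<mu> x + \<mu> y) \<and>
     (\<forall>c. \<forall>x\<in>W. sc c x \<in> W \<and> \<mu> (sc c x) = c * \<mu> x)"

text \<open>Vectors of the larger space are \<open>w + c b\<close> with \<open>w\<close> and
  \<open>c\<close> unique because \<open>b\<close> lies outside \<open>W\<close>; the extension
  ignores the \<open>b\<close>-part.\<close>

lemma extend_functional_step:
  assumes W: "linear_on W \<mu>" and b: "b \<in> carrier M"
  shows "\<exists>W' \<mu>'. linear_on W' \<mu>' \<and> W \<subseteq> W' \<and> b \<in> W' \<and> (\<forall>x\<in>W. \<mu>' x = \<mu> x)"
proof (cases "b \<in> W")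
  case True
  then show ?thesis using W by blast
next
  case False
  have sub: "x \<in> W \<Longrightarrow> x \<in> carrier M" for x using W unfolding linear_on_def by blast
  have zW: "\<zero>\<^bsub>M\<^esub> \<in> W" using W unfolding linear_on_def by blast
  have add: "x \<in> W \<Longrightarrow> y \<in> W \<Longrightarrow> x \<oplus>\<^bsub>M\<^esub> y \<in> W \<and> \<mu> (x \<oplus>\<^bsub>M\<^esub> y) = \<mu> x + \<mu> y" for x y
    using W unfolding linear_on_def by blast
  have scl: "x \<in> W \<Longrightarrow> sc c x \<in> W \<and> \<mu> (sc c x) = c * \<mu> x" for c x
    using W unfolding linear_on_def by blast
  have minus_sc: "\<ominus>\<^bsub>M\<^esub> x = sc (-1) x" if "x \<in> carrier M" for x
  proof -
    have "sc (-1) x \<oplus>\<^bsub>M\<^esub> x = sc (-1 + 1) x" using sc_add[of x "-1" 1] sc_1 that by simp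
    then show ?thesis using sc_0 that sc_closed M.minus_equality by simp
  qed
  have uniq: "c = c' \<and> w = w'"
    if w: "w \<in> W" "w' \<in> W" and eq: "w \<oplus>\<^bsub>M\<^esub> sc c b = w' \<oplus>\<^bsub>M\<^esub> sc c' b" for w w' c c'
  proof -
    have cl: "w \<in> carrier M" "w' \<in> carrier M" "sc c b \<in> carrier M" "sc c' b \<in> carrier M"
      using w sub b sc_closed by auto
    have "c = c'"
    proof (rule ccontr)
      assume ne: "c \<noteq> c'"
      have "sc (c - c') b = sc c b \<oplus>\<^bsub>M\<^esub> sc (- c') b" using sc_add[OF b, of c "- c'"] by simp
      also have "sc (- c') b = \<ominus>\<^bsub>M\<^esub> sc c' b" using minus_sc cl sc_sc[OF b] by simp
      also have "sc c b \<oplus>\<^bsub>M\<^esub> \<ominus>\<^bsub>M\<^esub> sc c' b = \<ominus>\<^bsub>M\<^esub> w \<oplus>\<^bsub>M\<^esub> (w \<oplus>\<^bsub>M\<^esub> sc c b) \<oplus>\<^bsub>M\<^esub> \<ominus>\<^bsub>M\<^esub> sc c' b"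
        using cl M.r_neg1 by simp
      also have "\<dots> = \<ominus>\<^bsub>M\<^esub> w \<oplus>\<^bsub>M\<^esub> w'" unfolding eq using cl by (simp add: M.a_assoc M.r_neg)
      finally have "sc (c - c') b \<in> W" using add scl w minus_sc cl by simp
      then have "sc (1 / (c - c')) (sc (c - c') b) \<in> W" using scl by blast
      then show False using False ne sc_sc[OF b] sc_1[OF b] by simp
    qed
    then show ?thesis using eq cl by simp
  qed
  define W' where "W' = {w \<oplus>\<^bsub>M\<^esub> sc c b | w c. w \<in> W}"
  define \<mu>' where "\<mu>' x = (THE v. \<exists>w\<in>W. \<exists>c. x = w \<oplus>\<^bsub>M\<^esub> sc c b \<and> v = \<mu> w)" for x
  have \<mu>': "\<mu>' (w \<oplus>\<^bsub>M\<^esub> sc c b) = \<mu> w" if "w \<in> W" for w c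
    unfolding \<mu>'_def using that uniq by (intro the_equality) blast+
  have WW: "W \<subseteq> W'" "\<forall>x\<in>W. \<mu>' x = \<mu> x"
  proof -
    have "x = x \<oplus>\<^bsub>M\<^esub> sc 0 b" if "x \<in> W" for x using that sub sc_0[OF b] by simp
    then show "W \<subseteq> W'" "\<forall>x\<in>W. \<mu>' x = \<mu> x" unfolding W'_def using \<mu>' by (blast, metis)
  qed
  have "b = \<zero>\<^bsub>M\<^esub> \<oplus>\<^bsub>M\<^esub> sc 1 b" using sc_1[OF b] b by simp
  then have "b \<in> W'" unfolding W'_def using zW by blast
  moreover have "linear_on W' \<mu>'"
    unfolding linear_on_def
  proof (intro conjI ballI allI)
    show "W' \<subseteq> carrier M" unfolding W'_def using sub b sc_closed by auto
    show "\<zero>\<^bsub>M\<^esub> \<in> W'" using WW zW by blast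
    fix x assume "x \<in> W'"
    then obtain w c where x: "w \<in> W" "x = w \<oplus>\<^bsub>M\<^esub> sc c b" unfolding W'_def by blast
    note cl = sub[OF x(1)] sc_closed[OF b, of c]
    {
      fix y assume "y \<in> W'"
      then obtain w' c' where y: "w' \<in> W" "y = w' \<oplus>\<^bsub>M\<^esub> sc c' b" unfolding W'_def by blast
      have "x \<oplus>\<^bsub>M\<^esub> y = (w \<oplus>\<^bsub>M\<^esub> w') \<oplus>\<^bsub>M\<^esub> sc (c + c') b"
        using x y cl sub[OF y(1)] sc_closed[OF b, of c'] sc_add[OF b] by (simp add: M.a_ac)
      then show "x \<oplus>\<^bsub>M\<^esub> y \<in> W'" "\<mu>' (x \<oplus>\<^bsub>M\<^esub> y) = \<mu>' x + \<mu>' y"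
        using add[OF x(1) y(1)] \<mu>' x y unfolding W'_def by auto
    }
    fix d
    have "sc d x = sc d w \<oplus>\<^bsub>M\<^esub> sc (d * c) b" using x cl sc_sum sc_sc[OF b] by simp
    then show "sc d x \<in> W'" "\<mu>' (sc d x) = d * \<mu>' x"
      using scl[OF x(1)] \<mu>' x unfolding W'_def by auto
  qed
  ultimately show ?thesis using WW by blast
qed

lemma linear_on_finsum:
  assumes "linear_on W \<mu>" "finite B" "B \<subseteq> W"
  shows "finsum M (\<lambda>b. sc (c b) b) B \<in> W"
  using assms(2,3)
proof (induction B)
  case empty
  then show ?case using assms(1) by (simp add: linear_on_def)
next
  case (insert b B)
  have "(\<lambda>b. sc (c b) b) \<in> insert b B \<rightarrow> carrier M"
    using insert.prems assms(1) sc_closed unfolding linear_on_def by blast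
  then have "finsum M (\<lambda>b. sc (c b) b) (insert b B) = sc (c b) b \<oplus>\<^bsub>M\<^esub> finsum M (\<lambda>b. sc (c b) b) B"
    using insert.hyps by (intro M.finsum_insert) auto
  then show ?case using insert assms(1) unfolding linear_on_def by simp
qed

text \<open>One step per element of a finite spanning set: a subspace containing that set is
  everything.\<close>

lemma extend_functional:
  assumes "fin_dim A M" "linear_on W \<mu>"
  shows "\<exists>\<Lambda>. linear_on (carrier M) \<Lambda> \<and> (\<forall>x\<in>W. \<Lambda> x = \<mu> x)"
proof -
  obtain B where B: "finite B" "B \<subseteq> carrier M"
    "\<And>x. x \<in> carrier M \<Longrightarrow> \<exists>c. x = finsum M (\<lambda>b. sc (c b) b) B"
    using assms(1) unfolding fin_dim_def sc_def by blast
  have "\<exists>W' \<mu>'. linear_on W' \<mu>' \<and> W \<union> B \<subseteq> W' \<and> (\<forall>x\<in>W. \<mu>' x = \<mu> x)" using B(1,2)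
  proof (induction B)
    case empty
    then show ?case using assms(2) by auto
  next
    case (insert b B)
    then obtain W' \<mu>' where W': "linear_on W' \<mu>'" "W \<union> B \<subseteq> W'" "\<forall>x\<in>W. \<mu>' x = \<mu> x" by auto
    obtain W2 \<mu>2 where "linear_on W2 \<mu>2" "W' \<subseteq> W2" "b \<in> W2" "\<forall>x\<in>W'. \<mu>2 x = \<mu>' x"
      using extend_functional_step[OF W'(1), of b] insert.prems by auto
    then show ?case using W' by (intro exI[of _ W2] exI[of _ \<mu>2]) auto
  qed
  then obtain W' \<mu>' where W': "linear_on W' \<mu>'" "W \<union> B \<subseteq> W'" "\<forall>x\<in>W. \<mu>' x = \<mu> x" by blast
  have "carrier M \<subseteq> W'"
  proof
    fix x assume "x \<in> carrier M"
    then obtain c where "x = finsum M (\<lambda>b. sc (c b) b) B" using B(3) by blast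
    then show "x \<in> W'" using linear_on_finsum[OF W'(1) B(1)] W'(2) by auto
  qed
  then have "W' = carrier M" using W'(1) unfolding linear_on_def by blast
  then show ?thesis using W' by blast
qed

lemma linear_on_sum:
  assumes "linear_on (carrier M) \<Lambda>" "finite S" "F \<in> S \<rightarrow> carrier M"
  shows "\<Lambda> (finsum M F S) = (\<Sum>s\<in>S. \<Lambda> (F s))"
  using assms(2,3)
proof (induction S)
  case empty
  have "\<Lambda> \<zero>\<^bsub>M\<^esub> = 0 * \<Lambda> \<zero>\<^bsub>M\<^esub>" using assms(1) sc_0[of "\<zero>\<^bsub>M\<^esub>"] unfolding linear_on_def
    by (metis M.zero_closed)
  then show ?case by simp
next
  case (insert s S)
  then show ?case using assms(1) unfolding linear_on_def by (simp add: Pi_iff)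
qed

end

section \<open>Homomorphisms of left modules\<close>

lemma left_homI:
  assumes "\<And>x. x \<in> carrier M \<Longrightarrow> h x \<in> carrier N"
    and "\<And>x y. x \<in> carrier M \<Longrightarrow> y \<in> carrier M \<Longrightarrow> h (x \<oplus>\<^bsub>M\<^esub> y) = h x \<oplus>\<^bsub>N\<^esub> h y"
    and "\<And>r x. r \<in> carrier A \<Longrightarrow> x \<in> carrier M \<Longrightarrow> h (r \<odot>\<^bsub>M\<^esub> x) = r \<odot>\<^bsub>N\<^esub> h x"
  shows "h \<in> left_hom A M N"
  using assms by (auto simp: left_hom_def)

lemma left_homD:
  assumes "h \<in> left_hom A M N"
  shows "x \<in> carrier M \<Longrightarrow> h x \<in> carrier N"
    and "x \<in> carrier M \<Longrightarrow> y \<in> carrier M \<Longrightarrow> h (x \<oplus>\<^bsub>M\<^esub> y) = h x \<oplus>\<^bsub>N\<^esub> h y"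
    and "r \<in> carrier A \<Longrightarrow> x \<in> carrier M \<Longrightarrow> h (r \<odot>\<^bsub>M\<^esub> x) = r \<odot>\<^bsub>N\<^esub> h x"
  using assms by (auto simp: left_hom_def)

lemma left_hom_comp: "h \<in> left_hom A M N \<Longrightarrow> k \<in> left_hom A N L \<Longrightarrow> (\<lambda>x. k (h x)) \<in> left_hom A M L"
  by (auto simp: left_hom_def Pi_iff)

lemma (in k_algebra) algebra_moduleI: "left_module A M \<Longrightarrow> algebra_module A M"
  by (intro algebra_module.intro k_algebra_axioms)

lemma (in k_algebra) left_hom_zero:
  assumes "left_module A M" "left_module A N" "h \<in> left_hom A M N"
  shows "h \<zero>\<^bsub>M\<^esub> = \<zero>\<^bsub>N\<^esub>"
proof -
  interpret M: algebra_module A M using assms by (simp add: algebra_moduleI)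
  interpret N: algebra_module A N using assms by (simp add: algebra_moduleI)
  show ?thesis
    using left_homD(3)[OF assms(3), of "\<zero>\<^bsub>A\<^esub>" "\<zero>\<^bsub>M\<^esub>"] left_homD(1)[OF assms(3)]
    by (simp add: M.smult_l_null N.smult_l_null)
qed

lemma (in k_algebra) left_hom_minus:
  assumes "left_module A M" "left_module A N" "h \<in> left_hom A M N" "x \<in> carrier M"
  shows "h (\<ominus>\<^bsub>M\<^esub> x) = \<ominus>\<^bsub>N\<^esub> h x"
proof -
  interpret M: algebra_module A M using assms by (simp add: algebra_moduleI)
  interpret N: algebra_module A N using assms by (simp add: algebra_moduleI)
  show ?thesis
    using left_homD(3)[OF assms(3), of "\<ominus>\<^bsub>A\<^esub> \<one>\<^bsub>A\<^esub>" x] left_homD(1)[OF assms(3)] assms(4)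
    by (simp add: M.smult_minus_1 N.smult_minus_1)
qed

lemma (in k_algebra) left_hom_diff:
  assumes "left_module A M" "left_module A N" "h \<in> left_hom A M N" "x \<in> carrier M" "y \<in> carrier M"
  shows "h (x \<ominus>\<^bsub>M\<^esub> y) = h x \<ominus>\<^bsub>N\<^esub> h y"
proof -
  interpret M: algebra_module A M using assms by (simp add: algebra_moduleI)
  show ?thesis unfolding a_minus_def
    using left_homD(2)[OF assms(3,4), of "\<ominus>\<^bsub>M\<^esub> y"] left_hom_minus[OF assms(1-3,5)] assms(5) by simp
qed

lemma (in k_algebra) left_hom_finsum:
  assumes "left_module A M" "left_module A N" "h \<in> left_hom A M N" "finite S" "F \<in> S \<rightarrow> carrier M"
  shows "h (finsum M F S) = finsum N (\<lambda>s. h (F s)) S"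
proof -
  interpret M: algebra_module A M using assms by (simp add: algebra_moduleI)
  interpret N: algebra_module A N using assms by (simp add: algebra_moduleI)
  show ?thesis using assms(4,5)
  proof (induction S)
    case empty
    then show ?case using left_hom_zero[OF assms(1-3)] by simp
  next
    case (insert s S)
    then have "(\<lambda>s. h (F s)) \<in> S \<rightarrow> carrier N" "h (F s) \<in> carrier N"
      using left_homD(1)[OF assms(3)] by auto
    then show ?case using insert left_homD(2)[OF assms(3)] by (simp add: Pi_iff)
  qed
qed

lemma (in k_algebra) regular_left_module: "left_module A (regular_module A)"
proof -
  have "abelian_group (regular_module A)"
    by (rule abelian_groupI) (auto simp: regular_module_def a_assoc a_comm a_lcomm intro: l_neg a_inv_closed)
  moreover have "left_module_axioms A (regular_module A)"
    by (rule left_module_axioms.intro) (auto simp: regular_module_def l_distr r_distr m_assoc)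
  ultimately show ?thesis using ring_axioms left_module.intro by blast
qed

section \<open>Band matrix algebras and interval modules\<close>

text \<open>
  Elements of a Nakayama algebra are periodic band matrices: \<open>coeff r w z\<close> is the coefficient in \<open>r\<close> of
  the path from \<open>w\<close> to \<open>z\<close> in the universal cover of the cyclic quiver, and \<open>f w - w\<close> is the
  length of the projective module at \<open>w\<close>.
\<close>

locale band_algebra = kupisch_map n f + k_algebra A
  for n and f and A :: "('k::field, 'a) module" (structure) +
  fixes coeff :: "'a \<Rightarrow> int \<Rightarrow> int \<Rightarrow> 'k"
  assumes coeff_outside: "r \<in> carrier A \<Longrightarrow> \<not> (w \<le> z \<and> z < f w) \<Longrightarrow> coeff r w z = 0"
    and coeff_shift: "r \<in> carrier A \<Longrightarrow> coeff r (w + k * int n) (z + k * int n) = coeff r w z"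
    and coeff_add: "r \<in> carrier A \<Longrightarrow> s \<in> carrier A \<Longrightarrow> coeff (r \<oplus> s) w z = coeff r w z + coeff s w z"
    and coeff_scale: "r \<in> carrier A \<Longrightarrow> coeff (c \<odot> r) w z = c * coeff r w z"
    and coeff_mult: "r \<in> carrier A \<Longrightarrow> s \<in> carrier A \<Longrightarrow> w \<le> z \<Longrightarrow> z < f w \<Longrightarrow>
       coeff (r \<otimes> s) w z = (\<Sum>v\<in>{w..z}. coeff r v z * coeff s w v)"
    and coeff_one: "w \<le> z \<Longrightarrow> z < f w \<Longrightarrow> coeff \<one> w z = (if w = z then 1 else 0)"
    and coeff_inj: "r \<in> carrier A \<Longrightarrow> s \<in> carrier A \<Longrightarrow> coeff r = coeff s \<Longrightarrow> r = s"
    and coeff_surj: "(\<And>w z. \<not> (w \<le> z \<and> z < f w) \<Longrightarrow> F w z = 0) \<Longrightarrow>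
       (\<And>w z k. F (w + k * int n) (z + k * int n) = F w z) \<Longrightarrow> \<exists>r\<in>carrier A. coeff r = F"
begin

definition mat :: "(int \<Rightarrow> int \<Rightarrow> 'k) \<Rightarrow> 'a" where
  "mat F = (SOME r. r \<in> carrier A \<and> coeff r = F)"

lemma mat:
  assumes "\<And>w z. \<not> (w \<le> z \<and> z < f w) \<Longrightarrow> F w z = 0"
    and "\<And>w z k. F (w + k * int n) (z + k * int n) = F w z"
  shows "mat F \<in> carrier A" "coeff (mat F) = F"
proof -
  have "\<exists>r. r \<in> carrier A \<and> coeff r = F" using coeff_surj[of F] assms by blast
  from someI_ex[OF this] show "mat F \<in> carrier A" "coeff (mat F) = F" by (simp_all add: mat_def)
qed

text \<open>A matrix unit made periodic. Outside the band it is the zero element, as the path from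
  \<open>a\<close> to \<open>b\<close> is then absent or zero in the algebra.\<close>

definition path_elem :: "int \<Rightarrow> int \<Rightarrow> 'a" where
  "path_elem a b = mat (\<lambda>w z. if a \<le> b \<and> b < f a \<and> (\<exists>k. w = a + k * int n \<and> z = b + k * int n) then 1 else 0)"

lemma path_elem: "path_elem a b \<in> carrier A"
  "coeff (path_elem a b) w z = (if a \<le> b \<and> b < f a \<and> (\<exists>k. w = a + k * int n \<and> z = b + k * int n) then 1 else 0)"
proof -
  let ?F = "\<lambda>w z. if a \<le> b \<and> b < f a \<and> (\<exists>k. w = a + k * int n \<and> z = b + k * int n) then 1 else 0 :: 'k"
  have 1: "?F w z = 0" if "\<not> (w \<le> z \<and> z < f w)" for w z using that f_shift[of a] by auto
  have 2: "?F (w + k * int n) (z + k * int n) = ?F w z" for w z k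
  proof -
    have "(\<exists>l. w + k * int n = a + l * int n \<and> z + k * int n = b + l * int n) \<longleftrightarrow>
      (\<exists>l. w = a + l * int n \<and> z = b + l * int n)"
    proof
      assume "\<exists>l. w + k * int n = a + l * int n \<and> z + k * int n = b + l * int n"
      then obtain l where "w + k * int n = a + l * int n" "z + k * int n = b + l * int n" by blast
      then show "\<exists>l. w = a + l * int n \<and> z = b + l * int n"
        by (intro exI[of _ "l - k"]) (simp add: algebra_simps)
    next
      assume "\<exists>l. w = a + l * int n \<and> z = b + l * int n"
      then obtain l where "w = a + l * int n" "z = b + l * int n" by blast
      then show "\<exists>l. w + k * int n = a + l * int n \<and> z + k * int n = b + l * int n"
        by (intro exI[of _ "l + k"]) (simp add: algebra_simps)
    qed
    then show ?thesis by simp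
  qed
  show "path_elem a b \<in> carrier A" unfolding path_elem_def using mat(1)[of ?F] 1 2 by blast
  have "coeff (path_elem a b) = ?F" unfolding path_elem_def using mat(2)[of ?F] 1 2 by blast
  then show "coeff (path_elem a b) w z = (if a \<le> b \<and> b < f a \<and> (\<exists>k. w = a + k * int n \<and> z = b + k * int n) then 1 else 0)"
    by simp
qed

lemma coeff_path_elem_col: "a \<le> b \<Longrightarrow> b < f a \<Longrightarrow> coeff (path_elem a b) w b = (if w = a then 1 else 0)"
  using n_pos by (auto simp: path_elem(2))

lemma coeff_path_elem_row: "a \<le> b \<Longrightarrow> b < f a \<Longrightarrow> coeff (path_elem a b) a z = (if z = b then 1 else 0)"
  using n_pos by (auto simp: path_elem(2))

lemma coeff_zero: "coeff \<zero> w z = 0"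
  using coeff_add[of \<zero> \<zero> w z] l_zero[OF zero_closed] by (metis add_cancel_right_right zero_closed)

lemma coeff_scalar: "coeff (c \<odot> \<one>) w z = (if w = z then c else 0)"
  using coeff_scale[of \<one> c w z] coeff_one[of w z] coeff_outside[of \<one> w z] f_gt[of w]
  by (cases "w \<le> z \<and> z < f w") auto

lemma coeff_finsum: "finite S \<Longrightarrow> F \<in> S \<rightarrow> carrier A \<Longrightarrow> coeff (finsum A F S) w z = (\<Sum>s\<in>S. coeff (F s) w z)"
  by (induction S rule: finite_induct) (simp_all add: coeff_zero coeff_add Pi_iff)

text \<open>
  The coordinate \<open>(i, z)\<close> of a vector is its entry at the number \<open>idx i z\<close>, so that these
  modules have carriers in the type \<open>nat \<Rightarrow> 'k\<close>.
\<close>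

definition idx :: "nat \<Rightarrow> int \<Rightarrow> nat" where "idx i z = prod_encode (i, int_encode z)"

definition vec :: "(nat \<Rightarrow> int \<Rightarrow> 'k) \<Rightarrow> nat \<Rightarrow> 'k" where
  "vec F m = F (fst (prod_decode m)) (int_decode (snd (prod_decode m)))"

lemma vec_idx [simp]: "vec F (idx i z) = F i z" by (simp add: vec_def idx_def)

lemma idx_eq [simp]: "idx i z = idx j w \<longleftrightarrow> i = j \<and> z = w" by (simp add: idx_def int_encode_eq)

lemma idx_surj: "\<exists>i z. m = idx i z"
  unfolding idx_def by (metis prod_decode_inverse int_decode_inverse surj_pair)

lemma vec_eqI: "(\<And>i z. v (idx i z) = w (idx i z)) \<Longrightarrow> v = w"
  using idx_surj by (intro ext) metis

text \<open>A direct sum of \<open>N\<close> uniserial modules: summand \<open>i\<close> has the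
  composition factors \<open>x i, ..., y i - 1\<close> from the top, and is zero if
  \<open>y i \<le> x i\<close>. The action is matrix times column; the test \<open>z < y i\<close>
  cuts off what vanishes in this quotient of the projective at \<open>x i\<close>. Sums are built in
  because a term in the resolution of \<open>A\<close> is a sum over all vertices.\<close>

definition ivl :: "nat \<Rightarrow> (nat \<Rightarrow> int) \<Rightarrow> (nat \<Rightarrow> int) \<Rightarrow> ('a, nat \<Rightarrow> 'k) module" where
  "ivl N x y = \<lparr>carrier = {v. \<forall>i z. v (idx i z) \<noteq> 0 \<longrightarrow> i < N \<and> x i \<le> z \<and> z < y i},
     mult = undefined, one = undefined, zero = (\<lambda>_. 0), add = (\<lambda>v w m. v m + w m),
     smult = (\<lambda>r v. vec (\<lambda>i z. if z < y i then \<Sum>w\<in>{x i..z}. coeff r w z * v (idx i w) else 0))\<rparr>"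

definition valid :: "nat \<Rightarrow> (nat \<Rightarrow> int) \<Rightarrow> (nat \<Rightarrow> int) \<Rightarrow> bool" where
  "valid N x y \<longleftrightarrow> (\<forall>i<N. y i \<le> f (x i))"

lemma ivl_simps [simp]:
  "v \<in> carrier (ivl N x y) \<longleftrightarrow> (\<forall>i z. v (idx i z) \<noteq> 0 \<longrightarrow> i < N \<and> x i \<le> z \<and> z < y i)"
  "\<zero>\<^bsub>ivl N x y\<^esub> = (\<lambda>_. 0)"
  "v \<oplus>\<^bsub>ivl N x y\<^esub> w = (\<lambda>m. v m + w m)"
  by (simp_all add: ivl_def)

lemma ivl_smult [simp]:
  "(r \<odot>\<^bsub>ivl N x y\<^esub> v) (idx i z) = (if z < y i then \<Sum>w\<in>{x i..z}. coeff r w z * v (idx i w) else 0)"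
  by (simp add: ivl_def)

declare ivl_simps(1) [simp del]

lemma ivl_carrierI:
  "(\<And>i z. \<not> (i < N \<and> x i \<le> z \<and> z < y i) \<Longrightarrow> v (idx i z) = 0) \<Longrightarrow> v \<in> carrier (ivl N x y)"
  unfolding ivl_simps(1) by blast

lemma ivl_carrierD:
  "v \<in> carrier (ivl N x y) \<Longrightarrow> \<not> (i < N \<and> x i \<le> z \<and> z < y i) \<Longrightarrow> v (idx i z) = 0"
  unfolding ivl_simps(1) by blast

lemma ivl_smult_closed:
  assumes "v \<in> carrier (ivl N x y)" shows "r \<odot>\<^bsub>ivl N x y\<^esub> v \<in> carrier (ivl N x y)"
proof (rule ivl_carrierI)
  fix i z assume "\<not> (i < N \<and> x i \<le> z \<and> z < y i)"
  then show "(r \<odot>\<^bsub>ivl N x y\<^esub> v) (idx i z) = 0"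
    using ivl_carrierD[OF assms] by (auto simp: not_less intro!: sum.neutral)
qed

lemma ivl_module:
  assumes "valid N x y" shows "left_module A (ivl N x y)"
proof -
  have "abelian_group (ivl N x y)"
  proof (rule abelian_groupI)
    fix v assume v: "v \<in> carrier (ivl N x y)"
    then have "(\<lambda>m. - v m) \<in> carrier (ivl N x y)" by (simp add: ivl_simps(1))
    then show "\<exists>w\<in>carrier (ivl N x y). w \<oplus>\<^bsub>ivl N x y\<^esub> v = \<zero>\<^bsub>ivl N x y\<^esub>"
      by (intro bexI[of _ "\<lambda>m. - v m"]) auto
  next
    fix v w assume "v \<in> carrier (ivl N x y)" "w \<in> carrier (ivl N x y)"
    then show "v \<oplus>\<^bsub>ivl N x y\<^esub> w \<in> carrier (ivl N x y)"
      using ivl_carrierD[of v N x y] ivl_carrierD[of w N x y] by (intro ivl_carrierI) simp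
  qed (auto simp: ivl_simps(1) algebra_simps)
  moreover have "left_module_axioms A (ivl N x y)"
  proof (rule left_module_axioms.intro)
    fix r s v assume r: "r \<in> carrier A" and s: "s \<in> carrier A" and v: "v \<in> carrier (ivl N x y)"
    show "(r \<otimes> s) \<odot>\<^bsub>ivl N x y\<^esub> v = r \<odot>\<^bsub>ivl N x y\<^esub> (s \<odot>\<^bsub>ivl N x y\<^esub> v)"
    proof (rule vec_eqI)
      fix i z
      show "((r \<otimes> s) \<odot>\<^bsub>ivl N x y\<^esub> v) (idx i z) = (r \<odot>\<^bsub>ivl N x y\<^esub> (s \<odot>\<^bsub>ivl N x y\<^esub> v)) (idx i z)"
      proof (cases "i < N \<and> z < y i")
        case True
        \<comment> \<open>Validity keeps the pairs \<open>(w, z)\<close> inside the band, where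
          \<open>coeff_mult\<close> is available; this is why an interval must not be longer than
          the projective at its start.\<close>
        have bound: "z < f w" if "w \<in> {x i..z}" for w
        proof -
          have "y i \<le> f (x i)" using assms True by (simp add: valid_def)
          also have "\<dots> \<le> f w" using that f_mono by simp
          finally show ?thesis using True by simp
        qed
        have "(\<Sum>w\<in>{x i..z}. coeff (r \<otimes> s) w z * v (idx i w)) =
           (\<Sum>w\<in>{x i..z}. \<Sum>t\<in>{w..z}. coeff r t z * (coeff s w t * v (idx i w)))"
          using bound by (intro sum.cong refl) (simp add: coeff_mult r s sum_distrib_right mult.assoc)
        \<comment> \<open>The triangle \<open>x i \<le> w \<le> t \<le> z\<close> is summed in the
          other order.\<close>
        also have "\<dots> = (\<Sum>t\<in>{x i..z}. \<Sum>w\<in>{x i..t}. coeff r t z * (coeff s w t * v (idx i w)))"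
          unfolding sum.Sigma[OF finite_atLeastAtMost_int, simplified]
          by (simp add: sum.Sigma, rule sum.reindex_bij_witness[of _ prod.swap prod.swap]) auto
        finally show ?thesis using True by (simp add: sum_distrib_left)
      next
        case False
        then show ?thesis
          using ivl_carrierD[OF v] ivl_carrierD[OF ivl_smult_closed[OF v]]
          by (auto simp del: ivl_smult simp: ivl_carrierD[OF ivl_smult_closed[OF v]]
              ivl_carrierD[OF ivl_smult_closed[OF ivl_smult_closed[OF v]]])
      qed
    qed
  next
    fix v assume v: "v \<in> carrier (ivl N x y)"
    show "\<one> \<odot>\<^bsub>ivl N x y\<^esub> v = v"
    proof (rule vec_eqI)
      fix i z
      have *: "coeff \<one> w z = (if w = z then 1 else 0)" for w
        using coeff_scalar[of 1 w z] by (simp add: scale_one)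
      show "(\<one> \<odot>\<^bsub>ivl N x y\<^esub> v) (idx i z) = v (idx i z)"
        using ivl_carrierD[OF v, of i z] by (auto simp: * if_distrib[of "\<lambda>c. c * _"] sum.delta cong: if_cong)
    qed
  qed (auto simp: ivl_smult_closed coeff_add algebra_simps sum.distrib intro!: vec_eqI)
  ultimately show ?thesis using ring_axioms left_module.intro by blast
qed

definition unit_vec :: "nat \<Rightarrow> int \<Rightarrow> nat \<Rightarrow> 'k" where
  "unit_vec i z = vec (\<lambda>j w. if j = i \<and> w = z then 1 else 0)"

lemma unit_vec_idx [simp]: "unit_vec i z (idx j w) = (if j = i \<and> w = z then 1 else 0)" by (simp add: unit_vec_def)

lemma unit_vec_eq [simp]: "unit_vec i z = unit_vec j w \<longleftrightarrow> i = j \<and> z = w"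
proof
  assume "unit_vec i z = unit_vec j w"
  then have "unit_vec i z (idx i z) = unit_vec j w (idx i z)" by simp
  then show "i = j \<and> z = w" by (auto split: if_splits)
qed simp

lemma unit_vec_in: "i < N \<Longrightarrow> x i \<le> z \<Longrightarrow> z < y i \<Longrightarrow> unit_vec i z \<in> carrier (ivl N x y)"
  by (simp add: ivl_simps(1))

lemma ivl_finsum:
  assumes "valid N x y" "finite S" "F \<in> S \<rightarrow> carrier (ivl N x y)"
  shows "finsum (ivl N x y) F S = (\<lambda>m. \<Sum>s\<in>S. F s m)"
proof -
  interpret M: algebra_module A "ivl N x y" using ivl_module[OF assms(1)] by (rule algebra_moduleI)
  show ?thesis using assms(2,3)
    by (induction S rule: finite_induct) (simp_all add: Pi_iff M.finsum_insert)
qed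

lemma ivl_scalar:
  assumes "v \<in> carrier (ivl N x y)"
  shows "(c \<odot> \<one>) \<odot>\<^bsub>ivl N x y\<^esub> v = (\<lambda>m. c * v m)"
proof (rule vec_eqI)
  fix i z
  show "((c \<odot> \<one>) \<odot>\<^bsub>ivl N x y\<^esub> v) (idx i z) = c * v (idx i z)"
    using ivl_carrierD[OF assms, of i z]
    by (auto simp: coeff_scalar if_distrib[of "\<lambda>c. c * _"] sum.delta cong: if_cong)
qed

lemma ivl_fd:
  assumes "valid N x y" shows "fd_module A (ivl N x y)"
proof -
  define S where "S = (SIGMA i:{..<N}. {x i..<y i})"
  have inj: "inj_on (\<lambda>(i, z). unit_vec i z) S"
    by (rule inj_onI) auto
  have fin: "finite S" by (simp add: S_def)
  have "fin_dim A (ivl N x y)"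
    unfolding fin_dim_def
  proof (intro exI[of _ "(\<lambda>(i, z). unit_vec i z) ` S"] conjI ballI)
    show "finite ((\<lambda>(i, z). unit_vec i z) ` S)" using fin by simp
    show sub: "(\<lambda>(i, z). unit_vec i z) ` S \<subseteq> carrier (ivl N x y)" by (auto simp: S_def unit_vec_in)
    fix v assume v: "v \<in> carrier (ivl N x y)"
    \<comment> \<open>\<open>fin_dim\<close> indexes coefficients by vectors, so the coordinate has
      to be recovered from the unit vector; distinct index pairs give distinct unit vectors.\<close>
    define c where "c b = (\<Sum>(i, z)\<in>S. if b = unit_vec i z then v (idx i z) else 0)" for b
    have c: "c (unit_vec i z) = v (idx i z)" if "(i, z) \<in> S" for i z
    proof -
      have "c (unit_vec i z) = (\<Sum>p\<in>S. if p = (i, z) then v (idx i z) else 0)"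
        unfolding c_def by (intro sum.cong) (auto split: if_splits)
      then show ?thesis using fin that by (simp add: sum.delta)
    qed
    have "finsum (ivl N x y) (\<lambda>b. (c b \<odot> \<one>) \<odot>\<^bsub>ivl N x y\<^esub> b) ((\<lambda>(i, z). unit_vec i z) ` S) = v"
    proof (rule vec_eqI)
      fix j w
      have "finsum (ivl N x y) (\<lambda>b. (c b \<odot> \<one>) \<odot>\<^bsub>ivl N x y\<^esub> b) ((\<lambda>(i, z). unit_vec i z) ` S) (idx j w) =
         (\<Sum>b\<in>(\<lambda>(i, z). unit_vec i z) ` S. c b * b (idx j w))"
      proof (subst ivl_finsum[OF assms])
        show "(\<Sum>b\<in>(\<lambda>(i, z). unit_vec i z) ` S. ((c b \<odot> \<one>) \<odot>\<^bsub>ivl N x y\<^esub> b) (idx j w)) =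
          (\<Sum>b\<in>(\<lambda>(i, z). unit_vec i z) ` S. c b * b (idx j w))"
          using ivl_scalar sub by (intro sum.cong refl) (auto simp del: ivl_smult)
      qed (use fin sub ivl_smult_closed in auto)
      also have "\<dots> = (\<Sum>(i, z)\<in>S. c (unit_vec i z) * unit_vec i z (idx j w))"
        by (subst sum.reindex[OF inj]) (simp add: case_prod_unfold)
      also have "\<dots> = (\<Sum>p\<in>S. if p = (j, w) then v (idx j w) else 0)"
        by (intro sum.cong) (auto simp: c split: if_splits)
      also have "\<dots> = v (idx j w)" using fin ivl_carrierD[OF v, of j w] by (auto simp: sum.delta S_def)
      finally show "finsum (ivl N x y) (\<lambda>b. (c b \<odot> \<one>) \<odot>\<^bsub>ivl N x y\<^esub> b) ((\<lambda>(i, z). unit_vec i z) ` S) (idx j w) = v (idx j w)" .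
    qed
    then show "\<exists>c. v = finsum (ivl N x y) (\<lambda>b. (c b \<odot> \<one>) \<odot>\<^bsub>ivl N x y\<^esub> b) ((\<lambda>(i, z). unit_vec i z) ` S)"
      by (rule exI[where x = c, OF sym])
  qed
  then show ?thesis using ivl_module[OF assms] by (simp add: fd_module_def)
qed

lemma path_elem_unit_vec:
  assumes "i < N" "x i \<le> a" "a \<le> b" "b < f a" "valid N x y"
  shows "path_elem a b \<odot>\<^bsub>ivl N x y\<^esub> unit_vec i a = (if b < y i then unit_vec i b else (\<lambda>_. 0))"
proof (rule vec_eqI)
  fix j z
  show "(path_elem a b \<odot>\<^bsub>ivl N x y\<^esub> unit_vec i a) (idx j z) = (if b < y i then unit_vec i b else (\<lambda>_. 0)) (idx j z)"
  proof (cases "j = i")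
    case True
    have "(\<Sum>w\<in>{x i..z}. coeff (path_elem a b) w z * unit_vec i a (idx i w)) = (if a \<le> z then coeff (path_elem a b) a z else 0)"
      using assms(2) by (simp add: if_distrib[of "\<lambda>c. _ * c"] sum.delta cong: if_cong)
    then show ?thesis using True assms coeff_path_elem_row[OF assms(3,4)] by auto
  qed simp
qed

section \<open>Truncation maps and injective interval modules\<close>

definition cut :: "(nat \<Rightarrow> int) \<Rightarrow> (nat \<Rightarrow> int) \<Rightarrow> (nat \<Rightarrow> 'k) \<Rightarrow> nat \<Rightarrow> 'k" where
  "cut x y v = vec (\<lambda>i z. if x i \<le> z \<and> z < y i then v (idx i z) else 0)"

lemma cut_idx [simp]: "cut x y v (idx i z) = (if x i \<le> z \<and> z < y i then v (idx i z) else 0)"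
  by (simp add: cut_def)

text \<open>The arrows lead from the start of an interval to its end, so lowering the end is a
  quotient map and lowering the start an inclusion. One map covers both and their
  composites.\<close>

lemma cut_hom:
  assumes "\<And>i. i < N \<Longrightarrow> x' i \<le> x i" "\<And>i. i < N \<Longrightarrow> y' i \<le> y i"
  shows "cut x' y' \<in> left_hom A (ivl N x y) (ivl N x' y')"
proof (rule left_homI)
  fix v assume v: "v \<in> carrier (ivl N x y)"
  show "cut x' y' v \<in> carrier (ivl N x' y')"
    using ivl_carrierD[OF v] by (intro ivl_carrierI) auto
  fix r assume "r \<in> carrier A"
  show "cut x' y' (r \<odot>\<^bsub>ivl N x y\<^esub> v) = r \<odot>\<^bsub>ivl N x' y'\<^esub> cut x' y' v"
  proof (rule vec_eqI)
    fix i z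
    show "cut x' y' (r \<odot>\<^bsub>ivl N x y\<^esub> v) (idx i z) = (r \<odot>\<^bsub>ivl N x' y'\<^esub> cut x' y' v) (idx i z)"
    proof (cases "i < N")
      case i: True
      have "(\<Sum>w\<in>{x' i..z}. coeff r w z * cut x' y' v (idx i w)) = (\<Sum>w\<in>{x i..z}. coeff r w z * v (idx i w))"
        if "z < y' i"
        using that assms(1)[OF i] ivl_carrierD[OF v, of i]
        by (intro sum.mono_neutral_cong_right) auto
      then show ?thesis using assms(1,2)[OF i] by auto
    next
      case False
      then show ?thesis using ivl_carrierD[OF v] by simp
    qed
  qed
qed (auto intro: vec_eqI)

text \<open>
  Homomorphisms into an injective interval module \<open>[g b, b)\<close> are linear functionals (take the
  coordinate \<open>b - 1\<close>), so they extend because functionals do.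
\<close>

lemma path_elem_mult_expand:
  assumes r: "r \<in> carrier A" and z: "x \<le> z" "z \<le> e" and x: "\<And>w. x \<le> w \<longleftrightarrow> e < f w"
  shows "path_elem z e \<otimes> r = (\<Oplus>w\<in>{x..z}. coeff r w z \<odot> path_elem w e)"
proof (rule coeff_inj)
  have ez: "e < f z" using x z by blast
  show "path_elem z e \<otimes> r \<in> carrier A" using r path_elem by simp
  have F: "(\<lambda>w. coeff r w z \<odot> path_elem w e) \<in> {x..z} \<rightarrow> carrier A" using path_elem scale_closed by blast
  then show "(\<Oplus>w\<in>{x..z}. coeff r w z \<odot> path_elem w e) \<in> carrier A" by (rule finsum_closed)
  show "coeff (path_elem z e \<otimes> r) = coeff (\<Oplus>w\<in>{x..z}. coeff r w z \<odot> path_elem w e)"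
  proof (intro ext)
    fix w' z'
    have R: "coeff (\<Oplus>w\<in>{x..z}. coeff r w z \<odot> path_elem w e) w' z' = (\<Sum>w\<in>{x..z}. coeff r w z * coeff (path_elem w e) w' z')"
      using F by (simp add: coeff_finsum coeff_scale path_elem)
    show "coeff (path_elem z e \<otimes> r) w' z' = coeff (\<Oplus>w\<in>{x..z}. coeff r w z \<odot> path_elem w e) w' z'"
    proof (cases "\<exists>k. z' = e + k * int n")
      case False
      then have "coeff (path_elem a e) v z' = 0" for a v by (simp add: path_elem)
      moreover from this have "coeff (path_elem z e \<otimes> r) w' z' = 0"
        using coeff_outside[of "path_elem z e \<otimes> r" w' z'] coeff_mult[of "path_elem z e" r w' z'] r path_elem(1)
        by (cases "w' \<le> z' \<and> z' < f w'") auto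
      ultimately show ?thesis by (simp add: R)
    next
      case True
      then obtain k where k: "z' = e + k * int n" by blast
      \<comment> \<open>Periodicity moves column \<open>z'\<close> to column \<open>e\<close>, where
        \<open>path_elem v e\<close> has a single nonzero entry.\<close>
      define w where "w = w' - k * int n"
      have w': "w' = w + k * int n" by (simp add: w_def)
      have "coeff (path_elem z e \<otimes> r) w' z' = coeff (path_elem z e \<otimes> r) w e"
        unfolding w' k using coeff_shift r path_elem(1) by simp
      also have "\<dots> = (if x \<le> w \<and> w \<le> z then coeff r w z else 0)"
      proof (cases "w \<le> e \<and> e < f w")
        case True
        then have "coeff (path_elem z e \<otimes> r) w e = (\<Sum>v\<in>{w..e}. (if v = z then 1 else 0) * coeff r w v)"
          using coeff_mult[of "path_elem z e" r w e] r path_elem(1) coeff_path_elem_col[OF z(2) ez] by simp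
        also have "\<dots> = (\<Sum>v\<in>{w..e}. if v = z then coeff r w z else 0)" by (intro sum.cong) auto
        finally show ?thesis using True x z by (auto simp: sum.delta)
      next
        case False
        then have "\<not> (x \<le> w \<and> w \<le> z)" using x z by force
        then show ?thesis using coeff_outside[of "path_elem z e \<otimes> r" w e] False r path_elem(1) by auto
      qed
      also have "\<dots> = (\<Sum>v\<in>{x..z}. if v = w then coeff r w z else 0)" by (simp add: sum.delta)
      also have "\<dots> = (\<Sum>v\<in>{x..z}. coeff r v z * coeff (path_elem v e) w e)"
        using z x by (intro sum.cong refl) (auto simp: coeff_path_elem_col)
      also have "\<dots> = (\<Sum>v\<in>{x..z}. coeff r v z * coeff (path_elem v e) w' z')"
        unfolding w' k using coeff_shift path_elem(1) by simp
      finally show ?thesis using R by simp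
    qed
  qed
qed

definition inj_ivl :: "nat \<Rightarrow> (nat \<Rightarrow> int) \<Rightarrow> (nat \<Rightarrow> int) \<Rightarrow> bool" where
  "inj_ivl N x y \<longleftrightarrow> (\<forall>i<N. x i = y i \<or> x i = g (y i))"

lemma inj_ivl_valid: "inj_ivl N x y \<Longrightarrow> valid N x y"
  unfolding inj_ivl_def valid_def using le_fg f_gt order_less_imp_le by metis

text \<open>Only the kernel of \<open>p\<close> matters: \<open>t\<close> factors through
  \<open>p\<close> as soon as it vanishes there. For injective \<open>p\<close> this is injectivity
  of the interval; for a differential \<open>p\<close> it yields the maps of the later comparison of
  resolutions.\<close>

lemma ivl_extend:
  assumes inj: "inj_ivl N x y"
    and Z: "left_module A Z" and Y: "left_module A Y" "fin_dim A Y"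
    and p: "p \<in> left_hom A Z Y" and t: "t \<in> left_hom A Z (ivl N x y)"
    and ker: "\<And>c. c \<in> carrier Z \<Longrightarrow> p c = \<zero>\<^bsub>Y\<^esub> \<Longrightarrow> t c = (\<lambda>_. 0)"
  shows "\<exists>h\<in>left_hom A Y (ivl N x y). \<forall>c\<in>carrier Z. h (p c) = t c"
proof -
  let ?I = "ivl N x y"
  note valid = inj_ivl_valid[OF inj]
  interpret Z: algebra_module A Z using Z by (rule algebra_moduleI)
  interpret Y: algebra_module A Y using Y(1) by (rule algebra_moduleI)
  interpret I: algebra_module A ?I using ivl_module[OF valid] by (rule algebra_moduleI)
  note pD = left_homD[OF p] and tD = left_homD[OF t]
  have wd: "t c = t d" if "c \<in> carrier Z" "d \<in> carrier Z" "p c = p d" for c d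
  proof -
    have "p (c \<ominus>\<^bsub>Z\<^esub> d) = \<zero>\<^bsub>Y\<^esub>"
      using left_hom_diff[OF Z Y(1) p that(1,2)] that pD(1) by (simp add: a_minus_def Y.M.r_neg)
    then have "t (c \<ominus>\<^bsub>Z\<^esub> d) = \<zero>\<^bsub>?I\<^esub>" using ker that by simp
    then have "t c \<ominus>\<^bsub>?I\<^esub> t d = \<zero>\<^bsub>?I\<^esub>"
      using left_hom_diff[OF Z ivl_module[OF valid] t that(1,2)] by simp
    then have "\<ominus>\<^bsub>?I\<^esub> (\<ominus>\<^bsub>?I\<^esub> t d) = t c"
      using tD(1) that by (intro I.M.minus_equality) (auto simp: a_minus_def)
    then show ?thesis using I.M.minus_minus[OF tD(1)[OF that(2)]] by simp
  qed
  \<comment> \<open>The functional reads the socle coordinate of \<open>t c\<close> for some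
    preimage \<open>c\<close> of \<open>q\<close>; by \<open>wd\<close> the choice does not affect
    the value.\<close>
  define \<mu> where "\<mu> i q = t (SOME c. c \<in> carrier Z \<and> p c = q) (idx i (y i - 1))" for i q
  have \<mu>: "\<mu> i (p c) = t c (idx i (y i - 1))" if c: "c \<in> carrier Z" for i c
  proof -
    have "\<exists>d. d \<in> carrier Z \<and> p d = p c" using c by blast
    from someI_ex[OF this] show ?thesis unfolding \<mu>_def using wd c by metis
  qed
  have sc_p: "Y.sc a (p c) = p (Z.sc a c)" if "c \<in> carrier Z" for a c
    using pD(3)[OF Z.scalar_closed that] by (simp add: Y.sc_def Z.sc_def)
  have sc_t: "t (Z.sc a c) = (\<lambda>m. a * t c m)" if "c \<in> carrier Z" for a c
    using tD(3)[OF Z.scalar_closed that] ivl_scalar[OF tD(1)[OF that]] by (simp add: Z.sc_def)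
  have lin: "Y.linear_on (p ` carrier Z) (\<mu> i)" for i
    unfolding Y.linear_on_def
  proof (intro conjI ballI allI)
    show "p ` carrier Z \<subseteq> carrier Y" using pD(1) by blast
    show "\<zero>\<^bsub>Y\<^esub> \<in> p ` carrier Z" using left_hom_zero[OF Z Y(1) p] Z.M.zero_closed by (metis imageI)
    fix q assume "q \<in> p ` carrier Z"
    then obtain c where c: "c \<in> carrier Z" "q = p c" by blast
    {
      fix q' assume "q' \<in> p ` carrier Z"
      then obtain c' where c': "c' \<in> carrier Z" "q' = p c'" by blast
      have "q \<oplus>\<^bsub>Y\<^esub> q' = p (c \<oplus>\<^bsub>Z\<^esub> c')" using pD(2) c c' by simp
      then show "q \<oplus>\<^bsub>Y\<^esub> q' \<in> p ` carrier Z" "\<mu> i (q \<oplus>\<^bsub>Y\<^esub> q') = \<mu> i q + \<mu> i q'"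
        using c c' \<mu> tD(2) by auto
    }
    fix a
    have "Y.sc a q = p (Z.sc a c)" using c sc_p by simp
    then show "Y.sc a q \<in> p ` carrier Z" "\<mu> i (Y.sc a q) = a * \<mu> i q"
      using c \<mu> sc_t Z.sc_closed by auto
  qed
  have "\<exists>\<Lambda>. Y.linear_on (carrier Y) \<Lambda> \<and> (\<forall>q\<in>p ` carrier Z. \<Lambda> q = \<mu> i q)" for i
    using Y.extend_functional[OF Y(2) lin] .
  then obtain \<Lambda> where \<Lambda>: "\<And>i. Y.linear_on (carrier Y) (\<Lambda> i)"
    "\<And>i q. q \<in> p ` carrier Z \<Longrightarrow> \<Lambda> i q = \<mu> i q" by metis
  have \<Lambda>_add: "\<Lambda> i (q \<oplus>\<^bsub>Y\<^esub> q') = \<Lambda> i q + \<Lambda> i q'" if "q \<in> carrier Y" "q' \<in> carrier Y" for i q q'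
    using \<Lambda>(1)[of i] that unfolding Y.linear_on_def by blast
  have \<Lambda>_sc: "\<Lambda> i (Y.sc a q) = a * \<Lambda> i q" if "q \<in> carrier Y" for i a q
    using \<Lambda>(1)[of i] that unfolding Y.linear_on_def by blast
  \<comment> \<open>Coordinate \<open>z\<close> is the socle coordinate after multiplication by the
    path from \<open>z\<close> to the socle, so one extended functional per summand recovers all
    coordinates.\<close>
  define h where "h q = vec (\<lambda>i z. if i < N \<and> x i \<le> z \<and> z < y i
     then \<Lambda> i (path_elem z (y i - 1) \<odot>\<^bsub>Y\<^esub> q) else 0)" for q
  \<comment> \<open>Here injectivity enters: as \<open>x i = g (y i)\<close>, the points with a
    nonzero path to \<open>y i - 1\<close> all lie at or after \<open>x i\<close>, so the expansion
    of a product has no term below the interval.\<close>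
  have x_iff: "x i \<le> w \<longleftrightarrow> y i - 1 < f w" if "i < N" "x i \<noteq> y i" for i w
    using inj that g_le_iff[of "y i" w] unfolding inj_ivl_def by auto
  have "h \<in> left_hom A Y ?I"
  proof (rule left_homI)
    fix q assume q: "q \<in> carrier Y"
    show "h q \<in> carrier ?I" by (rule ivl_carrierI) (auto simp: h_def)
    fix r assume r: "r \<in> carrier A"
    show "h (r \<odot>\<^bsub>Y\<^esub> q) = r \<odot>\<^bsub>?I\<^esub> h q"
    proof (rule vec_eqI)
      fix i z
      show "h (r \<odot>\<^bsub>Y\<^esub> q) (idx i z) = (r \<odot>\<^bsub>?I\<^esub> h q) (idx i z)"
      proof (cases "i < N \<and> x i \<le> z \<and> z < y i")
        case True
        let ?e = "y i - 1"
        have "path_elem z ?e \<odot>\<^bsub>Y\<^esub> (r \<odot>\<^bsub>Y\<^esub> q) = (path_elem z ?e \<otimes> r) \<odot>\<^bsub>Y\<^esub> q"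
          using Y.smult_assoc path_elem(1) r q by simp
        also have "path_elem z ?e \<otimes> r = (\<Oplus>w\<in>{x i..z}. coeff r w z \<odot> path_elem w ?e)"
          by (rule path_elem_mult_expand[OF r]) (use x_iff True in auto)
        \<comment> \<open>Acting on \<open>q\<close> is a homomorphism from the regular module,
          whose finite sums are those of \<open>A\<close>.\<close>
        also have "(\<Oplus>w\<in>{x i..z}. coeff r w z \<odot> path_elem w ?e) \<odot>\<^bsub>Y\<^esub> q =
            finsum Y (\<lambda>w. (coeff r w z \<odot> path_elem w ?e) \<odot>\<^bsub>Y\<^esub> q) {x i..z}"
          using left_hom_finsum[OF regular_left_module Y(1), of "\<lambda>r. r \<odot>\<^bsub>Y\<^esub> q" "{x i..z}"
              "\<lambda>w. coeff r w z \<odot> path_elem w ?e"] q path_elem(1) scale_closed Y.smult_closed Y.smult_l_distr Y.smult_assoc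
          unfolding left_hom_def regular_module_def finsum_def by (auto simp: finprod_def)
        also have "\<dots> = finsum Y (\<lambda>w. Y.sc (coeff r w z) (path_elem w ?e \<odot>\<^bsub>Y\<^esub> q)) {x i..z}"
          using Y.smult_scale path_elem(1) q by simp
        finally have "\<Lambda> i (path_elem z ?e \<odot>\<^bsub>Y\<^esub> (r \<odot>\<^bsub>Y\<^esub> q)) =
            (\<Sum>w\<in>{x i..z}. \<Lambda> i (Y.sc (coeff r w z) (path_elem w ?e \<odot>\<^bsub>Y\<^esub> q)))"
          using Y.linear_on_sum[OF \<Lambda>(1), of "{x i..z}"] Y.sc_closed Y.smult_closed path_elem(1) q by auto
        then show ?thesis using True \<Lambda>_sc Y.smult_closed path_elem(1) q by (simp add: h_def)
      next
        case False
        then show ?thesis by (auto simp: h_def intro!: sum.neutral)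
      qed
    qed
  next
    fix q q' assume "q \<in> carrier Y" "q' \<in> carrier Y"
    then show "h (q \<oplus>\<^bsub>Y\<^esub> q') = h q \<oplus>\<^bsub>?I\<^esub> h q'"
      by (auto intro!: vec_eqI simp: h_def Y.smult_r_distr path_elem(1) \<Lambda>_add Y.smult_closed)
  qed
  moreover have "h (p c) = t c" if c: "c \<in> carrier Z" for c
  proof (rule vec_eqI)
    fix i z
    show "h (p c) (idx i z) = t c (idx i z)"
    proof (cases "i < N \<and> x i \<le> z \<and> z < y i")
      case True
      let ?e = "y i - 1"
      have b: "z \<le> ?e" "?e < f z" using True x_iff[of i z] by auto
      have "h (p c) (idx i z) = \<Lambda> i (p (path_elem z ?e \<odot>\<^bsub>Z\<^esub> c))"
        using True pD(3)[OF path_elem(1) c] by (simp add: h_def)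
      also have "\<dots> = t (path_elem z ?e \<odot>\<^bsub>Z\<^esub> c) (idx i ?e)"
        using \<Lambda>(2) \<mu> Z.smult_closed[OF path_elem(1) c] by simp
      also have "\<dots> = (path_elem z ?e \<odot>\<^bsub>?I\<^esub> t c) (idx i ?e)" using tD(3)[OF path_elem(1) c] by simp
      also have "\<dots> = (\<Sum>w\<in>{x i..?e}. if w = z then t c (idx i z) else 0)"
        using coeff_path_elem_col[OF b] by (simp add: if_distrib[of "\<lambda>a. a * _"] cong: if_cong)
      also have "\<dots> = t c (idx i z)" using True by (simp add: sum.delta)
      finally show ?thesis .
    next
      case False
      then show ?thesis using ivl_carrierD[OF tD(1)[OF c]] by (auto simp: h_def)
    qed
  qed
  ultimately show ?thesis by blast
qed

lemma ivl_injective: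
  assumes "inj_ivl N x y" shows "injective_module A (ivl N x y)"
  unfolding injective_module_def
proof (intro conjI allI impI)
  show "fd_module A (ivl N x y)" using ivl_fd inj_ivl_valid assms by blast
  fix X Y :: "('a, nat \<Rightarrow> 'k) module" and q h
  assume *: "fd_module A X \<and> fd_module A Y \<and> q \<in> left_hom A X Y \<and> inj_on q (carrier X) \<and>
    h \<in> left_hom A X (ivl N x y)"
  then have X: "left_module A X" and Y: "left_module A Y" "fin_dim A Y" by (auto simp: fd_module_def)
  interpret X: algebra_module A X using X by (rule algebra_moduleI)
  have "h c = (\<lambda>_. 0)" if "c \<in> carrier X" "q c = \<zero>\<^bsub>Y\<^esub>" for c
  proof -
    have "q c = q \<zero>\<^bsub>X\<^esub>" using that left_hom_zero[OF X Y(1)] * by simp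
    then have "c = \<zero>\<^bsub>X\<^esub>" using * that X.M.zero_closed by (meson inj_onD)
    then show ?thesis using left_hom_zero[OF X ivl_module[OF inj_ivl_valid[OF assms]]] * by simp
  qed
  then show "\<exists>k\<in>left_hom A Y (ivl N x y). \<forall>c\<in>carrier X. k (q c) = h c"
    using ivl_extend[OF assms X Y, of q h] * by blast
qed

text \<open>The element of \<open>A\<close> that carries the generator of the \<open>i\<close>-th summand to the \<open>i\<close>-th component of \<open>v\<close>.\<close>

definition row_elem :: "(nat \<Rightarrow> int) \<Rightarrow> nat \<Rightarrow> (nat \<Rightarrow> 'k) \<Rightarrow> 'a" where
  "row_elem x i v = mat (\<lambda>w z. if (\<exists>k. w = x i + k * int n) \<and> w \<le> z \<and> z < f w then v (idx i (x i + (z - w))) else 0)"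

lemma row_elem: "row_elem x i v \<in> carrier A"
  "coeff (row_elem x i v) w z = (if (\<exists>k. w = x i + k * int n) \<and> w \<le> z \<and> z < f w then v (idx i (x i + (z - w))) else 0)"
proof -
  let ?F = "\<lambda>w z. if (\<exists>k. w = x i + k * int n) \<and> w \<le> z \<and> z < f w then v (idx i (x i + (z - w))) else 0"
  have 1: "?F w z = 0" if "\<not> (w \<le> z \<and> z < f w)" for w z using that by auto
  have 2: "?F (w + k * int n) (z + k * int n) = ?F w z" for w z k
  proof -
    have "(\<exists>l. w + k * int n = x i + l * int n) \<longleftrightarrow> (\<exists>l. w = x i + l * int n)"
    proof
      assume "\<exists>l. w + k * int n = x i + l * int n"
      then obtain l where "w + k * int n = x i + l * int n" by blast
      then show "\<exists>l. w = x i + l * int n" by (intro exI[of _ "l - k"]) (simp add: algebra_simps)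
    next
      assume "\<exists>l. w = x i + l * int n"
      then obtain l where "w = x i + l * int n" by blast
      then show "\<exists>l. w + k * int n = x i + l * int n" by (intro exI[of _ "l + k"]) (simp add: algebra_simps)
    qed
    then show ?thesis using f_shift[of w k] by auto
  qed
  show "row_elem x i v \<in> carrier A" unfolding row_elem_def using mat(1)[of ?F] 1 2 by blast
  have "coeff (row_elem x i v) = ?F" unfolding row_elem_def using mat(2)[of ?F] 1 2 by blast
  then show "coeff (row_elem x i v) w z = (if (\<exists>k. w = x i + k * int n) \<and> w \<le> z \<and> z < f w then v (idx i (x i + (z - w))) else 0)"
    by simp
qed

text \<open>For \<open>y i = f (x i)\<close> the cut of the interval agrees with the edge of the
  band; for an empty interval the coordinates of \<open>v\<close> in this summand vanish. A nonempty
  interval that is properly shorter would give no homomorphism, since a path killing its generator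
  survives in \<open>A\<close>.\<close>

lemma row_elem_hom:
  assumes i: "i < N" and y: "y i = f (x i) \<or> y i \<le> x i"
  shows "row_elem x i \<in> left_hom A (ivl N x y) (regular_module A)"
proof (rule left_homI)
  fix v w :: "nat \<Rightarrow> 'k"
  show "row_elem x i v \<in> carrier (regular_module A)" using row_elem(1) by (simp add: regular_module_def)
  have "row_elem x i (\<lambda>m. v m + w m) = row_elem x i v \<oplus> row_elem x i w"
    by (rule coeff_inj) (auto simp: row_elem coeff_add intro!: ext)
  then show "row_elem x i (v \<oplus>\<^bsub>ivl N x y\<^esub> w) = row_elem x i v \<oplus>\<^bsub>regular_module A\<^esub> row_elem x i w"
    by (simp add: regular_module_def)
next
  fix r v assume r: "r \<in> carrier A" and v: "v \<in> carrier (ivl N x y)"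
  have "row_elem x i (r \<odot>\<^bsub>ivl N x y\<^esub> v) = r \<otimes> row_elem x i v"
  proof (rule coeff_inj)
    show "coeff (row_elem x i (r \<odot>\<^bsub>ivl N x y\<^esub> v)) = coeff (r \<otimes> row_elem x i v)"
    proof (intro ext)
      fix w z
      show "coeff (row_elem x i (r \<odot>\<^bsub>ivl N x y\<^esub> v)) w z = coeff (r \<otimes> row_elem x i v) w z"
      proof (cases "w \<le> z \<and> z < f w")
        case False
        then show ?thesis using coeff_outside[of "r \<otimes> row_elem x i v" w z] r row_elem by auto
      next
        case wz: True
        show ?thesis
        proof (cases "\<exists>k. w = x i + k * int n")
          case False
          then show ?thesis using wz by (simp add: coeff_mult r row_elem)
        next
          case True
          then obtain k where k: "w = x i + k * int n" by blast
          let ?z = "z - k * int n"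
          have zf: "?z < f (x i)" using wz f_shift[of "x i" k] unfolding k by simp
          have "coeff (r \<otimes> row_elem x i v) w z = (\<Sum>u\<in>{w..z}. coeff r u z * coeff (row_elem x i v) w u)"
            using coeff_mult r row_elem(1) wz by simp
          also have "\<dots> = (\<Sum>u\<in>{w..z}. coeff r u z * v (idx i (u - k * int n)))"
            using True wz by (intro sum.cong refl) (auto simp: row_elem k algebra_simps)
          also have "\<dots> = (\<Sum>u\<in>{x i..?z}. coeff r (u + k * int n) z * v (idx i u))"
            by (rule sum.reindex_bij_witness[of _ "\<lambda>u. u + k * int n" "\<lambda>u. u - k * int n"]) (auto simp: k)
          also have "\<dots> = (\<Sum>u\<in>{x i..?z}. coeff r u ?z * v (idx i u))"
            using coeff_shift[OF r, of _ k ?z] by simp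
          finally have R: "coeff (r \<otimes> row_elem x i v) w z = (\<Sum>u\<in>{x i..?z}. coeff r u ?z * v (idx i u))" .
          have "coeff (row_elem x i (r \<odot>\<^bsub>ivl N x y\<^esub> v)) w z = (r \<odot>\<^bsub>ivl N x y\<^esub> v) (idx i ?z)"
            using True wz by (simp add: row_elem k algebra_simps)
          also have "\<dots> = (\<Sum>u\<in>{x i..?z}. coeff r u ?z * v (idx i u))"
          proof (cases "y i = f (x i)")
            case True then show ?thesis using zf by simp
          next
            case False
            then have "v (idx i u) = 0" for u using ivl_carrierD[OF v, of i u] y by auto
            then show ?thesis by simp
          qed
          finally show ?thesis using R by simp
        qed
      qed
    qed
  qed (use r row_elem in auto)
  then show "row_elem x i (r \<odot>\<^bsub>ivl N x y\<^esub> v) = r \<odot>\<^bsub>regular_module A\<^esub> row_elem x i v"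
    by (simp add: regular_module_def)
qed

definition proj_ivl :: "nat \<Rightarrow> (nat \<Rightarrow> int) \<Rightarrow> (nat \<Rightarrow> int) \<Rightarrow> bool" where
  "proj_ivl N x y \<longleftrightarrow> (\<forall>i<N. y i = f (x i) \<or> y i \<le> x i)"

lemma proj_ivl_valid: "proj_ivl N x y \<Longrightarrow> valid N x y"
  unfolding proj_ivl_def valid_def using f_gt by (metis order_less_imp_le order_refl order_trans)

text \<open>The dual basis property: the maps \<open>row_elem x i\<close> are coordinates with
  respect to the generators of the summands. An empty summand has the zero vector as
  generator.\<close>

lemma row_elem_unit_vec:
  assumes v: "v \<in> carrier (ivl N x y)" and P: "proj_ivl N x y"
  shows "finsum (ivl N x y) (\<lambda>i. row_elem x i v \<odot>\<^bsub>ivl N x y\<^esub> (if x i < y i then unit_vec i (x i) else (\<lambda>_. 0))) {..<N} = v"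
    (is "finsum _ ?F _ = _")
proof (rule vec_eqI)
  fix j z
  have unit_vec: "(if x i < y i then unit_vec i (x i) else (\<lambda>_. 0)) \<in> carrier (ivl N x y)" if "i < N" for i
    using that by (auto simp: ivl_simps(1))
  have "finsum (ivl N x y) ?F {..<N} (idx j z) = (\<Sum>i<N. ?F i (idx j z))"
    using unit_vec ivl_smult_closed by (subst ivl_finsum[OF proj_ivl_valid[OF P]]) auto
  also have "\<dots> = (\<Sum>i<N. if i = j then v (idx j z) else 0)"
  proof (intro sum.cong refl)
    fix i assume i: "i \<in> {..<N}"
    have a: "x i \<le> z \<and> z < y i \<Longrightarrow> y i = f (x i)" using P i unfolding proj_ivl_def by auto
    have b: "\<exists>k. x i = x i + k * int n" by (rule exI[of _ 0]) simp
    show "?F i (idx j z) = (if i = j then v (idx j z) else 0)"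
    proof (cases "i = j \<and> x i \<le> z \<and> z < y i")
      case True
      then have "?F i (idx j z) = (\<Sum>w\<in>{x i..z}. if w = x i then coeff (row_elem x i v) (x i) z else 0)"
        using True by (simp add: if_distrib[of "\<lambda>c. _ * c"] cong: if_cong)
      also have "\<dots> = v (idx i z)" using True a b by (auto simp: row_elem sum.delta)
      finally show ?thesis using True by simp
    next
      case False
      then show ?thesis using ivl_carrierD[OF v, of i z] by (auto intro!: sum.neutral)
    qed
  qed
  also have "\<dots> = v (idx j z)" using ivl_carrierD[OF v, of j z] by (auto simp: sum.delta)
  finally show "finsum (ivl N x y) ?F {..<N} (idx j z) = v (idx j z)" .
qed

lemma ivl_projective:
  assumes P: "proj_ivl N x y" shows "projective_module A (ivl N x y)"
  unfolding projective_module_def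
proof (intro conjI allI impI)
  let ?P = "ivl N x y"
  note valid = proj_ivl_valid[OF P]
  show "fd_module A ?P" using ivl_fd valid by blast
  interpret P: algebra_module A ?P using ivl_module[OF valid] by (rule algebra_moduleI)
  fix X Y :: "('a, nat \<Rightarrow> 'k) module" and q h
  assume *: "fd_module A X \<and> fd_module A Y \<and> q \<in> left_hom A X Y \<and> q ` carrier X = carrier Y \<and>
    h \<in> left_hom A ?P Y"
  then have X: "left_module A X" and Y: "left_module A Y" and q: "q \<in> left_hom A X Y"
    and h: "h \<in> left_hom A ?P Y" by (auto simp: fd_module_def)
  interpret X: algebra_module A X using X by (rule algebra_moduleI)
  interpret Y: algebra_module A Y using Y by (rule algebra_moduleI)
  define e where "e i = (if x i < y i then unit_vec i (x i) else (\<lambda>_. 0))" for i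
  have e: "e i \<in> carrier ?P" if "i < N" for i using that by (auto simp: ivl_simps(1) e_def)
  have "\<forall>i<N. \<exists>s\<in>carrier X. q s = h (e i)"
    using * left_homD(1)[OF h] e by (metis imageE)
  then obtain s where s: "\<And>i. i < N \<Longrightarrow> s i \<in> carrier X" "\<And>i. i < N \<Longrightarrow> q (s i) = h (e i)" by metis
  \<comment> \<open>The lifted generators \<open>s i\<close> are extended to a homomorphism by means
    of the dual basis.\<close>
  define k where "k v = finsum X (\<lambda>i. row_elem x i v \<odot>\<^bsub>X\<^esub> s i) {..<N}" for v
  have F: "(\<lambda>i. row_elem x i v \<odot>\<^bsub>X\<^esub> s i) \<in> {..<N} \<rightarrow> carrier X" for v
    using X.smult_closed row_elem(1) s(1) by auto
  have rrh: "row_elem x i \<in> left_hom A ?P (regular_module A)" if "i < N" for i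
    using row_elem_hom[of i N y x] that P unfolding proj_ivl_def by blast
  have "k \<in> left_hom A ?P X"
  proof (rule left_homI)
    fix v assume v: "v \<in> carrier ?P"
    show "k v \<in> carrier X" unfolding k_def using F by (rule X.M.finsum_closed)
    {
      fix w assume w: "w \<in> carrier ?P"
      have "k (v \<oplus>\<^bsub>?P\<^esub> w) = finsum X (\<lambda>i. row_elem x i v \<odot>\<^bsub>X\<^esub> s i \<oplus>\<^bsub>X\<^esub> row_elem x i w \<odot>\<^bsub>X\<^esub> s i) {..<N}"
        unfolding k_def
      proof (rule X.M.finsum_cong')
        fix i assume "i \<in> {..<N}"
        then show "row_elem x i (v \<oplus>\<^bsub>?P\<^esub> w) \<odot>\<^bsub>X\<^esub> s i = row_elem x i v \<odot>\<^bsub>X\<^esub> s i \<oplus>\<^bsub>X\<^esub> row_elem x i w \<odot>\<^bsub>X\<^esub> s i"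
          using left_homD(2)[OF rrh v w, of i] X.smult_l_distr row_elem(1) s(1) by (simp add: regular_module_def)
      qed (use F in auto)
      then show "k (v \<oplus>\<^bsub>?P\<^esub> w) = k v \<oplus>\<^bsub>X\<^esub> k w" unfolding k_def using F by (simp add: X.M.finsum_addf)
    }
    fix r assume r: "r \<in> carrier A"
    have "(\<lambda>t. r \<odot>\<^bsub>X\<^esub> t) \<zero>\<^bsub>X\<^esub> = \<zero>\<^bsub>X\<^esub>" using X.smult_r_null[OF r] .
    have dist: "r \<odot>\<^bsub>X\<^esub> finsum X G S = finsum X (\<lambda>i. r \<odot>\<^bsub>X\<^esub> G i) S" if "finite S" "G \<in> S \<rightarrow> carrier X" for G S
      using that
    proof (induction S)
      case (insert a S)
      then have "(\<lambda>i. r \<odot>\<^bsub>X\<^esub> G i) \<in> S \<rightarrow> carrier X" "r \<odot>\<^bsub>X\<^esub> G a \<in> carrier X"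
        using X.smult_closed[OF r] by auto
      then show ?case using insert X.smult_r_distr[OF r] by (simp add: Pi_iff)
    qed (simp add: X.smult_r_null r)
    have "k (r \<odot>\<^bsub>?P\<^esub> v) = finsum X (\<lambda>i. r \<odot>\<^bsub>X\<^esub> (row_elem x i v \<odot>\<^bsub>X\<^esub> s i)) {..<N}"
      unfolding k_def
    proof (rule X.M.finsum_cong')
      fix i assume "i \<in> {..<N}"
      then show "row_elem x i (r \<odot>\<^bsub>?P\<^esub> v) \<odot>\<^bsub>X\<^esub> s i = r \<odot>\<^bsub>X\<^esub> (row_elem x i v \<odot>\<^bsub>X\<^esub> s i)"
        using left_homD(3)[OF rrh r v, of i] X.smult_assoc r row_elem(1) s(1) by (simp add: regular_module_def)
    qed (use F X.smult_closed[OF r] in auto)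
    then show "k (r \<odot>\<^bsub>?P\<^esub> v) = r \<odot>\<^bsub>X\<^esub> k v" unfolding k_def using dist[OF _ F[of v]] by simp
  qed
  moreover have "q (k v) = h v" if v: "v \<in> carrier ?P" for v
  proof -
    have "q (k v) = finsum Y (\<lambda>i. q (row_elem x i v \<odot>\<^bsub>X\<^esub> s i)) {..<N}"
      unfolding k_def using left_hom_finsum[OF X Y q _ F] by simp
    also have "\<dots> = finsum Y (\<lambda>i. h (row_elem x i v \<odot>\<^bsub>?P\<^esub> e i)) {..<N}"
      using left_homD(3)[OF q row_elem(1)] left_homD(3)[OF h row_elem(1)] left_homD(1)[OF h] s e P.smult_closed row_elem(1) Y.smult_closed
      by (intro Y.M.finsum_cong') auto
    also have "\<dots> = h (finsum ?P (\<lambda>i. row_elem x i v \<odot>\<^bsub>?P\<^esub> e i) {..<N})"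
      using left_hom_finsum[OF ivl_module[OF valid] Y h, of "{..<N}" "\<lambda>i. row_elem x i v \<odot>\<^bsub>?P\<^esub> e i"] e P.smult_closed row_elem(1)
      by simp
    also have "\<dots> = h v" using row_elem_unit_vec[OF v P] by (simp add: e_def)
    finally show ?thesis .
  qed
  ultimately show "\<exists>k\<in>left_hom A ?P X. \<forall>v\<in>carrier ?P. q (k v) = h v" by blast
qed

end

lemma a_kernel_iff: "x \<in> a_kernel G H h \<longleftrightarrow> x \<in> carrier G \<and> h x = \<zero>\<^bsub>H\<^esub>"
  by (simp add: a_kernel_def kernel_def)

lemma projective_lift:
  fixes A :: "('k::field, 'a) module" and X Y :: "('a, nat \<Rightarrow> 'k) module"
  assumes "projective_module A P" "fd_module A X" "fd_module A Y" "q \<in> left_hom A X Y"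
    "q ` carrier X = carrier Y" "h \<in> left_hom A P Y"
  obtains k where "k \<in> left_hom A P X" "\<And>x. x \<in> carrier P \<Longrightarrow> q (k x) = h x"
  using assms unfolding projective_module_def by blast

context band_algebra begin

section \<open>The regular module as a sum of intervals; essential inclusions\<close>

lemma incl_hom:
  assumes "\<And>i. i < N \<Longrightarrow> x' i \<le> x i"
  shows "(\<lambda>v. v) \<in> left_hom A (ivl N x y) (ivl N x' y)"
proof -
  have eq: "cut x' y v = v" if "v \<in> carrier (ivl N x y)" for v
  proof (rule vec_eqI)
    fix i z
    show "cut x' y v (idx i z) = v (idx i z)"
      using ivl_carrierD[OF that, of i z] assms[of i] by fastforce
  qed
  have "cut x' y \<in> left_hom A (ivl N x y) (ivl N x' y)" using assms by (intro cut_hom) auto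
  then show ?thesis using eq ivl_smult_closed unfolding left_hom_def by (auto simp: Pi_iff)
qed

text \<open>Row \<open>x i\<close> of the matrix of \<open>r\<close> is the component of
  \<open>r\<close> in the projective at \<open>x i\<close>; for \<open>x = int\<close> and
  \<open>N = n\<close> this identifies \<open>A\<close> with the sum of its indecomposable
  projectives.\<close>

definition rows :: "nat \<Rightarrow> (nat \<Rightarrow> int) \<Rightarrow> 'a \<Rightarrow> nat \<Rightarrow> 'k" where
  "rows N x r = vec (\<lambda>i z. if i < N then coeff r (x i) z else 0)"

lemma rows_idx [simp]: "rows N x r (idx i z) = (if i < N then coeff r (x i) z else 0)" by (simp add: rows_def)

text \<open>The target may start earlier than the rows, so that the same map also serves as the
  embedding of \<open>A\<close> into its injective hull.\<close>

lemma rows_hom: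
  assumes "\<And>i. i < N \<Longrightarrow> x' i \<le> x i" "\<And>i. i < N \<Longrightarrow> y i = f (x i)"
  shows "rows N x \<in> left_hom A (regular_module A) (ivl N x' y)"
proof (rule left_homI)
  fix r assume "r \<in> carrier (regular_module A)"
  then have r: "r \<in> carrier A" by (simp add: regular_module_def)
  show "rows N x r \<in> carrier (ivl N x' y)"
  proof (rule ivl_carrierI)
    fix i z assume *: "\<not> (i < N \<and> x' i \<le> z \<and> z < y i)"
    show "rows N x r (idx i z) = 0"
    proof (cases "i < N")
      case True
      then have "\<not> (x i \<le> z \<and> z < f (x i))" using * assms[OF True] by auto
      then show ?thesis using coeff_outside[OF r] by simp
    qed simp
  qed
  {
    fix s assume "s \<in> carrier (regular_module A)"
    then have s: "s \<in> carrier A" by (simp add: regular_module_def)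
    show "rows N x (r \<oplus>\<^bsub>regular_module A\<^esub> s) = rows N x r \<oplus>\<^bsub>ivl N x' y\<^esub> rows N x s"
      using r s by (intro vec_eqI) (simp add: regular_module_def coeff_add)
  }
  fix s assume s: "s \<in> carrier A"
  show "rows N x (s \<odot>\<^bsub>regular_module A\<^esub> r) = s \<odot>\<^bsub>ivl N x' y\<^esub> rows N x r"
  proof (rule vec_eqI)
    fix i z
    show "rows N x (s \<odot>\<^bsub>regular_module A\<^esub> r) (idx i z) = (s \<odot>\<^bsub>ivl N x' y\<^esub> rows N x r) (idx i z)"
    proof (cases "i < N")
      case i: True
      have "(\<Sum>w\<in>{x' i..z}. coeff s w z * coeff r (x i) w) = (\<Sum>w\<in>{x i..z}. coeff s w z * coeff r (x i) w)"
        using assms(1)[OF i] coeff_outside[OF r] by (intro sum.mono_neutral_right) auto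
      also have "\<dots> = coeff (s \<otimes> r) (x i) z" if "z < y i"
        using that assms(2)[OF i] coeff_mult[OF s r, of "x i" z] coeff_outside[of "s \<otimes> r" "x i" z] s r
        by (cases "x i \<le> z") auto
      finally show ?thesis
        using i assms(2)[OF i] coeff_outside[of "s \<otimes> r" "x i" z] s r by (simp add: regular_module_def)
    qed (simp add: regular_module_def)
  qed
qed

lemma row_exists:
  assumes "v \<in> carrier (ivl n int (\<lambda>i. f (int i)))"
  shows "\<exists>r\<in>carrier A. rows n int r = v"
proof -
  \<comment> \<open>Rows 0 to \<open>n - 1\<close> are given and all others are translates:
    \<open>w\<close> is moved to its residue, and \<open>z\<close> along with it.\<close>
  define F where "F w z = (if w \<le> z \<and> z < f w then v (idx (nat (w mod int n)) (z - w + w mod int n)) else 0)" for w z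
  have F: "mat F \<in> carrier A" "coeff (mat F) = F"
    by (rule mat; auto simp: F_def f_shift)+
  have "rows n int (mat F) = v"
  proof (rule vec_eqI)
    fix i z
    show "rows n int (mat F) (idx i z) = v (idx i z)"
      using ivl_carrierD[OF assms, of i z] by (auto simp: F F_def)
  qed
  then show ?thesis using F by blast
qed

lemma rows_inj:
  assumes "r \<in> carrier A" "s \<in> carrier A" "rows n int r = rows n int s" shows "r = s"
proof (rule coeff_inj)
  show "coeff r = coeff s"
  proof (intro ext)
    fix w z
    obtain k where k: "w + k * int n \<in> window" using window_rep by metis
    then obtain i where i: "i < n" "w + k * int n = int i"
      unfolding window_def by (metis atLeastLessThan_iff nonneg_int_cases of_nat_less_iff)
    have "coeff r (int i) (z + k * int n) = coeff s (int i) (z + k * int n)"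
      using arg_cong[OF assms(3), of "\<lambda>v. v (idx i (z + k * int n))"] i by simp
    then show "coeff r w z = coeff s w z" using coeff_shift assms(1,2) i by metis
  qed
qed (use assms in auto)

text \<open>In a nonzero vector of \<open>X\<close>, take a nonzero coordinate farthest from the end
  of its summand and multiply by the path from it to the socle. Everything nearer to its end is
  pushed out or killed, so the product is nonzero and supported on socles; each of these belongs to
  the smaller interval by the second assumption on \<open>x'\<close>.\<close>

lemma ivl_essential:
  assumes V: "valid N x y" and x': "\<And>i. i < N \<Longrightarrow> x i \<le> x' i" "\<And>i. i < N \<Longrightarrow> x i < y i \<Longrightarrow> x' i < y i"
  shows "essential_submodule A (ivl N x y) (carrier (ivl N x' y))"
  unfolding essential_submodule_def
proof (intro conjI allI impI)
  let ?M = "ivl N x y" and ?H = "carrier (ivl N x' y)"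
  interpret M: algebra_module A ?M using ivl_module[OF V] by (rule algebra_moduleI)
  note inc = incl_hom[of N x x' y, OF x'(1)]
  show "submodule ?H A ?M"
  proof (rule M.submoduleI)
    show "?H \<subseteq> carrier ?M" using left_homD(1)[OF inc] by blast
    fix v w assume v: "v \<in> ?H"
    {
      assume w: "w \<in> ?H"
      show "v \<oplus>\<^bsub>?M\<^esub> w \<in> ?H"
        using ivl_carrierD[OF v] ivl_carrierD[OF w] by (intro ivl_carrierI) simp
    }
    fix r assume "r \<in> carrier A"
    then have "r \<odot>\<^bsub>ivl N x' y\<^esub> v = r \<odot>\<^bsub>?M\<^esub> v" using left_homD(3)[OF inc] v by blast
    then show "r \<odot>\<^bsub>?M\<^esub> v \<in> ?H" using ivl_smult_closed[OF v] by metis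
  qed (simp add: ivl_simps(1))
  fix X assume X: "submodule X A ?M \<and> X \<noteq> {\<zero>\<^bsub>?M\<^esub>}"
  note XD = M.submoduleD[OF conjunct1[OF X]]
  obtain v where v: "v \<in> X" "v \<noteq> (\<lambda>_. 0)" using X XD(2) by auto
  have vM: "v \<in> carrier ?M" using v XD(1) by blast
  define T where "T = {(i, z). v (idx i z) \<noteq> 0}"
  have "T \<subseteq> (SIGMA i:{..<N}. {x i..<y i})" using vM by (auto simp: T_def ivl_simps(1))
  then have fin: "finite T" by (rule finite_subset) simp
  have ne: "T \<noteq> {}" using v(2) vec_eqI[of v "\<lambda>_. 0"] by (auto simp: T_def)
  define gap where "gap = (\<lambda>(i, z). y i - 1 - z)"
  have "Max (gap ` T) \<in> gap ` T" using fin ne by simp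
  then obtain i z where iz: "(i, z) \<in> T" "Max (gap ` T) = gap (i, z)" by auto
  have max: "y j - 1 - w \<le> y i - 1 - z" if "v (idx j w) \<noteq> 0" for j w
  proof -
    have "gap (j, w) \<le> Max (gap ` T)" using fin that by (intro Max_ge) (auto simp: T_def)
    then show ?thesis using iz by (simp add: gap_def)
  qed
  define e where "e = y i - 1"
  have i: "i < N" "x i \<le> z" "z < y i" "v (idx i z) \<noteq> 0" using iz vM by (auto simp: T_def ivl_simps(1))
  have e: "z \<le> e" "e < f z" using i V f_mono[of "x i" z] unfolding e_def valid_def by fastforce+
  let ?w = "path_elem z e \<odot>\<^bsub>?M\<^esub> v"
  have wX: "?w \<in> X" using XD(4) v path_elem by blast
  have "?w (idx i e) = (\<Sum>a\<in>{x i..e}. if a = z then v (idx i z) else 0)"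
    using coeff_path_elem_col[OF e] i by (simp add: e_def if_distrib[of "\<lambda>a. a * _"] cong: if_cong)
  then have w0: "?w (idx i e) \<noteq> 0" using i e by (simp add: sum.delta)
  have "?w \<in> ?H"
  proof (rule ivl_carrierI, rule ccontr)
    fix j z' assume out: "\<not> (j < N \<and> x' j \<le> z' \<and> z' < y j)" and nz: "?w (idx j z') \<noteq> 0"
    have j: "j < N" "x j \<le> z'" "z' < y j"
      using nz ivl_carrierD[OF ivl_smult_closed[OF vM], of j z' "path_elem z e"] by (auto simp del: ivl_smult)
    then obtain a where "coeff (path_elem z e) a z' * v (idx j a) \<noteq> 0"
      using nz by (auto elim: sum.not_neutral_contains_not_neutral)
    then obtain k where k: "a = z + k * int n" "z' = e + k * int n" "v (idx j a) \<noteq> 0"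
      by (auto simp: path_elem split: if_splits)
    have "y j - 1 \<le> z'" using max[OF k(3)] k e_def by simp
    then have "z' = y j - 1" using j by simp
    then show False using out j x'(2)[of j] by auto
  qed
  then have "?w \<in> X \<inter> ?H" using wX by blast
  moreover have "?w \<noteq> \<zero>\<^bsub>?M\<^esub>" using w0 by (metis ivl_simps(2))
  ultimately show "X \<inter> ?H \<noteq> {\<zero>\<^bsub>?M\<^esub>}" by blast
qed

lemma ivl_zero: "(\<And>i. i < N \<Longrightarrow> y i \<le> x i) \<Longrightarrow> carrier (ivl N x y) = {\<zero>\<^bsub>ivl N x y\<^esub>}"
proof -
  assume *: "\<And>i. i < N \<Longrightarrow> y i \<le> x i"
  have "v = (\<lambda>_. 0)" if "v \<in> carrier (ivl N x y)" for v
  proof (rule vec_eqI)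
    fix i z
    have "\<not> (i < N \<and> x i \<le> z \<and> z < y i)" using *[of i] by linarith
    then show "v (idx i z) = 0" using ivl_carrierD[OF that] by blast
  qed
  then show ?thesis by (auto simp: ivl_simps(1))
qed


section \<open>The minimal injective resolution\<close>

definition res_term :: "nat \<Rightarrow> ('a, nat \<Rightarrow> 'k) module" where
  "res_term j = ivl n (\<lambda>i. u (int i) (Suc (Suc j))) (\<lambda>i. u (int i) j)"

definition res_map :: "nat \<Rightarrow> (nat \<Rightarrow> 'k) \<Rightarrow> nat \<Rightarrow> 'k" where
  "res_map j = cut (\<lambda>i. u (int i) (Suc (Suc (Suc j)))) (\<lambda>i. u (int i) (Suc j))"

lemma inj_term: "u a (Suc (Suc j)) = u a j \<or> u a (Suc (Suc j)) = g (u a j)"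
  by (simp add: u.simps(3))

lemma res_map_kernel: "a_kernel (res_term j) (res_term (Suc j)) (res_map j) =
   carrier (ivl n (\<lambda>i. u (int i) (Suc j)) (\<lambda>i. u (int i) j))" (is "_ = carrier ?C")
proof (intro equalityI subsetI)
  fix v assume "v \<in> a_kernel (res_term j) (res_term (Suc j)) (res_map j)"
  then have v: "v \<in> carrier (res_term j)" "res_map j v = (\<lambda>_. 0)" by (auto simp: a_kernel_iff res_term_def)
  show "v \<in> carrier ?C"
  proof (rule ivl_carrierI)
    fix i z assume *: "\<not> (i < n \<and> u (int i) (Suc j) \<le> z \<and> z < u (int i) j)"
    have "res_map j v (idx i z) = 0" using v(2) by simp
    then show "v (idx i z) = 0"
      using * ivl_carrierD[of v n _ _ i z] v(1) u_dec[of "int i" "Suc (Suc j)"] unfolding res_term_def res_map_def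
      by (fastforce split: if_splits)
  qed
next
  fix v assume v: "v \<in> carrier ?C"
  have "v \<in> carrier (res_term j)"
    unfolding res_term_def by (rule left_homD(1)[OF incl_hom v]) (rule u_dec)
  moreover have "res_map j v = (\<lambda>_. 0)"
    using ivl_carrierD[OF v] by (intro vec_eqI) (simp add: res_map_def)
  ultimately show "v \<in> a_kernel (res_term j) (res_term (Suc j)) (res_map j)" by (simp add: a_kernel_iff res_term_def)
qed

lemma res_map_hom: "res_map j \<in> left_hom A (res_term j) (res_term (Suc j))"
  unfolding res_map_def res_term_def using u_dec by (intro cut_hom) auto

lemma res_map_image: "res_map j ` carrier (res_term j) = carrier (ivl n (\<lambda>i. u (int i) (Suc (Suc j))) (\<lambda>i. u (int i) (Suc j)))"
  (is "_ = carrier ?C")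
proof (intro equalityI subsetI)
  fix w assume "w \<in> res_map j ` carrier (res_term j)"
  then obtain v where v: "v \<in> carrier (res_term j)" "w = res_map j v" by blast
  show "w \<in> carrier ?C"
    using ivl_carrierD[OF v(1)[unfolded res_term_def]] by (intro ivl_carrierI) (auto simp: v(2) res_map_def)
next
  fix w assume w: "w \<in> carrier ?C"
  have "w \<in> carrier (res_term j)" unfolding res_term_def
  proof (rule ivl_carrierI)
    fix i z assume "\<not> (i < n \<and> u (int i) (Suc (Suc j)) \<le> z \<and> z < u (int i) j)"
    then show "w (idx i z) = 0" using ivl_carrierD[OF w, of i z] u_dec[of "int i" j] by linarith
  qed
  moreover have "res_map j w = w"
  proof (rule vec_eqI)
    fix i z show "res_map j w (idx i z) = w (idx i z)"
      using ivl_carrierD[OF w, of i z] u_dec[of "int i" "Suc (Suc j)"] by (auto simp: res_map_def)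
  qed
  ultimately show "w \<in> res_map j ` carrier (res_term j)" by (metis imageI)
qed

lemma rows_image: "rows n int ` carrier (regular_module A) = carrier (ivl n (\<lambda>i. u (int i) (Suc 0)) (\<lambda>i. u (int i) 0))"
proof (intro equalityI subsetI)
  fix v assume "v \<in> rows n int ` carrier (regular_module A)"
  then show "v \<in> carrier (ivl n (\<lambda>i. u (int i) (Suc 0)) (\<lambda>i. u (int i) 0))"
    using left_homD(1)[OF rows_hom[of n int int "\<lambda>i. f (int i)"]] by auto
next
  fix v assume "v \<in> carrier (ivl n (\<lambda>i. u (int i) (Suc 0)) (\<lambda>i. u (int i) 0))"
  then show "v \<in> rows n int ` carrier (regular_module A)"
    using row_exists[of v] by (auto simp: regular_module_def)
qed

lemma res_term_injective: "injective_module A (res_term j)"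
  unfolding res_term_def using inj_term by (intro ivl_injective) (auto simp: inj_ivl_def)

lemma res_term_valid: "valid n (\<lambda>i. u (int i) (Suc (Suc j))) (\<lambda>i. u (int i) j)"
  using u_le_f by (simp add: valid_def)

lemma minimal_resolution: "minimal_injective_resolution A (regular_module A) res_term (rows n int) res_map"
proof -
  have ess: "essential_submodule A (res_term j) (carrier (ivl n (\<lambda>i. u (int i) (Suc j)) (\<lambda>i. u (int i) j)))" for j
    unfolding res_term_def
  proof (rule ivl_essential[OF res_term_valid])
    \<comment> \<open>A nonempty term has a nonempty cosyzygy, because \<open>u\<close> is constant
      once two neighbours agree.\<close>
    fix i assume "u (int i) (Suc (Suc j)) < u (int i) j"
    then show "u (int i) (Suc j) < u (int i) j"
      using u_const[of "int i" j] u_dec[of "int i" j] by (cases "u (int i) (Suc j) = u (int i) j") auto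
  qed (use u_dec in auto)
  have rows: "rows n int \<in> left_hom A (regular_module A) (res_term 0)"
    unfolding res_term_def using u_dec[of _ "Suc 0"] by (intro rows_hom) auto
  have "inj_on (rows n int) (carrier (regular_module A))"
    using rows_inj by (auto simp: inj_on_def regular_module_def)
  then have "injective_resolution A (regular_module A) res_term (rows n int) res_map"
    unfolding injective_resolution_def
    using res_term_injective rows res_map_hom res_map_kernel res_map_image rows_image by simp
  then show ?thesis unfolding minimal_injective_resolution_def using ess res_map_image rows_image by metis
qed

lemma res_term_projective: "(\<And>a. proj_term a j) \<Longrightarrow> projective_module A (res_term j)"
  unfolding res_term_def
proof (rule ivl_projective)
  assume *: "\<And>a. proj_term a j"
  show "proj_ivl n (\<lambda>i. u (int i) (Suc (Suc j))) (\<lambda>i. u (int i) j)"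
    unfolding proj_ivl_def
  proof (intro allI impI)
    fix i
    show "u (int i) j = f (u (int i) (Suc (Suc j))) \<or> u (int i) j \<le> u (int i) (Suc (Suc j))"
      using *[of "int i"] u_const[of "int i" j] unfolding proj_term_def by auto
  qed
qed

lemma res_term_zero: "(\<And>a. u a (Suc j) = u a j) \<Longrightarrow> carrier (res_term j) = {\<zero>\<^bsub>res_term j\<^esub>}"
  unfolding res_term_def using u_const by (intro ivl_zero) simp


section \<open>Comparison with an arbitrary injective resolution\<close>

definition uni :: "int \<Rightarrow> int \<Rightarrow> ('a, nat \<Rightarrow> 'k) module" where
  "uni x y = ivl 1 (\<lambda>_. x) (\<lambda>_. y)"

abbreviation crd :: "(nat \<Rightarrow> 'k) \<Rightarrow> int \<Rightarrow> 'k" where "crd v z \<equiv> v (idx 0 z)"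

lemma uni_module: "y \<le> f x \<Longrightarrow> left_module A (uni x y)"
  unfolding uni_def by (rule ivl_module) (simp add: valid_def)

lemma uni_fd: "y \<le> f x \<Longrightarrow> fd_module A (uni x y)"
  unfolding uni_def by (rule ivl_fd) (simp add: valid_def)

lemma uni_zero [simp]: "\<zero>\<^bsub>uni x y\<^esub> = (\<lambda>_. 0)" by (simp add: uni_def)

lemma uni_carrierI: "(\<And>i z. \<not> (i = 0 \<and> x \<le> z \<and> z < y) \<Longrightarrow> v (idx i z) = 0) \<Longrightarrow> v \<in> carrier (uni x y)"
  unfolding uni_def by (rule ivl_carrierI) auto

lemma uni_carrierD: "v \<in> carrier (uni x y) \<Longrightarrow> \<not> (i = 0 \<and> x \<le> z \<and> z < y) \<Longrightarrow> v (idx i z) = 0"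
  unfolding uni_def by (erule ivl_carrierD) auto

lemma unit_vec_uni: "x \<le> z \<Longrightarrow> z < y \<Longrightarrow> unit_vec 0 z \<in> carrier (uni x y)"
  unfolding uni_def by (rule unit_vec_in) auto

lemma uni_cut: "x' \<le> x \<Longrightarrow> y' \<le> y \<Longrightarrow> cut (\<lambda>_. x') (\<lambda>_. y') \<in> left_hom A (uni x y) (uni x' y')"
  unfolding uni_def by (rule cut_hom) auto

lemma uni_cut_surj:
  assumes "y' \<le> y"
  shows "cut (\<lambda>_. x) (\<lambda>_. y') ` carrier (uni x y) = carrier (uni x y')"
proof (intro equalityI subsetI)
  fix v assume v: "v \<in> carrier (uni x y')"
  have "v \<in> carrier (uni x y)"
  proof (rule uni_carrierI)
    fix i :: nat and z :: int assume "\<not> (i = 0 \<and> x \<le> z \<and> z < y)"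
    then have "\<not> (i = 0 \<and> x \<le> z \<and> z < y')" using assms by linarith
    then show "v (idx i z) = 0" by (rule uni_carrierD[OF v])
  qed
  moreover have "cut (\<lambda>_. x) (\<lambda>_. y') v = v"
  proof (rule vec_eqI)
    fix i z show "cut (\<lambda>_. x) (\<lambda>_. y') v (idx i z) = v (idx i z)" using uni_carrierD[OF v, of i z] by auto
  qed
  ultimately show "v \<in> cut (\<lambda>_. x) (\<lambda>_. y') ` carrier (uni x y)" by (metis imageI)
next
  fix v assume "v \<in> cut (\<lambda>_. x) (\<lambda>_. y') ` carrier (uni x y)"
  then show "v \<in> carrier (uni x y')" using left_homD(1)[OF uni_cut[of x x y' y]] assms by auto
qed

lemma uni_incl: "x' \<le> x \<Longrightarrow> (\<lambda>v. v) \<in> left_hom A (uni x y) (uni x' y)"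
  unfolding uni_def by (rule incl_hom) auto

lemma uni_path_elem_at:
  assumes "x \<le> z" "z \<le> b" "b < f z" "b < y"
  shows "crd (path_elem z b \<odot>\<^bsub>uni x y\<^esub> v) b = crd v z"
proof -
  have "crd (path_elem z b \<odot>\<^bsub>uni x y\<^esub> v) b = (\<Sum>w\<in>{x..b}. if w = z then crd v z else 0)"
    using assms coeff_path_elem_col[OF assms(2,3)] by (simp add: uni_def if_distrib[of "\<lambda>a. a * _"] cong: if_cong)
  then show ?thesis using assms by (simp add: sum.delta)
qed

lemma uni_path_elem_unit_vec:
  assumes "x \<le> z" "z \<le> b" "b < f z" "y \<le> f x"
  shows "path_elem z b \<odot>\<^bsub>uni x y\<^esub> unit_vec 0 z = (if b < y then unit_vec 0 b else (\<lambda>_. 0))"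
  unfolding uni_def by (rule path_elem_unit_vec) (use assms in \<open>auto simp: valid_def\<close>)

text \<open>All unit vectors are multiples of the generator by paths, so one scalar governs the
  diagonal coordinates. This leading scalar is the invariant carried through the comparison.\<close>

lemma lead:
  assumes h: "h \<in> left_hom A (uni x y) (uni x y')" and y: "y \<le> f x"
    and z: "x \<le> z" "z < y" "z < y'"
  shows "crd (h (unit_vec 0 z)) z = crd (h (unit_vec 0 x)) x"
proof -
  have zf: "z < f x" using y z by simp
  have "unit_vec 0 z = path_elem x z \<odot>\<^bsub>uni x y\<^esub> unit_vec 0 x" using uni_path_elem_unit_vec[of x x z y] z zf y by simp
  then have "h (unit_vec 0 z) = path_elem x z \<odot>\<^bsub>uni x y'\<^esub> h (unit_vec 0 x)"
    using left_homD(3)[OF h path_elem(1)] unit_vec_uni z by simp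
  then show ?thesis using uni_path_elem_at[of x x z y'] z zf by simp
qed

text \<open>The path from \<open>x\<close> to \<open>y\<close> kills the generator of
  \<open>[x, y)\<close>, but moves a nonzero leading coordinate to \<open>y\<close> if the target
  reaches beyond \<open>y\<close>.\<close>

lemma lead_le:
  assumes h: "h \<in> left_hom A (uni x y) (uni x y')" and y: "y' \<le> f x" "y \<le> f x" "x < y"
    and nz: "crd (h (unit_vec 0 x)) x \<noteq> 0"
  shows "y' \<le> y"
proof (rule ccontr)
  assume *: "\<not> y' \<le> y"
  have "path_elem x y \<odot>\<^bsub>uni x y\<^esub> unit_vec 0 x = \<zero>\<^bsub>uni x y\<^esub>" using uni_path_elem_unit_vec[of x x y y] * y by simp
  moreover have "h (path_elem x y \<odot>\<^bsub>uni x y\<^esub> unit_vec 0 x) = path_elem x y \<odot>\<^bsub>uni x y'\<^esub> h (unit_vec 0 x)"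
    using left_homD(3)[OF h path_elem(1) unit_vec_uni, of x] y by simp
  ultimately have "path_elem x y \<odot>\<^bsub>uni x y'\<^esub> h (unit_vec 0 x) = \<zero>\<^bsub>uni x y'\<^esub>"
    using left_hom_zero[OF uni_module uni_module h] y by simp
  then have "crd (path_elem x y \<odot>\<^bsub>uni x y'\<^esub> h (unit_vec 0 x)) y = 0" by simp
  then show False using uni_path_elem_at[of x x y y'] * y nz by simp
qed

lemma uni_extend:
  assumes "x = g y" "left_module A Z" "fd_module A Y" "p \<in> left_hom A Z Y" "t \<in> left_hom A Z (uni x y)"
    and "\<And>c. c \<in> carrier Z \<Longrightarrow> p c = \<zero>\<^bsub>Y\<^esub> \<Longrightarrow> t c = (\<lambda>_. 0)"
  shows "\<exists>h\<in>left_hom A Y (uni x y). \<forall>c\<in>carrier Z. h (p c) = t c"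
  unfolding uni_def by (rule ivl_extend) (use assms in \<open>auto simp: inj_ivl_def fd_module_def uni_def\<close>)

context
  fixes Q :: "nat \<Rightarrow> ('a, nat \<Rightarrow> 'k) module" and \<eta> d
  assumes res: "injective_resolution A (regular_module A) Q \<eta> d"
begin

lemma Q_inj: "injective_module A (Q j)"
  and \<eta>_hom: "\<eta> \<in> left_hom A (regular_module A) (Q 0)"
  and d_hom: "d j \<in> left_hom A (Q j) (Q (Suc j))"
  and \<eta>_inj: "inj_on \<eta> (carrier (regular_module A))"
  and ker_0: "a_kernel (Q 0) (Q (Suc 0)) (d 0) = \<eta> ` carrier (regular_module A)"
  and ker_Suc: "a_kernel (Q (Suc j)) (Q (Suc (Suc j))) (d (Suc j)) = d j ` carrier (Q j)"
  using res by (simp_all add: injective_resolution_def)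

lemma Q_fd: "fd_module A (Q j)" using Q_inj by (simp add: injective_module_def)
lemma Q_module: "left_module A (Q j)" using Q_fd by (simp add: fd_module_def)

lemma Q_extend:
  assumes "x' \<le> x" "y \<le> f x'" "t \<in> left_hom A (uni x y) (Q j)"
  shows "\<exists>h\<in>left_hom A (uni x' y) (Q j). \<forall>v\<in>carrier (uni x y). h v = t v"
proof -
  have "y \<le> f x" using assms f_mono by (meson order_trans)
  then have "fd_module A (uni x y) \<and> fd_module A (uni x' y) \<and> (\<lambda>v. v) \<in> left_hom A (uni x y) (uni x' y) \<and>
    inj_on (\<lambda>v. v) (carrier (uni x y)) \<and> t \<in> left_hom A (uni x y) (Q j)"
    using uni_fd uni_incl assms by (auto simp: inj_on_def)
  then show ?thesis using Q_inj[of j] unfolding injective_module_def by blast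
qed

text \<open>Both maps respect cosyzygies, hence induce maps on the next ones; injectivity of
  \<open>Q (Suc j)\<close> extends one of them and injectivity of the interval the other. The
  extensions are not canonical, so the composite is controlled only through its leading
  scalar.\<close>

lemma comparison:
  assumes "u a (Suc j) \<noteq> u a j"
  shows "\<exists>s\<in>left_hom A (uni (u a (Suc (Suc j))) (u a j)) (Q j).
     \<exists>r\<in>left_hom A (Q j) (uni (u a (Suc (Suc j))) (u a j)).
       (\<forall>v\<in>carrier (uni (u a (Suc j)) (u a j)). d j (s v) = \<zero>\<^bsub>Q (Suc j)\<^esub>) \<and>
       (\<forall>q\<in>carrier (Q j). d j q = \<zero>\<^bsub>Q (Suc j)\<^esub> \<longrightarrow> r q \<in> carrier (uni (u a (Suc j)) (u a j))) \<and>
       crd (r (s (unit_vec 0 (u a (Suc (Suc j)))))) (u a (Suc (Suc j))) \<noteq> 0"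
  using assms
proof (induction j)
  case 0
  let ?x = "u a (Suc (Suc 0))"
  have x: "?x \<le> a" "f a \<le> f ?x" "?x = g (f a)"
    using u_dec[of a "Suc 0"] u_le_f[of a 0] u_step[OF u_0_neq[of a]] by simp_all
  note xf = f_gt[of a]
  have rrh: "row_elem (\<lambda>_. a) 0 \<in> left_hom A (uni a (f a)) (regular_module A)"
    unfolding uni_def by (rule row_elem_hom) auto
  obtain s where s: "s \<in> left_hom A (uni ?x (f a)) (Q 0)"
    "\<And>v. v \<in> carrier (uni a (f a)) \<Longrightarrow> s v = \<eta> (row_elem (\<lambda>_. a) 0 v)"
    using Q_extend[OF x(1,2) left_hom_comp[OF rrh \<eta>_hom]] by blast
  have prh: "rows 1 (\<lambda>_. a) \<in> left_hom A (regular_module A) (uni ?x (f a))"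
    unfolding uni_def by (rule rows_hom) (use x in auto)
  have "rows 1 (\<lambda>_. a) c = (\<lambda>_. 0)" if "c \<in> carrier (regular_module A)" "\<eta> c = \<zero>\<^bsub>Q 0\<^esub>" for c
  proof -
    have "\<zero>\<^bsub>regular_module A\<^esub> \<in> carrier (regular_module A)" by (simp add: regular_module_def)
    then have "c = \<zero>\<^bsub>regular_module A\<^esub>"
      using that left_hom_zero[OF regular_left_module Q_module \<eta>_hom] \<eta>_inj by (metis inj_onD)
    then show ?thesis
      using left_hom_zero[OF regular_left_module uni_module prh] x by simp
  qed
  then obtain r where r: "r \<in> left_hom A (Q 0) (uni ?x (f a))"
    "\<And>c. c \<in> carrier (regular_module A) \<Longrightarrow> r (\<eta> c) = rows 1 (\<lambda>_. a) c"
    using uni_extend[OF x(3) regular_left_module Q_fd \<eta>_hom prh] by blast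
  have ker: "d 0 (\<eta> c) = \<zero>\<^bsub>Q (Suc 0)\<^esub>" if "c \<in> carrier (regular_module A)" for c
    using that ker_0 by (metis a_kernel_iff imageI)
  have 1: "\<forall>v\<in>carrier (uni (u a (Suc 0)) (u a 0)). d 0 (s v) = \<zero>\<^bsub>Q (Suc 0)\<^esub>"
    using ker s(2) left_homD(1)[OF rrh] by simp
  have 2: "r q \<in> carrier (uni (u a (Suc 0)) (u a 0))" if "q \<in> carrier (Q 0)" "d 0 q = \<zero>\<^bsub>Q (Suc 0)\<^esub>" for q
  proof -
    have "q \<in> \<eta> ` carrier (regular_module A)" using that ker_0 by (metis a_kernel_iff)
    then obtain c where c: "c \<in> carrier (regular_module A)" "q = \<eta> c" by blast
    have "r q \<in> carrier (uni a (f a))"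
    proof (rule uni_carrierI)
      fix i :: nat and z :: int assume "\<not> (i = 0 \<and> a \<le> z \<and> z < f a)"
      then show "r q (idx i z) = 0"
        using r(2)[OF c(1)] c coeff_outside[of c a z] by (auto simp: regular_module_def)
    qed
    then show ?thesis by simp
  qed
  have "crd (r (s (unit_vec 0 a))) a = coeff (row_elem (\<lambda>_. a) 0 (unit_vec 0 a)) a a"
    using s(2)[OF unit_vec_uni, of a] r(2) left_homD(1)[OF rrh unit_vec_uni, of a] xf by simp
  also have "\<dots> = 1" using xf by (auto simp: row_elem intro: exI[of _ 0])
  finally have "crd (r (s (unit_vec 0 ?x))) ?x = 1"
    using lead[OF left_hom_comp[OF s(1) r(1)], of a] x xf by simp
  then have 3: "crd (r (s (unit_vec 0 ?x))) ?x \<noteq> 0" by simp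
  show ?case
    by (rule bexI[of _ s], rule bexI[of _ r]) (use s(1) r(1) 1 2 3 in simp_all)
next
  case (Suc j)
  have nz: "u a (Suc j) \<noteq> u a j" using Suc.prems u_const by blast
  let ?x = "u a (Suc (Suc j))" and ?y = "u a (Suc j)" and ?x' = "u a (Suc (Suc (Suc j)))"
  have lt: "?x < ?y" using Suc.prems u_dec[of a "Suc j"] by simp
  have yle: "?y \<le> u a j" "u a j \<le> f ?x" using u_dec u_le_f by auto
  have x': "?x' \<le> ?x" "?y \<le> f ?x'" "?x' = g ?y"
    using u_dec[of a "Suc (Suc j)"] u_le_f[of a "Suc j"] u_step[OF Suc.prems] by auto
  obtain s r where s: "s \<in> left_hom A (uni ?x (u a j)) (Q j)" and r: "r \<in> left_hom A (Q j) (uni ?x (u a j))"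
    and sC: "\<And>v. v \<in> carrier (uni ?y (u a j)) \<Longrightarrow> d j (s v) = \<zero>\<^bsub>Q (Suc j)\<^esub>"
    and rC: "\<And>q. q \<in> carrier (Q j) \<Longrightarrow> d j q = \<zero>\<^bsub>Q (Suc j)\<^esub> \<Longrightarrow> r q \<in> carrier (uni ?y (u a j))"
    and top: "crd (r (s (unit_vec 0 ?x))) ?x \<noteq> 0"
    using Suc.IH[OF nz] by blast
  interpret QS: algebra_module A "Q (Suc j)" using Q_module by (rule algebra_moduleI)
  define t where "t v = d j (s v)" for v
  have tI: "t \<in> left_hom A (uni ?x (u a j)) (Q (Suc j))"
    unfolding t_def using left_hom_comp[OF s d_hom] .
  have sub: "v \<in> carrier (uni ?x (u a j))" if "v \<in> carrier (uni ?x ?y)" for v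
    using uni_carrierD[OF that] yle by (intro uni_carrierI) force
  \<comment> \<open>The quotient \<open>[u (j + 2), u (j + 1))\<close> uses part of the coordinates
    of the term without being a submodule of it in general, so linearity over \<open>A\<close> has
    to be checked anew.\<close>
  have "t \<in> left_hom A (uni ?x ?y) (Q (Suc j))"
  proof (rule left_homI)
    fix v assume v: "v \<in> carrier (uni ?x ?y)"
    show "t v \<in> carrier (Q (Suc j))" using left_homD(1)[OF tI] sub v by blast
    {
      fix w assume w: "w \<in> carrier (uni ?x ?y)"
      have "v \<oplus>\<^bsub>uni ?x ?y\<^esub> w = v \<oplus>\<^bsub>uni ?x (u a j)\<^esub> w" by (simp add: uni_def)
      then show "t (v \<oplus>\<^bsub>uni ?x ?y\<^esub> w) = t v \<oplus>\<^bsub>Q (Suc j)\<^esub> t w"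
        using left_homD(2)[OF tI] sub v w by simp
    }
    fix b assume b: "b \<in> carrier A"
    define v1 where "v1 = b \<odot>\<^bsub>uni ?x ?y\<^esub> v"
    define v2 where "v2 = b \<odot>\<^bsub>uni ?x (u a j)\<^esub> v"
    have v1': "v1 \<in> carrier (uni ?x ?y)"
      using ivl_smult_closed v unfolding v1_def uni_def by blast
    note v1 = sub[OF v1']
    have v2: "v2 \<in> carrier (uni ?x (u a j))"
      using ivl_smult_closed sub[OF v] unfolding v2_def uni_def by blast
    \<comment> \<open>The two products differ by a vector supported on
      \<open>[u (j + 1), u j)\<close>, which \<open>d j\<close> annihilates after
      \<open>s\<close>.\<close>
    have "(\<lambda>m. v2 m - v1 m) \<in> carrier (uni ?y (u a j))"
    proof (rule uni_carrierI)
      fix i :: nat and z :: int assume *: "\<not> (i = 0 \<and> ?y \<le> z \<and> z < u a j)"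
      show "v2 (idx i z) - v1 (idx i z) = 0"
      proof (cases "i = 0 \<and> z < ?y")
        case True
        then show ?thesis using yle by (simp add: v1_def v2_def uni_def)
      next
        case False
        then have "\<not> (i = 0 \<and> ?x \<le> z \<and> z < ?y)" "\<not> (i = 0 \<and> ?x \<le> z \<and> z < u a j)" using * by auto
        then show ?thesis using uni_carrierD[OF v1'] uni_carrierD[OF v2] by simp
      qed
    qed
    note dC = this sC[OF this]
    have dI: "(\<lambda>m. v2 m - v1 m) \<in> carrier (uni ?x (u a j))"
      using left_homD(1)[OF uni_incl dC(1)] lt by simp
    have "v2 = v1 \<oplus>\<^bsub>uni ?x (u a j)\<^esub> (\<lambda>m. v2 m - v1 m)" by (simp add: uni_def)
    then have "t v2 = t v1 \<oplus>\<^bsub>Q (Suc j)\<^esub> t (\<lambda>m. v2 m - v1 m)"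
      using left_homD(2)[OF tI v1 dI] by metis
    also have "\<dots> = t v1" using dC(2) left_homD(1)[OF tI v1] by (simp add: t_def)
    finally show "t (b \<odot>\<^bsub>uni ?x ?y\<^esub> v) = b \<odot>\<^bsub>Q (Suc j)\<^esub> t v"
      using left_homD(3)[OF tI b] sub v unfolding v1_def v2_def by simp
  qed
  then obtain s' where s': "s' \<in> left_hom A (uni ?x' ?y) (Q (Suc j))"
    "\<And>v. v \<in> carrier (uni ?x ?y) \<Longrightarrow> s' v = d j (s v)"
    using Q_extend[OF x'(1,2)] unfolding t_def by blast
  let ?R = "cut (\<lambda>_. ?x') (\<lambda>_. ?y)"
  have R: "(\<lambda>q. ?R (r q)) \<in> left_hom A (Q j) (uni ?x' ?y)"
    using left_hom_comp[OF r uni_cut] x' yle by blast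
  have "?R (r q) = (\<lambda>_. 0)" if "q \<in> carrier (Q j)" "d j q = \<zero>\<^bsub>Q (Suc j)\<^esub>" for q
  proof (rule vec_eqI)
    fix i z show "?R (r q) (idx i z) = 0" using uni_carrierD[OF rC[OF that], of i z] by auto
  qed
  then obtain r' where r': "r' \<in> left_hom A (Q (Suc j)) (uni ?x' ?y)"
    "\<And>q. q \<in> carrier (Q j) \<Longrightarrow> r' (d j q) = ?R (r q)"
    using uni_extend[OF x'(3) Q_module Q_fd d_hom R] by blast
  have 1: "d (Suc j) (s' v) = \<zero>\<^bsub>Q (Suc (Suc j))\<^esub>" if "v \<in> carrier (uni ?x ?y)" for v
  proof -
    have "s' v \<in> d j ` carrier (Q j)" using s'(2)[OF that] left_homD(1)[OF s] sub[OF that] by blast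
    then show ?thesis using ker_Suc by (metis a_kernel_iff)
  qed
  have 2: "r' q \<in> carrier (uni ?x ?y)" if q: "q \<in> carrier (Q (Suc j))" "d (Suc j) q = \<zero>\<^bsub>Q (Suc (Suc j))\<^esub>" for q
  proof -
    have "q \<in> d j ` carrier (Q j)" using q ker_Suc by (metis a_kernel_iff)
    then obtain p where p: "p \<in> carrier (Q j)" "q = d j p" by blast
    show ?thesis
    proof (rule uni_carrierI)
      fix i :: nat and z :: int assume "\<not> (i = 0 \<and> ?x \<le> z \<and> z < ?y)"
      then show "r' q (idx i z) = 0"
        using uni_carrierD[OF left_homD(1)[OF r p(1)], of i z] r'(2)[OF p(1)] p(2) yle by auto
    qed
  qed
  \<comment> \<open>The point \<open>?x\<close> lies in the new cosyzygy, where both extensions are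
    prescribed; \<open>lead\<close> carries the scalar from there to the start
    \<open>?x'\<close>.\<close>
  have "crd (r' (s' (unit_vec 0 ?x))) ?x = crd (r (s (unit_vec 0 ?x))) ?x"
    using s'(2)[OF unit_vec_uni] r'(2)[OF left_homD(1)[OF s sub[OF unit_vec_uni]]] lt x' by simp
  then have "crd (r' (s' (unit_vec 0 ?x'))) ?x' \<noteq> 0"
    using lead[OF left_hom_comp[OF s'(1) r'(1)], of ?x] x' lt top by simp
  then show ?case using s'(1) r'(1) 1 2 by blast
qed

lemma resolution_nonzero:
  assumes "u a (Suc j) \<noteq> u a j" shows "carrier (Q j) \<noteq> {\<zero>\<^bsub>Q j\<^esub>}"
proof
  assume z: "carrier (Q j) = {\<zero>\<^bsub>Q j\<^esub>}"
  let ?x = "u a (Suc (Suc j))"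
  obtain s r where s: "s \<in> left_hom A (uni ?x (u a j)) (Q j)" and r: "r \<in> left_hom A (Q j) (uni ?x (u a j))"
    and top: "crd (r (s (unit_vec 0 ?x))) ?x \<noteq> 0" using comparison[OF assms] by blast
  have "?x < u a j" using u_dec[of a j] u_dec[of a "Suc j"] assms by simp
  then have "s (unit_vec 0 ?x) = \<zero>\<^bsub>Q j\<^esub>" using left_homD(1)[OF s unit_vec_uni] z by simp
  then show False using top left_hom_zero[OF Q_module uni_module r] u_le_f by simp
qed

text \<open>If the term is projective, the map back to \<open>[x, y)\<close> lifts through the
  projective cover \<open>[x, f x)\<close>. The lift still has nonzero leading scalar, so
  \<open>f x \<le> y\<close> and the interval is projective.\<close>

lemma resolution_proj_term:
  assumes P: "projective_module A (Q j)" shows "proj_term a j"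
proof (cases "u a (Suc j) = u a j")
  case False
  let ?x = "u a (Suc (Suc j))" and ?y = "u a j"
  obtain s r where s: "s \<in> left_hom A (uni ?x ?y) (Q j)" and r: "r \<in> left_hom A (Q j) (uni ?x ?y)"
    and top: "crd (r (s (unit_vec 0 ?x))) ?x \<noteq> 0" using comparison[OF False] by blast
  have x: "?x < ?y" "?y \<le> f ?x" using u_dec[of a j] u_dec[of a "Suc j"] False u_le_f by auto
  let ?R = "cut (\<lambda>_. ?x) (\<lambda>_. ?y)"
  have R: "?R \<in> left_hom A (uni ?x (f ?x)) (uni ?x ?y)" using uni_cut x by blast
  obtain h where h: "h \<in> left_hom A (Q j) (uni ?x (f ?x))"
    "\<And>q. q \<in> carrier (Q j) \<Longrightarrow> ?R (h q) = r q"
    using projective_lift[OF P uni_fd uni_fd[OF x(2)] R uni_cut_surj[OF x(2)] r] by blast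
  have "r (s (unit_vec 0 ?x)) = ?R (h (s (unit_vec 0 ?x)))"
    using h(2) left_homD(1)[OF s unit_vec_uni] x by simp
  then have "crd (h (s (unit_vec 0 ?x))) ?x \<noteq> 0" using top by (auto split: if_splits)
  then have "f ?x \<le> ?y" using lead_le[OF left_hom_comp[OF s h(1)]] x by simp
  then show ?thesis using x by (simp add: proj_term_def)
qed (simp add: proj_term_def)

end

section \<open>Reading off the two dimensions\<close>

lemma inj_dim_le_iff:
  "(\<exists>Q \<eta> d. injective_resolution A (regular_module A) Q \<eta> d \<and> (\<forall>j>m. carrier (Q j) = {\<zero>\<^bsub>Q j\<^esub>})) \<longleftrightarrow>
   (\<forall>a. u a (Suc (Suc m)) = u a (Suc m))"
proof
  assume "\<exists>Q \<eta> d. injective_resolution A (regular_module A) Q \<eta> d \<and> (\<forall>j>m. carrier (Q j) = {\<zero>\<^bsub>Q j\<^esub>})"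
  then show "\<forall>a. u a (Suc (Suc m)) = u a (Suc m)" using resolution_nonzero by blast
next
  assume *: "\<forall>a. u a (Suc (Suc m)) = u a (Suc m)"
  have "carrier (res_term j) = {\<zero>\<^bsub>res_term j\<^esub>}" if "j > m" for j
    using * u_const_le[of _ "Suc m" j] that by (intro res_term_zero) simp
  then show "\<exists>Q \<eta> d. injective_resolution A (regular_module A) Q \<eta> d \<and> (\<forall>j>m. carrier (Q j) = {\<zero>\<^bsub>Q j\<^esub>})"
    using minimal_resolution unfolding minimal_injective_resolution_def by blast
qed

lemma dom_dim_ge_iff:
  "(\<exists>Q \<eta> d. minimal_injective_resolution A (regular_module A) Q \<eta> d \<and> (\<forall>j<m. projective_module A (Q j))) \<longleftrightarrow>
   (\<forall>a. \<forall>j<m. proj_term a j)"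
proof
  assume "\<exists>Q \<eta> d. minimal_injective_resolution A (regular_module A) Q \<eta> d \<and> (\<forall>j<m. projective_module A (Q j))"
  then show "\<forall>a. \<forall>j<m. proj_term a j"
    using resolution_proj_term unfolding minimal_injective_resolution_def by blast
next
  assume "\<forall>a. \<forall>j<m. proj_term a j"
  then show "\<exists>Q \<eta> d. minimal_injective_resolution A (regular_module A) Q \<eta> d \<and> (\<forall>j<m. projective_module A (Q j))"
    using minimal_resolution res_term_projective by blast
qed

lemma Inf_enat_iff: "Inf {enat m | m. T m} = enat d \<longleftrightarrow> T d \<and> (\<forall>m<d. \<not> T m)"
proof
  assume I: "Inf {enat m | m. T m} = enat d"
  have "{enat m | m. T m} \<noteq> {}" using I by (auto simp: Inf_enat_def split: if_splits)
  then have "Inf {enat m | m. T m} \<in> {enat m | m. T m}"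
    unfolding Inf_enat_def by (auto intro: LeastI)
  then have "T d" using I by auto
  moreover have "\<not> T m" if "m < d" for m
  proof
    assume "T m"
    then have "Inf {enat m | m. T m} \<le> enat m" by (intro Inf_lower) blast
    then show False using I that by simp
  qed
  ultimately show "T d \<and> (\<forall>m<d. \<not> T m)" by blast
next
  assume *: "T d \<and> (\<forall>m<d. \<not> T m)"
  show "Inf {enat m | m. T m} = enat d"
  proof (rule antisym)
    show "Inf {enat m | m. T m} \<le> enat d" using * by (intro Inf_lower) blast
    show "enat d \<le> Inf {enat m | m. T m}" using * by (intro Inf_greatest) (auto simp: not_less[symmetric])
  qed
qed

lemma Sup_enat_iff:
  assumes "\<And>m. W (Suc m) \<Longrightarrow> W m" "W 0"
  shows "Sup {enat m | m. W m} = enat d \<longleftrightarrow> W d \<and> \<not> W (Suc d)"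
proof -
  have down: "W m" if "W m'" "m \<le> m'" for m m'
    using that(2,1) by (induction rule: inc_induct) (use assms(1) in auto)
  show ?thesis
  proof
    assume S: "Sup {enat m | m. W m} = enat d"
    have le: "m \<le> d" if "W m" for m
    proof -
      have "enat m \<le> Sup {enat m | m. W m}" using that by (intro Sup_upper) blast
      then show ?thesis using S by simp
    qed
    have "W d"
    proof (rule ccontr)
      assume n: "\<not> W d"
      then have lt: "m < d" if "W m" for m using le that by (metis order_le_less)
      then have "d > 0" using assms(2) by blast
      then have "Sup {enat m | m. W m} \<le> enat (d - 1)"
      proof (intro Sup_least)
        fix e assume "e \<in> {enat m | m. W m}"
        then obtain m where "W m" "e = enat m" by blast
        then show "e \<le> enat (d - 1)" using lt[of m] by simp
      qed
      then show False using S \<open>d > 0\<close> by simp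
    qed
    then show "W d \<and> \<not> W (Suc d)" using le[of "Suc d"] by auto
  next
    assume *: "W d \<and> \<not> W (Suc d)"
    show "Sup {enat m | m. W m} = enat d"
    proof (rule antisym)
      show "Sup {enat m | m. W m} \<le> enat d"
      proof (rule Sup_least)
        fix e assume "e \<in> {enat m | m. W m}"
        then obtain m where m: "W m" "e = enat m" by blast
        then have "\<not> Suc d \<le> m" using * down by blast
        then show "e \<le> enat d" using m by simp
      qed
      show "enat d \<le> Sup {enat m | m. W m}" using * by (intro Sup_upper) blast
    qed
  qed
qed

lemma auslander_gorenstein_iff: "minimal_auslander_gorenstein A d \<longleftrightarrow> resolution_cond d"
proof -
  have id: "inj_dim A (regular_module A) = enat d \<longleftrightarrow>
     (\<forall>a. u a (Suc (Suc d)) = u a (Suc d)) \<and> (\<forall>m<d. \<not> (\<forall>a. u a (Suc (Suc m)) = u a (Suc m)))"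
    unfolding inj_dim_def inj_dim_le_iff by (rule Inf_enat_iff)
  have dd: "dom_dim A = enat d \<longleftrightarrow>
     (\<forall>a. \<forall>j<d. proj_term a j) \<and> \<not> (\<forall>a. \<forall>j<Suc d. proj_term a j)"
    unfolding dom_dim_def dom_dim_ge_iff by (rule Sup_enat_iff) auto
  \<comment> \<open>Once two neighbours agree the sequence stays constant, so among all
    \<open>m < d\<close> only \<open>m = d - 1\<close> has to be tested.\<close>
  have "(\<forall>m<d. \<not> (\<forall>a. u a (Suc (Suc m)) = u a (Suc m))) \<longleftrightarrow> \<not> (\<forall>a. u a (Suc d) = u a d)" if "d \<ge> 1"
  proof
    assume "\<forall>m<d. \<not> (\<forall>a. u a (Suc (Suc m)) = u a (Suc m))"
    then show "\<not> (\<forall>a. u a (Suc d) = u a d)" using that by (cases d) auto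
  next
    assume *: "\<not> (\<forall>a. u a (Suc d) = u a d)"
    show "\<forall>m<d. \<not> (\<forall>a. u a (Suc (Suc m)) = u a (Suc m))"
      using * u_const_le[of _ "Suc m" d for m] by (metis Suc_leI)
  qed
  moreover have "(\<forall>a. \<forall>j<d. proj_term a j) \<Longrightarrow> (\<forall>a. \<forall>j<Suc d. proj_term a j) \<longleftrightarrow> (\<forall>a. proj_term a d)"
    by (auto simp: less_Suc_eq)
  ultimately show ?thesis
    unfolding minimal_auslander_gorenstein_def resolution_cond_def id dd by blast
qed

end

section \<open>Socles, radicals and simple modules\<close>

lemma left_hom_inv:
  assumes N: "left_module A N" and t: "t \<in> left_hom A N L" "bij_betw t (carrier N) (carrier L)"
  shows "inv_into (carrier N) t \<in> left_hom A L N"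
    and "bij_betw (inv_into (carrier N) t) (carrier L) (carrier N)"
proof -
  interpret N: left_module A N by fact
  let ?s = "inv_into (carrier N) t"
  show bij: "bij_betw ?s (carrier L) (carrier N)" using t(2) by (rule bij_betw_inv_into)
  have ts: "t (?s y) = y" "?s y \<in> carrier N" if "y \<in> carrier L" for y
    using that t(2) bij by (auto simp: bij_betw_inv_into_right bij_betw_apply)
  have st: "?s (t x) = x" if "x \<in> carrier N" for x
    using that t(2) by (simp add: bij_betw_inv_into_left)
  show "?s \<in> left_hom A L N"
  proof (rule left_homI)
    fix x assume x: "x \<in> carrier L"
    show "?s x \<in> carrier N" using ts x by simp
    {
      fix y assume y: "y \<in> carrier L"
      have "t (?s x \<oplus>\<^bsub>N\<^esub> ?s y) = x \<oplus>\<^bsub>L\<^esub> y" using left_homD(2)[OF t(1)] ts x y by simp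
      then show "?s (x \<oplus>\<^bsub>L\<^esub> y) = ?s x \<oplus>\<^bsub>N\<^esub> ?s y" using st ts x y by (metis N.M.a_closed)
    }
    fix r assume r: "r \<in> carrier A"
    have "t (r \<odot>\<^bsub>N\<^esub> ?s x) = r \<odot>\<^bsub>L\<^esub> x" using left_homD(3)[OF t(1)] ts x r by simp
    then show "?s (r \<odot>\<^bsub>L\<^esub> x) = r \<odot>\<^bsub>N\<^esub> ?s x" using st ts x r by (metis N.smult_closed)
  qed
qed

text \<open>The isomorphism theorem, in the direction from the image: \<open>t\<close> sends a
  vector to its fibre under \<open>h\<close>, and the fibres are the cosets. Its value at zero is
  recorded for transporting kernels to the quotient.\<close>

lemma (in k_algebra) quotient_iso:
  assumes M: "left_module A M" and N: "left_module A N"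
    and h: "h \<in> left_hom A M N" and surj: "h ` carrier M = carrier N"
    and K: "K = {x \<in> carrier M. h x = \<zero>\<^bsub>N\<^esub>}"
  shows "\<exists>t\<in>left_hom A N (quotient_module M K). bij_betw t (carrier N) (carrier (quotient_module M K)) \<and>
     t \<zero>\<^bsub>N\<^esub> = \<zero>\<^bsub>quotient_module M K\<^esub>"
proof -
  interpret M: algebra_module A M using M by (rule algebra_moduleI)
  interpret N: algebra_module A N using N by (rule algebra_moduleI)
  note hD = left_homD[OF h]
  define C where "C v = {y \<in> carrier M. h y = v}" for v
  have coset: "K +>\<^bsub>M\<^esub> x = C (h x)" if x: "x \<in> carrier M" for x
  proof (intro equalityI subsetI)
    fix y assume "y \<in> K +>\<^bsub>M\<^esub> x"
    then obtain k where "k \<in> K" "y = k \<oplus>\<^bsub>M\<^esub> x" by (auto simp: a_r_coset_def')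
    then show "y \<in> C (h x)" using hD x K by (simp add: C_def)
  next
    fix y assume "y \<in> C (h x)"
    then have y: "y \<in> carrier M" "h y = h x" by (auto simp: C_def)
    have "y = (y \<ominus>\<^bsub>M\<^esub> x) \<oplus>\<^bsub>M\<^esub> x" using x y by (simp add: a_minus_def M.M.a_assoc M.M.l_neg)
    moreover have "h (y \<ominus>\<^bsub>M\<^esub> x) = \<zero>\<^bsub>N\<^esub>"
      using left_hom_diff[OF M N h y(1) x] y hD(1)[OF x] by (simp add: a_minus_def N.M.r_neg)
    ultimately show "y \<in> K +>\<^bsub>M\<^esub> x" using x y K by (auto simp: a_r_coset_def')
  qed
  have carr: "carrier (quotient_module M K) = C ` carrier N"
    unfolding quotient_module_def A_RCOSETS_def' surj[symmetric] using coset by auto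
  have C_in: "\<exists>x\<in>carrier M. h x = v" if "v \<in> carrier N" for v using that surj by (metis imageE)
  have "C \<in> left_hom A N (quotient_module M K)"
  proof (rule left_homI)
    fix v assume v: "v \<in> carrier N"
    show "C v \<in> carrier (quotient_module M K)" using v carr by simp
    obtain x where x: "x \<in> carrier M" "h x = v" using C_in[OF v] by blast
    {
      fix w assume w: "w \<in> carrier N"
      have "C (v \<oplus>\<^bsub>N\<^esub> w) = set_add M (C v) (C w)"
      proof (intro equalityI subsetI)
        fix z assume "z \<in> C (v \<oplus>\<^bsub>N\<^esub> w)"
        then have z: "z \<in> carrier M" "h z = v \<oplus>\<^bsub>N\<^esub> w" by (auto simp: C_def)
        have "z \<ominus>\<^bsub>M\<^esub> x \<in> C w"
          using left_hom_diff[OF M N h z(1) x(1)] z x v w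
          by (simp add: C_def a_minus_def N.M.a_assoc N.M.a_lcomm[of v w] N.M.r_neg)
        moreover have "z = x \<oplus>\<^bsub>M\<^esub> (z \<ominus>\<^bsub>M\<^esub> x)"
          using x z by (simp add: a_minus_def M.M.a_lcomm[of x z] M.M.r_neg)
        moreover have "x \<in> C v" using x by (simp add: C_def)
        ultimately show "z \<in> set_add M (C v) (C w)" by (auto simp: set_add_def')
      next
        fix z assume "z \<in> set_add M (C v) (C w)"
        then show "z \<in> C (v \<oplus>\<^bsub>N\<^esub> w)" using hD by (auto simp: set_add_def' C_def)
      qed
      then show "C (v \<oplus>\<^bsub>N\<^esub> w) = C v \<oplus>\<^bsub>quotient_module M K\<^esub> C w" by (simp add: quotient_module_def)
    }
    fix r assume r: "r \<in> carrier A"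
    have "(\<Union>y\<in>C v. K +>\<^bsub>M\<^esub> (r \<odot>\<^bsub>M\<^esub> y)) = C (r \<odot>\<^bsub>N\<^esub> v)"
    proof -
      have "K +>\<^bsub>M\<^esub> (r \<odot>\<^bsub>M\<^esub> y) = C (r \<odot>\<^bsub>N\<^esub> v)" if "y \<in> C v" for y
        using that coset[OF M.smult_closed[OF r]] hD(3)[OF r] by (auto simp: C_def)
      moreover have "C v \<noteq> {}" using x by (auto simp: C_def)
      ultimately show ?thesis by auto
    qed
    then show "C (r \<odot>\<^bsub>N\<^esub> v) = r \<odot>\<^bsub>quotient_module M K\<^esub> C v" by (simp add: quotient_module_def)
  qed
  moreover have "inj_on C (carrier N)"
  proof (rule inj_onI)
    fix v w assume *: "v \<in> carrier N" "w \<in> carrier N" "C v = C w"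
    obtain x where "x \<in> carrier M" "h x = v" using C_in[OF *(1)] by blast
    then have "x \<in> C w" using *(3) by (auto simp: C_def)
    then show "v = w" using \<open>h x = v\<close> by (simp add: C_def)
  qed
  moreover have "C \<zero>\<^bsub>N\<^esub> = \<zero>\<^bsub>quotient_module M K\<^esub>" by (simp add: C_def K quotient_module_def)
  ultimately show ?thesis using carr by (auto simp: bij_betw_def)
qed

lemma (in k_algebra) left_hom_injI:
  assumes M: "left_module A M" and N: "left_module A N" and h: "h \<in> left_hom A M N"
    and ker: "a_kernel M N h \<subseteq> {\<zero>\<^bsub>M\<^esub>}"
  shows "inj_on h (carrier M)"
proof (rule inj_onI)
  interpret M: algebra_module A M using M by (rule algebra_moduleI)
  interpret N: algebra_module A N using N by (rule algebra_moduleI)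
  fix x y assume xy: "x \<in> carrier M" "y \<in> carrier M" "h x = h y"
  have "h (x \<ominus>\<^bsub>M\<^esub> y) = \<zero>\<^bsub>N\<^esub>"
    using left_hom_diff[OF M N h xy(1,2)] xy left_homD(1)[OF h] by (simp add: a_minus_def N.M.r_neg)
  then have "x \<ominus>\<^bsub>M\<^esub> y \<in> a_kernel M N h" using xy by (simp add: a_kernel_iff)
  then have "x \<oplus>\<^bsub>M\<^esub> \<ominus>\<^bsub>M\<^esub> y = \<zero>\<^bsub>M\<^esub>" using ker by (auto simp: a_minus_def)
  then have "\<ominus>\<^bsub>M\<^esub> (\<ominus>\<^bsub>M\<^esub> y) = x" using xy by (intro M.M.minus_equality) auto
  then show "x = y" using M.M.minus_minus[OF xy(2)] by simp
qed

text \<open>Only the augmentation changes, and its kernel stays the same since \<open>t\<close> is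
  injective and preserves zero.\<close>

lemma projective_resolution_iso:
  assumes res: "projective_resolution A M P \<epsilon> d"
    and t: "t \<in> left_hom A M N" "bij_betw t (carrier M) (carrier N)" "t \<zero>\<^bsub>M\<^esub> = \<zero>\<^bsub>N\<^esub>" "\<zero>\<^bsub>M\<^esub> \<in> carrier M"
  shows "projective_resolution A N P (\<lambda>x. t (\<epsilon> x)) d"
proof -
  have e: "\<epsilon> \<in> left_hom A (P 0) M" using res by (simp add: projective_resolution_def)
  have "t (\<epsilon> x) = \<zero>\<^bsub>N\<^esub> \<longleftrightarrow> \<epsilon> x = \<zero>\<^bsub>M\<^esub>" if "x \<in> carrier (P 0)" for x
    using t(2-4) left_homD(1)[OF e that] unfolding bij_betw_def by (metis inj_onD)
  then have "a_kernel (P 0) N (\<lambda>x. t (\<epsilon> x)) = a_kernel (P 0) M \<epsilon>"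
    unfolding set_eq_iff a_kernel_iff by blast
  moreover have "(\<lambda>x. t (\<epsilon> x)) ` carrier (P 0) = t ` \<epsilon> ` carrier (P 0)" by auto
  ultimately show ?thesis
    using res left_hom_comp[OF e t(1)] t(2) unfolding projective_resolution_def bij_betw_def by simp
qed

section \<open>Indecomposable projectives, their radicals and socles\<close>

context band_algebra begin

definition proj_mod :: "int \<Rightarrow> ('a, 'a) module" where
  "proj_mod a = (regular_module A)\<lparr>carrier := {x \<otimes> path_elem a a | x. x \<in> carrier A}\<rparr>"

definition simple_mod :: "int \<Rightarrow> ('a, 'a set) module" where
  "simple_mod a = quotient_module (proj_mod a) (rad A (proj_mod a))"

lemma proj_mod_simps [simp]: "\<zero>\<^bsub>proj_mod a\<^esub> = \<zero>" "x \<oplus>\<^bsub>proj_mod a\<^esub> y = x \<oplus> y" "r \<odot>\<^bsub>proj_mod a\<^esub> x = r \<otimes> x"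
  by (simp_all add: proj_mod_def regular_module_def)

lemma coeff_mult_idem:
  assumes "x \<in> carrier A"
  shows "coeff (x \<otimes> path_elem a a) w z = (if \<exists>k. w = a + k * int n then coeff x w z else 0)"
proof (cases "w \<le> z \<and> z < f w")
  case True
  have "coeff (x \<otimes> path_elem a a) w z = (\<Sum>v\<in>{w..z}. coeff x v z * coeff (path_elem a a) w v)"
    using coeff_mult assms path_elem(1) True by simp
  also have "\<dots> = (\<Sum>v\<in>{w..z}. if v = w then (if \<exists>k. w = a + k * int n then coeff x w z else 0) else 0)"
    using f_gt[of a] by (intro sum.cong refl) (auto simp: path_elem)
  finally show ?thesis using True by (simp add: sum.delta)
next
  case False
  then show ?thesis using coeff_outside assms path_elem(1) by simp
qed

lemma proj_mod_iff: "x \<in> carrier (proj_mod a) \<longleftrightarrow> x \<in> carrier A \<and> (\<forall>w z. (\<nexists>k. w = a + k * int n) \<longrightarrow> coeff x w z = 0)"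
proof
  assume "x \<in> carrier (proj_mod a)"
  then obtain y where "y \<in> carrier A" "x = y \<otimes> path_elem a a" by (auto simp: proj_mod_def)
  then show "x \<in> carrier A \<and> (\<forall>w z. (\<nexists>k. w = a + k * int n) \<longrightarrow> coeff x w z = 0)"
    using path_elem(1) by (auto simp: coeff_mult_idem)
next
  assume x: "x \<in> carrier A \<and> (\<forall>w z. (\<nexists>k. w = a + k * int n) \<longrightarrow> coeff x w z = 0)"
  then have "x = x \<otimes> path_elem a a"
    using path_elem(1) by (intro coeff_inj) (auto intro!: ext simp: coeff_mult_idem)
  then show "x \<in> carrier (proj_mod a)" using x by (auto simp: proj_mod_def)
qed

lemma proj_mod_eqI:
  assumes "x \<in> carrier (proj_mod a)" "y \<in> carrier (proj_mod a)" "\<And>z. a \<le> z \<Longrightarrow> z < f a \<Longrightarrow> coeff x a z = coeff y a z"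
  shows "x = y"
proof (rule coeff_inj)
  note x = assms(1)[unfolded proj_mod_iff] and y = assms(2)[unfolded proj_mod_iff]
  show "x \<in> carrier A" "y \<in> carrier A" using x y by auto
  have row: "coeff x a z = coeff y a z" for z
    using assms(3)[of z] coeff_outside[of x a z] coeff_outside[of y a z] x y by (cases "a \<le> z \<and> z < f a") auto
  show "coeff x = coeff y"
  proof (intro ext)
    fix w z
    show "coeff x w z = coeff y w z"
    proof (cases "\<exists>k. w = a + k * int n")
      case True
      then obtain k where "w = a + k * int n" by blast
      then show ?thesis using coeff_shift[of x a k "z - k * int n"] coeff_shift[of y a k "z - k * int n"] x y row by simp
    qed (use x y in auto)
  qed
qed

lemma proj_mod_module: "left_module A (proj_mod a)"
proof -
  interpret R: algebra_module A "regular_module A" using regular_left_module by (rule algebra_moduleI)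
  have "submodule {x \<otimes> path_elem a a | x. x \<in> carrier A} A (regular_module A)"
  proof (rule R.submoduleI)
    show "\<zero>\<^bsub>regular_module A\<^esub> \<in> {x \<otimes> path_elem a a | x. x \<in> carrier A}"
      using l_null[OF path_elem(1), of a a] by (auto simp: regular_module_def intro!: exI[of _ \<zero>])
  next
    fix x y assume "x \<in> {x \<otimes> path_elem a a | x. x \<in> carrier A}" "y \<in> {x \<otimes> path_elem a a | x. x \<in> carrier A}"
    then show "x \<oplus>\<^bsub>regular_module A\<^esub> y \<in> {x \<otimes> path_elem a a | x. x \<in> carrier A}"
      using path_elem(1) by (auto simp: regular_module_def l_distr[symmetric])
  next
    fix r x assume "r \<in> carrier A" "x \<in> {x \<otimes> path_elem a a | x. x \<in> carrier A}"
    then show "r \<odot>\<^bsub>regular_module A\<^esub> x \<in> {x \<otimes> path_elem a a | x. x \<in> carrier A}"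
      using path_elem(1) by (auto simp: regular_module_def m_assoc[symmetric])
  qed (use path_elem(1) in \<open>auto simp: regular_module_def\<close>)
  then show ?thesis unfolding proj_mod_def using R.submodule_module by simp
qed

lemma proj_mod_sub: "x \<in> carrier (proj_mod a) \<Longrightarrow> x \<in> carrier A" by (simp add: proj_mod_iff)

lemma path_elem_proj_mod: "path_elem a b \<in> carrier (proj_mod a)" using path_elem by (auto simp: proj_mod_iff)

text \<open>A translate of the path that ends before \<open>b\<close> also starts before
  \<open>z\<close>, where \<open>x\<close> has no coordinates. So coordinate \<open>z\<close> is
  moved to \<open>b\<close>, and nothing else arrives up to \<open>b\<close>.\<close>

lemma coeff_path_elem_mult:
  assumes x: "x \<in> carrier A" and z: "a \<le> z" "z \<le> b" "b < f z" "b < f a"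
    and low: "\<And>v. v < z \<Longrightarrow> coeff x a v = 0"
  shows "z' \<le> b \<Longrightarrow> coeff (path_elem z b \<otimes> x) a z' = (if z' = b then coeff x a z else 0)"
proof -
  assume z': "z' \<le> b"
  show ?thesis
  proof (cases "a \<le> z' \<and> z' < f a")
    case True
    have "coeff (path_elem z b \<otimes> x) a z' = (\<Sum>v\<in>{a..z'}. coeff (path_elem z b) v z' * coeff x a v)"
      using coeff_mult[OF path_elem(1) x] True by simp
    also have "\<dots> = (\<Sum>v\<in>{a..z'}. if v = z then (if z' = b then coeff x a z else 0) else 0)"
    proof (intro sum.cong refl)
      fix v assume "v \<in> {a..z'}"
      show "coeff (path_elem z b) v z' * coeff x a v = (if v = z then (if z' = b then coeff x a z else 0) else 0)"
      proof (cases "\<exists>k. v = z + k * int n \<and> z' = b + k * int n")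
        case True
        then obtain k where k: "v = z + k * int n" "z' = b + k * int n" by blast
        then have "k * int n \<le> 0" using z' by simp
        show ?thesis
        proof (cases "k * int n = 0")
          case True
          then have "v = z" "z' = b" using k by simp_all
          then show ?thesis using z coeff_path_elem_col[of z b z] by simp
        next
          case False
          then have "v < z" using \<open>k * int n \<le> 0\<close> k by linarith
          then show ?thesis using low by simp
        qed
      next
        case False
        then have "coeff (path_elem z b) v z' = 0" by (auto simp: path_elem)
        moreover have "\<not> (v = z \<and> z' = b)" using False by (metis add.right_neutral mult_zero_left)
        ultimately show ?thesis by auto
      qed
    qed
    also have "\<dots> = (if z' = b then coeff x a z else 0)" using True z by (auto simp: sum.delta)
    finally show ?thesis .
  next
    case False
    then show ?thesis using coeff_outside[of "path_elem z b \<otimes> x" a z'] path_elem(1) x z z' by auto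
  qed
qed

text \<open>Elimination from the top: a multiple of \<open>x\<close> by a path removes the first
  coordinate of \<open>y\<close>, and the number \<open>m\<close> of positions left before
  \<open>f a\<close> decreases.\<close>

lemma proj_mod_generated:
  assumes N: "submodule N A (proj_mod a)" and x: "x \<in> N" "coeff x a a \<noteq> 0"
  shows "carrier (proj_mod a) \<subseteq> N"
proof -
  interpret P: algebra_module A "proj_mod a" using proj_mod_module by (rule algebra_moduleI)
  note ND = P.submoduleD[OF N]
  have xP: "x \<in> carrier (proj_mod a)" using x ND(1) by blast
  have *: "y \<in> N" if "y \<in> carrier (proj_mod a)" "\<And>z. z < f a - int m \<Longrightarrow> coeff y a z = 0" for y m using that
  proof (induction m arbitrary: y)
    case 0
    have "y = \<zero>" using 0 P.M.zero_closed by (intro proj_mod_eqI[of _ a]) (auto simp: coeff_zero)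
    then show ?case using ND(2) by simp
  next
    case (Suc m)
    define z where "z = f a - int (Suc m)"
    show ?case
    proof (cases "a \<le> z")
      case False
      have "coeff y a w = 0" if "w < f a - int m" for w
        using that False coeff_outside[of y a w] proj_mod_sub[OF Suc.prems(1)] z_def by auto
      then show ?thesis using Suc.IH Suc.prems(1) by blast
    next
      case True
      have zf: "z < f a" by (simp add: z_def)
      \<comment> \<open>The factor that cancels coordinate \<open>z\<close> of \<open>y\<close>
        against the top coordinate of \<open>x\<close> once this is moved to
        \<open>z\<close>.\<close>
      define c where "c = - (coeff y a z / coeff x a a)"
      define t where "t = (c \<odot> path_elem a z) \<otimes> x"
      have tN: "t \<in> N" using ND(4)[OF scale_closed[OF path_elem(1)] x(1)] by (simp add: t_def)
      then have tP: "t \<in> carrier (proj_mod a)" using ND(1) by blast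
      have coeff_t: "coeff t a w = (if w = z then c * coeff x a a else 0)" if "w \<le> z" for w
        unfolding t_def using that coeff_path_elem_mult[OF proj_mod_sub[OF xP], of a a z w] True zf
          coeff_outside[OF proj_mod_sub[OF xP]] proj_mod_sub[OF xP] path_elem(1)
        by (simp add: scale_mult_left coeff_scale)
      have "y \<oplus> t \<in> carrier (proj_mod a)" using P.M.a_closed Suc.prems(1) tP by simp
      moreover have "coeff (y \<oplus> t) a w = 0" if "w < f a - int m" for w
        using that coeff_t[of w] coeff_add[OF proj_mod_sub[OF Suc.prems(1)] proj_mod_sub[OF tP]] Suc.prems(2)[of w] x(2)
        by (cases "w = z") (auto simp: z_def c_def)
      ultimately have "y \<oplus> t \<in> N" using Suc.IH by blast
      moreover have "\<ominus>\<^bsub>proj_mod a\<^esub> t \<in> N"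
        using ND(4)[OF _ tN, of "\<ominus> \<one>"] P.smult_minus_1[OF tP] by simp
      ultimately have "(y \<oplus> t) \<oplus>\<^bsub>proj_mod a\<^esub> \<ominus>\<^bsub>proj_mod a\<^esub> t \<in> N" using ND(3) by blast
      moreover have "(y \<oplus> t) \<oplus>\<^bsub>proj_mod a\<^esub> \<ominus>\<^bsub>proj_mod a\<^esub> t = y"
        using P.M.a_assoc[OF Suc.prems(1) tP, of "\<ominus>\<^bsub>proj_mod a\<^esub> t"] P.M.r_neg[OF tP] P.M.a_inv_closed[OF tP]
          P.M.r_zero[OF Suc.prems(1)] by simp
      ultimately show ?thesis by simp
    qed
  qed
  show ?thesis
  proof
    fix y assume y: "y \<in> carrier (proj_mod a)"
    then show "y \<in> N"
      using *[of y "nat (f a - a)"] coeff_outside[of y a] proj_mod_sub[OF y] f_gt[of a] by auto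
  qed
qed

lemma coeff_smult_lowest:
  assumes r: "r \<in> carrier A" and x: "x \<in> carrier A" and b: "a \<le> b" "b < f a"
    and low: "\<And>v. v < b \<Longrightarrow> coeff x a v = 0"
  shows "z \<le> b \<Longrightarrow> coeff (r \<otimes> x) a z = (if z = b then coeff r b b * coeff x a b else 0)"
proof -
  assume z: "z \<le> b"
  show ?thesis
  proof (cases "a \<le> z")
    case True
    have "coeff (r \<otimes> x) a z = (\<Sum>v\<in>{a..z}. coeff r v z * coeff x a v)" using coeff_mult[OF r x] True z b by simp
    also have "\<dots> = (\<Sum>v\<in>{a..z}. if v = b then coeff r b b * coeff x a b else 0)"
      using low z by (intro sum.cong refl) auto
    finally show ?thesis using True z b by (auto simp: sum.delta)
  next
    case False
    then show ?thesis using coeff_outside[of "r \<otimes> x" a z] r x b by auto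
  qed
qed

text \<open>An element with nonzero top coordinate generates, so a submodule not contained in the
  right-hand side is everything; hence there is only one maximal submodule.\<close>

lemma rad_proj_mod: "rad A (proj_mod a) = {x \<in> carrier (proj_mod a). coeff x a a = 0}" (is "_ = ?R")
proof -
  interpret P: algebra_module A "proj_mod a" using proj_mod_module by (rule algebra_moduleI)
  have R: "submodule ?R A (proj_mod a)"
  proof (rule P.submoduleI)
    fix r x assume r: "r \<in> carrier A" and x: "x \<in> ?R"
    have "coeff (r \<otimes> x) a a = coeff r a a * coeff x a a"
      using coeff_smult_lowest[OF r proj_mod_sub, of x a a a a] x f_gt[of a] coeff_outside[OF proj_mod_sub, of x a a] by auto
    then show "r \<odot>\<^bsub>proj_mod a\<^esub> x \<in> ?R" using P.smult_closed[OF r] x by simp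
  qed (use P.M.zero_closed P.M.a_closed proj_mod_sub in \<open>auto simp: coeff_zero coeff_add\<close>)
  have "path_elem a a \<notin> ?R" using f_gt[of a] coeff_path_elem_col[of a a a] by simp
  then have proper: "?R \<noteq> carrier (proj_mod a)" using path_elem_proj_mod by blast
  have big: "N = carrier (proj_mod a)" if "submodule N A (proj_mod a)" "\<not> N \<subseteq> ?R" for N
    using that proj_mod_generated[OF that(1)] P.submoduleD(1)[OF that(1)] by blast
  have "maximal_submodule A (proj_mod a) ?R"
    unfolding maximal_submodule_def using R proper big by blast
  moreover have "N = ?R" if "maximal_submodule A (proj_mod a) N" for N
    using that R proper big unfolding maximal_submodule_def by blast
  ultimately have "{N. maximal_submodule A (proj_mod a) N} = {?R}" by blast
  then show ?thesis unfolding rad_def by auto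
qed

text \<open>Every nonzero submodule contains the right-hand side: a path pushes the first nonzero
  coordinate of one of its elements to \<open>f a - 1\<close> and leaves no other. Hence there is
  only one simple submodule.\<close>

lemma soc_proj_mod:
  "carrier (soc A (proj_mod a)) = {x \<in> carrier (proj_mod a). \<forall>z. z \<noteq> f a - 1 \<longrightarrow> coeff x a z = 0}" (is "_ = ?T")
proof -
  interpret P: algebra_module A "proj_mod a" using proj_mod_module by (rule algebra_moduleI)
  let ?e = "f a - 1"
  have e: "a \<le> ?e" "?e < f a" using f_gt[of a] by auto
  have T: "submodule ?T A (proj_mod a)"
  proof (rule P.submoduleI)
    fix r x assume r: "r \<in> carrier A" and x: "x \<in> ?T"
    have "coeff (r \<otimes> x) a z = 0" if "z \<noteq> ?e" for z
    proof (cases "z \<le> ?e")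
      case True
      then show ?thesis using coeff_smult_lowest[OF r proj_mod_sub e, of x a z] x that by auto
    next
      case False
      then show ?thesis using coeff_outside[of "r \<otimes> x" a z] r proj_mod_sub x by auto
    qed
    then show "r \<odot>\<^bsub>proj_mod a\<^esub> x \<in> ?T" using P.smult_closed[OF r] x by simp
  qed (use P.M.zero_closed P.M.a_closed proj_mod_sub in \<open>auto simp: coeff_zero coeff_add\<close>)
  have elT: "path_elem a ?e \<in> ?T" using path_elem_proj_mod e coeff_path_elem_row[OF e] by auto
  have "coeff (path_elem a ?e) a ?e \<noteq> 0" using coeff_path_elem_row[OF e] by simp
  then have "path_elem a ?e \<noteq> \<zero>" using coeff_zero by metis
  then have T0: "?T \<noteq> {\<zero>\<^bsub>proj_mod a\<^esub>}" using elT by auto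
  have sub: "?T \<subseteq> N" if N: "submodule N A (proj_mod a)" "N \<noteq> {\<zero>\<^bsub>proj_mod a\<^esub>}" for N
  proof
    note ND = P.submoduleD[OF N(1)]
    obtain x where x: "x \<in> N" "x \<noteq> \<zero>" using N(2) ND(2) by auto
    have xP: "x \<in> carrier (proj_mod a)" using x ND(1) by blast
    have ex: "\<exists>k::nat. coeff x a (a + int k) \<noteq> 0"
    proof (rule ccontr)
      assume "\<not> ?thesis"
      then have "coeff x a z = 0" if "a \<le> z" for z using that by (metis zle_iff_zadd)
      then have "x = \<zero>" using xP P.M.zero_closed by (intro proj_mod_eqI[of _ a]) (auto simp: coeff_zero)
      then show False using x by simp
    qed
    \<comment> \<open>The first nonzero coordinate, counted from \<open>a\<close> so that
      \<open>LEAST\<close> ranges over natural numbers.\<close>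
    define z where "z = a + int (LEAST k. coeff x a (a + int k) \<noteq> 0)"
    have z0: "coeff x a z \<noteq> 0" unfolding z_def using ex by (rule LeastI_ex)
    have low: "coeff x a v = 0" if "v < z" for v
    proof (cases "a \<le> v")
      case True
      then have "nat (v - a) < (LEAST k. coeff x a (a + int k) \<noteq> 0)" using that unfolding z_def by simp
      then have "\<not> coeff x a (a + int (nat (v - a))) \<noteq> 0" by (rule not_less_Least)
      then show ?thesis using True by simp
    qed (use coeff_outside[of x a v] proj_mod_sub[OF xP] in auto)
    have za: "a \<le> z" "z < f a" using z0 coeff_outside[of x a z] proj_mod_sub[OF xP] by auto
    have zf: "?e < f z" using f_mono[OF za(1)] by simp
    have coeff_t: "coeff (path_elem z ?e \<otimes> x) a z' = (if z' = ?e then coeff x a z else 0)" for z'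
      using coeff_path_elem_mult[OF proj_mod_sub[OF xP] za(1) _ zf e(2) low, of z'] za
        coeff_outside[of "path_elem z ?e \<otimes> x" a z'] proj_mod_sub[OF xP] path_elem(1) by (cases "z' \<le> ?e") auto
    fix y assume y: "y \<in> ?T"
    have t: "(coeff y a ?e / coeff x a z) \<odot> path_elem z ?e \<in> carrier A" using scale_closed path_elem(1) by blast
    have "y = ((coeff y a ?e / coeff x a z) \<odot> path_elem z ?e) \<otimes> x"
    proof (rule proj_mod_eqI[of _ a])
      show "((coeff y a ?e / coeff x a z) \<odot> path_elem z ?e) \<otimes> x \<in> carrier (proj_mod a)"
        using P.smult_closed[OF t xP] by simp
      show "coeff y a z' = coeff (((coeff y a ?e / coeff x a z) \<odot> path_elem z ?e) \<otimes> x) a z'" for z'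
        using y z0 coeff_t[of z'] proj_mod_sub[OF xP] path_elem(1) by (auto simp: scale_mult_left coeff_scale)
    qed (use y in auto)
    then show "y \<in> N" using ND(4)[OF t x(1)] by simp
  qed
  have "simple_submodule A (proj_mod a) ?T"
    unfolding simple_submodule_def
  proof (intro conjI allI impI)
    show "N = {\<zero>\<^bsub>proj_mod a\<^esub>} \<or> N = ?T" if "submodule N A (proj_mod a) \<and> N \<subseteq> ?T" for N
      using sub[of N] that by blast
  qed (use T T0 in auto)
  moreover have "S = ?T" if "simple_submodule A (proj_mod a) S" for S
  proof -
    have "?T \<subseteq> S" using that sub unfolding simple_submodule_def by blast
    then show ?thesis using that T T0 unfolding simple_submodule_def by blast
  qed
  ultimately have "{N. submodule N A (proj_mod a) \<and> (\<forall>S. simple_submodule A (proj_mod a) S \<longrightarrow> S \<subseteq> N)} =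
    {N. submodule N A (proj_mod a) \<and> ?T \<subseteq> N}" by blast
  then have "carrier (soc A (proj_mod a)) = \<Inter>{N. submodule N A (proj_mod a) \<and> ?T \<subseteq> N}"
    unfolding soc_def by simp
  also have "\<dots> = ?T" using T by blast
  finally show ?thesis .
qed

section \<open>Simple modules as one-point intervals\<close>

definition coeff_vec :: "int \<Rightarrow> int \<Rightarrow> 'a \<Rightarrow> nat \<Rightarrow> 'k" where
  "coeff_vec a b x = (\<lambda>m. coeff x a b * unit_vec 0 b m)"

lemma coeff_vec_uni: "coeff_vec a b x \<in> carrier (uni b (b + 1))" by (rule uni_carrierI) (auto simp: coeff_vec_def)

lemma uni1_smult: "r \<odot>\<^bsub>uni b (b + 1)\<^esub> (\<lambda>m. c * unit_vec 0 b m) = (\<lambda>m. (coeff r b b * c) * unit_vec 0 b m)"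
  by (rule vec_eqI) (auto simp: uni_def intro!: sum.neutral)

lemma uni1_cases: assumes "v \<in> carrier (uni b (b + 1))" shows "v = (\<lambda>m. crd v b * unit_vec 0 b m)"
  using uni_carrierD[OF assms] by (intro vec_eqI) fastforce

lemma uni1_module: "left_module A (uni b (b + 1))" using uni_module f_gt by (simp add: zless_imp_add1_zle)

lemma simple_mod_iso:
  "\<exists>t\<in>left_hom A (uni a (a + 1)) (simple_mod a). bij_betw t (carrier (uni a (a + 1))) (carrier (simple_mod a)) \<and>
    t \<zero>\<^bsub>uni a (a + 1)\<^esub> = \<zero>\<^bsub>simple_mod a\<^esub>"
  unfolding simple_mod_def
proof (rule quotient_iso)
  show "left_module A (proj_mod a)" by (rule proj_mod_module)
  show "left_module A (uni a (a + 1))" by (rule uni1_module)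
  show hom: "coeff_vec a a \<in> left_hom A (proj_mod a) (uni a (a + 1))"
  proof (rule left_homI)
    fix x assume x: "x \<in> carrier (proj_mod a)"
    show "coeff_vec a a x \<in> carrier (uni a (a + 1))" by (rule coeff_vec_uni)
    {
      fix y assume "y \<in> carrier (proj_mod a)"
      then show "coeff_vec a a (x \<oplus>\<^bsub>proj_mod a\<^esub> y) = coeff_vec a a x \<oplus>\<^bsub>uni a (a + 1)\<^esub> coeff_vec a a y"
        using x by (simp add: coeff_vec_def uni_def coeff_add proj_mod_sub distrib_right)
    }
    fix r assume r: "r \<in> carrier A"
    have "coeff (r \<otimes> x) a a = coeff r a a * coeff x a a"
      using coeff_smult_lowest[OF r proj_mod_sub[OF x], of a a a] f_gt[of a] coeff_outside[OF proj_mod_sub[OF x]] by simp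
    then show "coeff_vec a a (r \<odot>\<^bsub>proj_mod a\<^esub> x) = r \<odot>\<^bsub>uni a (a + 1)\<^esub> coeff_vec a a x"
      unfolding coeff_vec_def uni1_smult by simp
  qed
  show "coeff_vec a a ` carrier (proj_mod a) = carrier (uni a (a + 1))"
  proof (intro equalityI subsetI)
    fix v assume v: "v \<in> carrier (uni a (a + 1))"
    interpret P: algebra_module A "proj_mod a" using proj_mod_module by (rule algebra_moduleI)
    have "crd v a \<odot> path_elem a a \<in> carrier (proj_mod a)"
      using P.smult_closed[OF P.scalar_closed path_elem_proj_mod[of a a], of "crd v a"] P.scalar_mult[OF path_elem(1)] by simp
    moreover have "coeff_vec a a (crd v a \<odot> path_elem a a) = v"
      using uni1_cases[OF v] coeff_path_elem_col[of a a a] f_gt[of a] path_elem(1) by (simp add: coeff_vec_def coeff_scale)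
    ultimately show "v \<in> coeff_vec a a ` carrier (proj_mod a)" by (metis imageI)
  qed (use coeff_vec_uni in auto)
  have "coeff_vec a a x = (\<lambda>_. 0) \<longleftrightarrow> coeff x a a = 0" for x
  proof
    assume "coeff_vec a a x = (\<lambda>_. 0)"
    then have "crd (coeff_vec a a x) a = 0" by simp
    then show "coeff x a a = 0" by (simp add: coeff_vec_def)
  qed (simp add: coeff_vec_def)
  then show "rad A (proj_mod a) = {x \<in> carrier (proj_mod a). coeff_vec a a x = \<zero>\<^bsub>uni a (a + 1)\<^esub>}" by (simp add: rad_proj_mod)
qed

lemma soc_hom:
  "coeff_vec a (f a - 1) \<in> left_hom A (soc A (proj_mod a)) (uni (f a - 1) (f a - 1 + 1))"
  "bij_betw (coeff_vec a (f a - 1)) (carrier (soc A (proj_mod a))) (carrier (uni (f a - 1) (f a - 1 + 1)))"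
proof -
  let ?e = "f a - 1"
  have e: "a \<le> ?e" "?e < f a" using f_gt[of a] by auto
  have S: "x \<oplus>\<^bsub>soc A (proj_mod a)\<^esub> y = x \<oplus> y" "r \<odot>\<^bsub>soc A (proj_mod a)\<^esub> x = r \<otimes> x" for x y r
    by (simp_all add: soc_def proj_mod_def regular_module_def)
  show "coeff_vec a ?e \<in> left_hom A (soc A (proj_mod a)) (uni ?e (?e + 1))"
  proof (rule left_homI)
    fix x assume "x \<in> carrier (soc A (proj_mod a))"
    then have x: "x \<in> carrier (proj_mod a)" "\<And>z. z \<noteq> ?e \<Longrightarrow> coeff x a z = 0" unfolding soc_proj_mod by auto
    show "coeff_vec a ?e x \<in> carrier (uni ?e (?e + 1))" by (rule coeff_vec_uni)
    {
      fix y assume "y \<in> carrier (soc A (proj_mod a))"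
      then have "y \<in> carrier (proj_mod a)" unfolding soc_proj_mod by auto
      then show "coeff_vec a ?e (x \<oplus>\<^bsub>soc A (proj_mod a)\<^esub> y) = coeff_vec a ?e x \<oplus>\<^bsub>uni ?e (?e + 1)\<^esub> coeff_vec a ?e y"
        using x unfolding S by (simp add: coeff_vec_def uni_def coeff_add proj_mod_sub distrib_right)
    }
    fix r assume r: "r \<in> carrier A"
    have "coeff (r \<otimes> x) a ?e = coeff r ?e ?e * coeff x a ?e"
      using coeff_smult_lowest[OF r proj_mod_sub[OF x(1)] e, of ?e] x(2) by simp
    then show "coeff_vec a ?e (r \<odot>\<^bsub>soc A (proj_mod a)\<^esub> x) = r \<odot>\<^bsub>uni ?e (?e + 1)\<^esub> coeff_vec a ?e x"
      unfolding S coeff_vec_def uni1_smult by simp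
  qed
  show "bij_betw (coeff_vec a ?e) (carrier (soc A (proj_mod a))) (carrier (uni ?e (?e + 1)))"
    unfolding bij_betw_def
  proof
    show "inj_on (coeff_vec a ?e) (carrier (soc A (proj_mod a)))"
    proof (rule inj_onI)
      fix x y assume xy: "x \<in> carrier (soc A (proj_mod a))" "y \<in> carrier (soc A (proj_mod a))" "coeff_vec a ?e x = coeff_vec a ?e y"
      then have "crd (coeff_vec a ?e x) ?e = crd (coeff_vec a ?e y) ?e" by simp
      then have "coeff x a ?e = coeff y a ?e" by (simp add: coeff_vec_def)
      then have "coeff x a z = coeff y a z" for z using xy(1,2) unfolding soc_proj_mod by (cases "z = ?e") auto
      then show "x = y" using xy(1,2) unfolding soc_proj_mod by (intro proj_mod_eqI[of x a y]) auto
    qed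
    show "coeff_vec a ?e ` carrier (soc A (proj_mod a)) = carrier (uni ?e (?e + 1))"
    proof (intro equalityI subsetI)
      fix v assume v: "v \<in> carrier (uni ?e (?e + 1))"
      interpret P: algebra_module A "proj_mod a" using proj_mod_module by (rule algebra_moduleI)
      have "crd v ?e \<odot> path_elem a ?e \<in> carrier (proj_mod a)"
        using P.smult_closed[OF P.scalar_closed path_elem_proj_mod[of a ?e], of "crd v ?e"] P.scalar_mult[OF path_elem(1)] by simp
      then have "crd v ?e \<odot> path_elem a ?e \<in> carrier (soc A (proj_mod a))"
        unfolding soc_proj_mod using coeff_path_elem_row[OF e] path_elem(1) by (simp add: coeff_scale)
      moreover have "coeff_vec a ?e (crd v ?e \<odot> path_elem a ?e) = v"
        using uni1_cases[OF v] coeff_path_elem_row[OF e] path_elem(1) by (simp add: coeff_vec_def coeff_scale)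
      ultimately show "v \<in> coeff_vec a ?e ` carrier (soc A (proj_mod a))" by (metis imageI)
    next
      fix v assume "v \<in> coeff_vec a ?e ` carrier (soc A (proj_mod a))"
      then show "v \<in> carrier (uni ?e (?e + 1))" using coeff_vec_uni by blast
    qed
  qed
qed

text \<open>An element acts on a one-point interval by its diagonal entry, which is
  periodic.\<close>

lemma uni1_shift:
  "\<exists>t\<in>left_hom A (uni b (b + 1)) (uni (b + k * int n) (b + k * int n + 1)).
     bij_betw t (carrier (uni b (b + 1))) (carrier (uni (b + k * int n) (b + k * int n + 1)))"
proof -
  let ?b = "b + k * int n"
  define t where "t v = (\<lambda>m. crd v b * unit_vec 0 ?b m)" for v
  have tJ: "t v \<in> carrier (uni ?b (?b + 1))" for v by (rule uni_carrierI) (auto simp: t_def)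
  have "t \<in> left_hom A (uni b (b + 1)) (uni ?b (?b + 1))"
  proof (rule left_homI)
    fix r v assume r: "r \<in> carrier A" and v: "v \<in> carrier (uni b (b + 1))"
    have "r \<odot>\<^bsub>uni b (b + 1)\<^esub> v = (\<lambda>m. (coeff r b b * crd v b) * unit_vec 0 b m)"
      by (subst uni1_cases[OF v]) (rule uni1_smult)
    moreover have "r \<odot>\<^bsub>uni ?b (?b + 1)\<^esub> t v = (\<lambda>m. (coeff r ?b ?b * crd v b) * unit_vec 0 ?b m)"
      unfolding t_def by (rule uni1_smult)
    ultimately show "t (r \<odot>\<^bsub>uni b (b + 1)\<^esub> v) = r \<odot>\<^bsub>uni ?b (?b + 1)\<^esub> t v"
      using coeff_shift[OF r, of b k b] by (simp add: t_def)
  next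
    fix v w
    show "t (v \<oplus>\<^bsub>uni b (b + 1)\<^esub> w) = t v \<oplus>\<^bsub>uni ?b (?b + 1)\<^esub> t w"
      by (simp add: t_def uni_def distrib_right)
  qed (rule tJ)
  moreover have "bij_betw t (carrier (uni b (b + 1))) (carrier (uni ?b (?b + 1)))"
    unfolding bij_betw_def
  proof
    show "inj_on t (carrier (uni b (b + 1)))"
    proof (rule inj_onI)
      fix v w assume vw: "v \<in> carrier (uni b (b + 1))" "w \<in> carrier (uni b (b + 1))" "t v = t w"
      then have "crd (t v) ?b = crd (t w) ?b" by simp
      then have "crd v b = crd w b" by (simp add: t_def)
      then show "v = w" using uni1_cases vw by metis
    qed
    show "t ` carrier (uni b (b + 1)) = carrier (uni ?b (?b + 1))"
    proof (intro equalityI subsetI)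
      fix v assume v: "v \<in> carrier (uni ?b (?b + 1))"
      have "(\<lambda>m. crd v ?b * unit_vec 0 b m) \<in> carrier (uni b (b + 1))" by (rule uni_carrierI) auto
      moreover have "t (\<lambda>m. crd v ?b * unit_vec 0 b m) = v" using uni1_cases[OF v] by (simp add: t_def)
      ultimately show "v \<in> t ` carrier (uni b (b + 1))" by (metis imageI)
    qed (use tJ in auto)
  qed
  ultimately show ?thesis by blast
qed

lemma left_iso_trans:
  assumes "h \<in> left_hom A M N" "bij_betw h (carrier M) (carrier N)"
    and "k \<in> left_hom A N L" "bij_betw k (carrier N) (carrier L)"
  shows "(\<lambda>x. k (h x)) \<in> left_hom A M L" "bij_betw (\<lambda>x. k (h x)) (carrier M) (carrier L)"
  using left_hom_comp[OF assms(1,3)] bij_betw_trans[OF assms(2,4)] by (simp_all add: comp_def)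

text \<open>For the converse, the idempotent at \<open>f a - 1\<close> fixes the generator of the
  socle. On the simple module at \<open>b\<close> it acts by its diagonal entry at \<open>b\<close>,
  which vanishes unless \<open>b\<close> is congruent to \<open>f a - 1\<close>.\<close>

lemma soc_iso_iff: "left_iso A (soc A (proj_mod a)) (simple_mod b) \<longleftrightarrow> (\<exists>k. b = f a - 1 + k * int n)"
proof
  let ?e = "f a - 1"
  obtain t where t: "t \<in> left_hom A (uni b (b + 1)) (simple_mod b)" "bij_betw t (carrier (uni b (b + 1))) (carrier (simple_mod b))"
    using simple_mod_iso by blast
  {
    assume "\<exists>k. b = ?e + k * int n"
    then obtain s where s: "s \<in> left_hom A (uni ?e (?e + 1)) (uni b (b + 1))"
      "bij_betw s (carrier (uni ?e (?e + 1))) (carrier (uni b (b + 1)))"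
      using uni1_shift[of ?e] by blast
    show "left_iso A (soc A (proj_mod a)) (simple_mod b)"
      unfolding left_iso_def
      using left_iso_trans[OF left_iso_trans[OF soc_hom s] t] by blast
  }
  assume "left_iso A (soc A (proj_mod a)) (simple_mod b)"
  then obtain h where h: "h \<in> left_hom A (soc A (proj_mod a)) (simple_mod b)"
    "bij_betw h (carrier (soc A (proj_mod a))) (carrier (simple_mod b))" unfolding left_iso_def by blast
  obtain q where q: "q = inv_into (carrier (soc A (proj_mod a))) (coeff_vec a ?e)" by blast
  define p where "p = inv_into (carrier (uni b (b + 1))) t"
  have p: "p \<in> left_hom A (simple_mod b) (uni b (b + 1))" "bij_betw p (carrier (simple_mod b)) (carrier (uni b (b + 1)))"
    unfolding p_def using left_hom_inv[OF uni1_module t] by auto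
  note hp = left_iso_trans[OF h p]
  let ?x = "path_elem a ?e"
  have e: "a \<le> ?e" "?e < f a" using f_gt[of a] by auto
  have x: "?x \<in> carrier (soc A (proj_mod a))" unfolding soc_proj_mod using path_elem_proj_mod coeff_path_elem_row[OF e] by simp
  have x0: "\<zero> \<in> carrier (soc A (proj_mod a))"
    unfolding soc_proj_mod using algebra_moduleI[OF proj_mod_module]
    by (auto simp: coeff_zero proj_mod_iff)
  have smult: "r \<odot>\<^bsub>soc A (proj_mod a)\<^esub> y = r \<otimes> y" for r y by (simp add: soc_def proj_mod_def regular_module_def)
  have "path_elem ?e ?e \<otimes> ?x = ?x"
  proof (rule proj_mod_eqI[of _ a])
    show "path_elem ?e ?e \<otimes> ?x \<in> carrier (proj_mod a)"
      using left_module.smult_closed[OF proj_mod_module path_elem(1) path_elem_proj_mod] by simp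
    show "coeff (path_elem ?e ?e \<otimes> ?x) a z = coeff ?x a z" if "a \<le> z" "z < f a" for z
      using that coeff_path_elem_mult[OF path_elem(1), of a ?e ?e a ?e z] coeff_path_elem_row[OF e] e f_gt[of ?e] by simp
  qed (rule path_elem_proj_mod)
  then have "p (h ?x) = path_elem ?e ?e \<odot>\<^bsub>uni b (b + 1)\<^esub> p (h ?x)"
    using left_homD(3)[OF hp(1) path_elem(1) x, of ?e ?e] by (simp add: smult)
  also have "\<dots> = (\<lambda>m. (coeff (path_elem ?e ?e) b b * crd (p (h ?x)) b) * unit_vec 0 b m)"
    by (subst uni1_cases[OF left_homD(1)[OF hp(1) x]]) (rule uni1_smult)
  finally have px: "p (h ?x) = (\<lambda>m. (coeff (path_elem ?e ?e) b b * crd (p (h ?x)) b) * unit_vec 0 b m)" .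
  have p0: "p (h \<zero>) = (\<lambda>m. 0)"
  proof -
    have "p (h (\<zero> \<otimes> \<zero>)) = \<zero> \<odot>\<^bsub>uni b (b + 1)\<^esub> p (h \<zero>)"
      using left_homD(3)[OF hp(1) zero_closed x0] by (simp only: smult)
    then show ?thesis using left_homD(1)[OF hp(1) x0]
        algebra_module.smult_l_null[OF algebra_moduleI[OF uni1_module]] by simp
  qed
  have "?x \<noteq> \<zero>" using coeff_path_elem_row[OF e, of ?e] coeff_zero by (metis one_neq_zero)
  then have "p (h ?x) \<noteq> p (h \<zero>)" using hp(2) x x0 unfolding bij_betw_def by (meson inj_onD)
  then have "coeff (path_elem ?e ?e) b b \<noteq> 0" using px p0 by auto
  then show "\<exists>k. b = ?e + k * int n" by (auto simp: path_elem split: if_splits)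
qed


section \<open>Simple modules of projective dimension one\<close>

definition pd_le :: "int \<Rightarrow> nat \<Rightarrow> bool" where
  "pd_le a m \<longleftrightarrow> (\<exists>P \<epsilon> d. projective_resolution A (uni a (a + 1)) P \<epsilon> d \<and> (\<forall>j>m. carrier (P j) = {\<zero>\<^bsub>P j\<^esub>}))"

lemma proj_dim_simple_mod: "proj_dim A (simple_mod a) = Inf {enat m | m. pd_le a m}"
proof -
  obtain t where t: "t \<in> left_hom A (uni a (a + 1)) (simple_mod a)" "bij_betw t (carrier (uni a (a + 1))) (carrier (simple_mod a))"
    "t \<zero>\<^bsub>uni a (a + 1)\<^esub> = \<zero>\<^bsub>simple_mod a\<^esub>" using simple_mod_iso by blast
  have z: "\<zero>\<^bsub>uni a (a + 1)\<^esub> \<in> carrier (uni a (a + 1))" by (rule uni_carrierI) simp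
  define s where "s = inv_into (carrier (uni a (a + 1))) t"
  have s: "s \<in> left_hom A (simple_mod a) (uni a (a + 1))" "bij_betw s (carrier (simple_mod a)) (carrier (uni a (a + 1)))"
    unfolding s_def using left_hom_inv[OF uni1_module t(1,2)] by auto
  have sz: "s \<zero>\<^bsub>simple_mod a\<^esub> = \<zero>\<^bsub>uni a (a + 1)\<^esub>" unfolding s_def t(3)[symmetric]
    using t(2) z by (simp add: bij_betw_inv_into_left)
  have z': "\<zero>\<^bsub>simple_mod a\<^esub> \<in> carrier (simple_mod a)" using left_homD(1)[OF t(1) z] t(3) by simp
  have "(\<exists>P \<epsilon> d. projective_resolution A (simple_mod a) P \<epsilon> d \<and> (\<forall>j>m. carrier (P j) = {\<zero>\<^bsub>P j\<^esub>})) \<longleftrightarrow> pd_le a m" for m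
    unfolding pd_le_def
    using projective_resolution_iso[OF _ t z] projective_resolution_iso[OF _ s sz z'] by blast
  then show ?thesis unfolding proj_dim_def by simp
qed

text \<open>The projective cover \<open>[a, f a)\<close> has kernel \<open>[a + 1, f a)\<close>,
  which is projective if \<open>f (a + 1) = f a\<close> and zero if \<open>f a = a + 1\<close>. The
  later terms are the empty interval.\<close>

lemma pd_le_1I:
  assumes "f (a + 1) = f a \<or> f a = a + 1" shows "pd_le a 1" "f a = a + 1 \<Longrightarrow> pd_le a 0"
proof -
  define P where "P j = (if j = 0 then uni a (f a) else if j = 1 then uni (a + 1) (f a) else uni a a)" for j :: nat
  define d where "d j = (if j = 0 then (\<lambda>v. v) else (\<lambda>(_ :: nat \<Rightarrow> 'k) (_ :: nat). 0 :: 'k))" for j :: nat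
  let ?e = "cut (\<lambda>_. a) (\<lambda>_. a + 1)"
  have af: "a + 1 \<le> f a" using f_gt[of a] by simp
  have Jp: "projective_module A (uni x y)" if "y = f x \<or> y \<le> x" for x y
    unfolding uni_def using that by (intro ivl_projective) (simp add: proj_ivl_def)
  have Paa: "carrier (uni x y) = {\<zero>\<^bsub>uni x y\<^esub>}" if "y \<le> x" for x y
    unfolding uni_def by (rule ivl_zero) (use that in simp)
  have 0: "(\<lambda>_. 0) \<in> carrier (uni x y)" for x y by (rule uni_carrierI) simp
  have proj: "projective_module A (P j)" for j
    unfolding P_def using assms by (auto intro!: Jp)
  have e: "?e \<in> left_hom A (P 0) (uni a (a + 1))" unfolding P_def using uni_cut af by simp
  have z_hom: "(\<lambda>_ _. 0) \<in> left_hom A M (uni x y)" if "y \<le> f x" for M :: "('a, nat \<Rightarrow> 'k) module" and x y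
    using 0 algebra_module.smult_r_null[OF algebra_moduleI[OF uni_module[OF that]]]
    by (intro left_homI) (auto simp: uni_def)
  have dh: "d j \<in> left_hom A (P (Suc j)) (P j)" for j
  proof (cases j)
    case 0
    then show ?thesis using uni_incl[of a "a + 1" "f a"] by (simp add: d_def P_def)
  next
    case (Suc i)
    then show ?thesis
      using z_hom[of "f a" "a + 1"] z_hom[of a a] f_gt[of a] f_mono[of a "a + 1"]
      by (auto simp: d_def P_def order_less_imp_le)
  qed
  have e_surj: "?e ` carrier (P 0) = carrier (uni a (a + 1))"
    unfolding P_def using uni_cut_surj af by simp
  have ker: "a_kernel (P 0) (uni a (a + 1)) ?e = d 0 ` carrier (P 1)"
  proof (intro equalityI subsetI)
    fix v assume "v \<in> a_kernel (P 0) (uni a (a + 1)) ?e"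
    then have v: "v \<in> carrier (uni a (f a))" "?e v = (\<lambda>_. 0)" by (auto simp: a_kernel_iff P_def)
    have "crd (?e v) a = 0" using v(2) by simp
    then have va: "crd v a = 0" by simp
    have "v \<in> carrier (uni (a + 1) (f a))"
    proof (rule uni_carrierI)
      fix i :: nat and z :: int assume "\<not> (i = 0 \<and> a + 1 \<le> z \<and> z < f a)"
      then show "v (idx i z) = 0" using uni_carrierD[OF v(1), of i z] va by (cases "i = 0 \<and> z = a") auto
    qed
    then show "v \<in> d 0 ` carrier (P 1)" by (simp add: d_def P_def)
  next
    fix v assume "v \<in> d 0 ` carrier (P 1)"
    then have v: "v \<in> carrier (uni (a + 1) (f a))" by (simp add: d_def P_def)
    have "?e v = (\<lambda>_. 0)"
    proof (rule vec_eqI)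
      fix i z show "?e v (idx i z) = 0" using uni_carrierD[OF v, of i z] by auto
    qed
    moreover have "v \<in> carrier (uni a (f a))" using left_homD(1)[OF uni_incl v] by simp
    ultimately show "v \<in> a_kernel (P 0) (uni a (a + 1)) ?e" by (simp add: a_kernel_iff P_def)
  qed
  have ker2: "a_kernel (P (Suc j)) (P j) (d j) = d (Suc j) ` carrier (P (Suc (Suc j)))" for j
  proof -
    have "d (Suc j) ` carrier (P (Suc (Suc j))) = {\<lambda>_. 0}" using 0 by (auto simp: d_def P_def)
    moreover have "a_kernel (P (Suc j)) (P j) (d j) = {\<lambda>_. 0}"
      using 0 Paa[of a a] by (cases j) (auto simp: a_kernel_iff d_def P_def)
    ultimately show ?thesis by simp
  qed
  have res: "projective_resolution A (uni a (a + 1)) P ?e d"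
    unfolding projective_resolution_def using proj e dh e_surj ker ker2 by blast
  have P1: "carrier (P j) = {\<zero>\<^bsub>P j\<^esub>}" if "j > 1" for j using that Paa[of a a] by (simp add: P_def)
  then show "pd_le a 1" unfolding pd_le_def using res by blast
  assume "f a = a + 1"
  then have "carrier (P j) = {\<zero>\<^bsub>P j\<^esub>}" if "j > 0" for j
    using that P1[of j] Paa[of "f a" "a + 1"] by (cases "j = 1") (auto simp: P_def)
  then show "pd_le a 0" unfolding pd_le_def using res by blast
qed

text \<open>A comparison with an arbitrary resolution in the manner of Schanuel's lemma. The lifts
  \<open>\<alpha>\<close> and \<open>\<beta>\<close> of the identity of the simple module compose to
  leading scalar 1 on \<open>[a, f a)\<close>. In length one they restrict to maps between the
  radical \<open>[a + 1, f a)\<close> and \<open>P 1\<close>; as \<open>P 1\<close> is projective,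
  lifting through \<open>[a + 1, f (a + 1))\<close> bounds \<open>f (a + 1)\<close> by leading
  scalars. In length zero \<open>P 0\<close> is the simple module and the same bound applies to
  \<open>f a\<close>.\<close>

lemma pd_le_1D:
  assumes "pd_le a 1" "f a \<noteq> a + 1" shows "f (a + 1) = f a" "\<not> pd_le a 0"
proof -
  have af: "a + 1 < f a" using f_gt[of a] assms(2) by simp
  let ?S = "uni a (a + 1)" and ?P = "uni a (f a)" and ?K = "uni (a + 1) (f a)"
  let ?e = "cut (\<lambda>_. a) (\<lambda>_. a + 1)"
  have fP: "fd_module A ?P" and fS: "fd_module A ?S" and PP: "projective_module A ?P"
    using uni_fd af unfolding uni_def by (auto intro!: ivl_projective simp: proj_ivl_def)
  have e: "?e \<in> left_hom A ?P ?S" using uni_cut af by simp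
  have e_surj: "?e ` carrier ?P = carrier ?S"
    using uni_cut_surj af by simp
  have crd_e: "crd v a = crd (?e v) a" for v by simp
  have unit_vec_P: "unit_vec 0 a \<in> carrier ?P" "unit_vec 0 a \<in> carrier ?S" using unit_vec_uni af by auto
  show "\<not> pd_le a 0"
  proof
    assume "pd_le a 0"
    then obtain P \<epsilon> d where R: "projective_resolution A ?S P \<epsilon> d" "carrier (P 1) = {\<zero>\<^bsub>P 1\<^esub>}"
      unfolding pd_le_def by auto
    have P0: "projective_module A (P 0)" "left_module A (P 0)" "left_module A (P 1)"
      and eps: "\<epsilon> \<in> left_hom A (P 0) ?S" "\<epsilon> ` carrier (P 0) = carrier ?S"
      and d0: "d 0 \<in> left_hom A (P 1) (P 0)" and ker: "a_kernel (P 0) ?S \<epsilon> = d 0 ` carrier (P 1)"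
      using R(1) unfolding projective_resolution_def projective_module_def fd_module_def by auto
    interpret P0: algebra_module A "P 0" using P0(2) by (rule algebra_moduleI)
    have ker0: "a_kernel (P 0) ?S \<epsilon> = {\<zero>\<^bsub>P 0\<^esub>}"
      using ker R(2) left_hom_zero[OF P0(3,2) d0] by simp
    have "inj_on \<epsilon> (carrier (P 0))"
      using left_hom_injI[OF P0(2) uni1_module eps(1)] ker0 by simp
    then have bij: "bij_betw \<epsilon> (carrier (P 0)) (carrier ?S)" using eps(2) by (simp add: bij_betw_def)
    define s where "s = inv_into (carrier (P 0)) \<epsilon>"
    have s: "s \<in> left_hom A ?S (P 0)" unfolding s_def using left_hom_inv[OF P0(2) eps(1) bij] by simp
    obtain \<beta> where \<beta>: "\<beta> \<in> left_hom A (P 0) ?P" "\<And>x. x \<in> carrier (P 0) \<Longrightarrow> ?e (\<beta> x) = \<epsilon> x"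
      using projective_lift[OF P0(1) fP fS e e_surj eps(1)] by blast
    have "?e (\<beta> (s (unit_vec 0 a))) = unit_vec 0 a"
      using \<beta>(2)[OF left_homD(1)[OF s unit_vec_P(2)]] bij unit_vec_P(2) by (simp add: s_def bij_betw_inv_into_right)
    then have "crd (?e (\<beta> (s (unit_vec 0 a)))) a = crd (unit_vec 0 a) a" by (rule arg_cong)
    then have "crd (\<beta> (s (unit_vec 0 a))) a = 1" by simp
    then show False using lead_le[OF left_hom_comp[OF s \<beta>(1)]] af by simp
  qed
  obtain P \<epsilon> d where R: "projective_resolution A ?S P \<epsilon> d" "carrier (P 2) = {\<zero>\<^bsub>P 2\<^esub>}"
    using assms(1) unfolding pd_le_def by force
  have P: "projective_module A (P j)" "fd_module A (P j)" "left_module A (P j)" for j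
    using R(1) unfolding projective_resolution_def projective_module_def fd_module_def by auto
  have eps: "\<epsilon> \<in> left_hom A (P 0) ?S" "\<epsilon> ` carrier (P 0) = carrier ?S"
    and dh: "\<And>j. d j \<in> left_hom A (P (Suc j)) (P j)" and ker: "a_kernel (P 0) ?S \<epsilon> = d 0 ` carrier (P 1)"
    and ker1: "a_kernel (P 1) (P 0) (d 0) = d 1 ` carrier (P 2)"
    using R(1) unfolding projective_resolution_def by (auto simp: numeral_2_eq_2)
  have d0: "d 0 \<in> left_hom A (P 1) (P 0)" and d1: "d 1 \<in> left_hom A (P 2) (P 1)"
    using dh[of 0] dh[of 1] by (simp_all add: numeral_2_eq_2)
  interpret P0: algebra_module A "P 0" using P(3) by (rule algebra_moduleI)
  interpret P1: algebra_module A "P 1" using P(3) by (rule algebra_moduleI)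
  have "a_kernel (P 1) (P 0) (d 0) = {\<zero>\<^bsub>P 1\<^esub>}"
    using ker1 R(2) left_hom_zero[OF P(3) P(3) d1] by simp
  then have d0_inj: "inj_on (d 0) (carrier (P 1))"
    using left_hom_injI[OF P(3) P(3) d0] by simp
  obtain \<alpha> where \<alpha>: "\<alpha> \<in> left_hom A ?P (P 0)" "\<And>v. v \<in> carrier ?P \<Longrightarrow> \<epsilon> (\<alpha> v) = ?e v"
    using projective_lift[OF PP P(2) fS eps e] by blast
  obtain \<beta> where \<beta>: "\<beta> \<in> left_hom A (P 0) ?P" "\<And>x. x \<in> carrier (P 0) \<Longrightarrow> ?e (\<beta> x) = \<epsilon> x"
    using projective_lift[OF P(1) fP fS e e_surj eps(1)] by blast
  have KP: "v \<in> carrier ?P" if "v \<in> carrier ?K" for v using left_homD(1)[OF uni_incl that] by simp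
  have "\<alpha> v \<in> d 0 ` carrier (P 1)" if v: "v \<in> carrier ?K" for v
  proof -
    have "?e v = \<zero>\<^bsub>?S\<^esub>"
      unfolding uni_zero
    proof (rule vec_eqI)
      fix i z show "?e v (idx i z) = 0" using uni_carrierD[OF v, of i z] by auto
    qed
    then have "\<alpha> v \<in> a_kernel (P 0) ?S \<epsilon>"
      using \<alpha>(2)[OF KP[OF v]] left_homD(1)[OF \<alpha>(1) KP[OF v]] by (simp add: a_kernel_iff)
    then show ?thesis using ker by simp
  qed
  note \<alpha>d = this
  \<comment> \<open>As \<open>P 2\<close> vanishes, \<open>d 0\<close> is injective, so
    \<open>\<alpha>\<close> on the radical factors uniquely through \<open>P 1\<close>.\<close>
  define \<kappa> where "\<kappa> v = inv_into (carrier (P 1)) (d 0) (\<alpha> v)" for v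
  have \<kappa>: "\<And>v. v \<in> carrier ?K \<Longrightarrow> \<kappa> v \<in> carrier (P 1)"
    "\<And>v. v \<in> carrier ?K \<Longrightarrow> d 0 (\<kappa> v) = \<alpha> v"
    using inv_into_into[OF \<alpha>d] f_inv_into_f[OF \<alpha>d] by (simp_all add: \<kappa>_def)
  have \<alpha>K: "\<alpha> \<in> left_hom A ?K (P 0)" using left_hom_comp[OF uni_incl \<alpha>(1), of "a + 1"] by simp
  have Kmod: "left_module A ?K" using uni_module f_mono[of a "a + 1"] by simp
  interpret K: algebra_module A ?K using Kmod by (rule algebra_moduleI)
  have \<kappa>h: "\<kappa> \<in> left_hom A ?K (P 1)"
  proof (rule left_homI)
    fix v assume v: "v \<in> carrier ?K"
    show "\<kappa> v \<in> carrier (P 1)" using \<kappa>(1) v .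
    {
      fix w assume w: "w \<in> carrier ?K"
      have "d 0 (\<kappa> (v \<oplus>\<^bsub>?K\<^esub> w)) = d 0 (\<kappa> v \<oplus>\<^bsub>P 1\<^esub> \<kappa> w)"
        using \<kappa> v w K.M.a_closed[OF v w] left_homD(2)[OF \<alpha>K] left_homD(2)[OF d0] by simp
      then show "\<kappa> (v \<oplus>\<^bsub>?K\<^esub> w) = \<kappa> v \<oplus>\<^bsub>P 1\<^esub> \<kappa> w"
        using inj_onD[OF d0_inj] \<kappa>(1) v w K.M.a_closed[OF v w] P1.M.a_closed by metis
    }
    fix r assume r: "r \<in> carrier A"
    have "d 0 (\<kappa> (r \<odot>\<^bsub>?K\<^esub> v)) = d 0 (r \<odot>\<^bsub>P 1\<^esub> \<kappa> v)"
      using \<kappa> v K.smult_closed[OF r v] left_homD(3)[OF \<alpha>K r] left_homD(3)[OF d0 r] by simp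
    then show "\<kappa> (r \<odot>\<^bsub>?K\<^esub> v) = r \<odot>\<^bsub>P 1\<^esub> \<kappa> v"
      using inj_onD[OF d0_inj] \<kappa>(1) v K.smult_closed[OF r v] P1.smult_closed[OF r] by metis
  qed
  have bd: "\<beta> (d 0 p) \<in> carrier ?K" if p: "p \<in> carrier (P 1)" for p
  proof (rule uni_carrierI)
    fix i :: nat and z :: int assume *: "\<not> (i = 0 \<and> a + 1 \<le> z \<and> z < f a)"
    have "d 0 p \<in> a_kernel (P 0) ?S \<epsilon>" using ker p by simp
    then have "?e (\<beta> (d 0 p)) = (\<lambda>_. 0)" using \<beta>(2) by (simp add: a_kernel_iff)
    then have "crd (\<beta> (d 0 p)) a = 0" using crd_e by metis
    then show "\<beta> (d 0 p) (idx i z) = 0"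
      using * uni_carrierD[OF left_homD(1)[OF left_hom_comp[OF d0 \<beta>(1)] p], of i z]
      by (cases "i = 0 \<and> z = a") auto
  qed
  have bdK: "(\<lambda>p. \<beta> (d 0 p)) \<in> left_hom A (P 1) ?K"
  proof (rule left_homI)
    fix p assume p: "p \<in> carrier (P 1)"
    show "\<beta> (d 0 p) \<in> carrier ?K" using bd p .
    note h = left_hom_comp[OF d0 \<beta>(1)]
    {
      fix q assume q: "q \<in> carrier (P 1)"
      show "\<beta> (d 0 (p \<oplus>\<^bsub>P 1\<^esub> q)) = \<beta> (d 0 p) \<oplus>\<^bsub>?K\<^esub> \<beta> (d 0 q)"
        using left_homD(2)[OF h p q] by (simp add: uni_def)
    }
    fix r assume r: "r \<in> carrier A"
    show "\<beta> (d 0 (r \<odot>\<^bsub>P 1\<^esub> p)) = r \<odot>\<^bsub>?K\<^esub> \<beta> (d 0 p)"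
      using left_homD(3)[OF h r p] left_homD(3)[OF uni_incl[of a "a + 1" "f a"] r bd[OF p]] by simp
  qed
  let ?L = "uni (a + 1) (f (a + 1))"
  let ?q = "cut (\<lambda>_. a + 1) (\<lambda>_. f a)"
  have fle: "f a \<le> f (a + 1)" by (rule f_mono) simp
  have q: "?q \<in> left_hom A ?L ?K" using uni_cut fle by simp
  have q_surj: "?q ` carrier ?L = carrier ?K"
    using uni_cut_surj fle by simp
  have "fd_module A ?L" "fd_module A ?K" using uni_fd fle by auto
  then obtain h where h: "h \<in> left_hom A (P 1) ?L" "\<And>p. p \<in> carrier (P 1) \<Longrightarrow> ?q (h p) = \<beta> (d 0 p)"
    using projective_lift[OF P(1) _ _ q q_surj bdK] by blast
  let ?v = "unit_vec 0 (a + 1)"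
  have vK: "?v \<in> carrier ?K" using unit_vec_uni af by simp
  \<comment> \<open>The leading scalar 1 of the composite of \<open>\<alpha>\<close> and
    \<open>\<beta>\<close> is moved from \<open>a\<close> to \<open>a + 1\<close> by
    \<open>lead\<close>; there the composite factors through \<open>P 1\<close>.\<close>
  have "crd (h (\<kappa> ?v)) (a + 1) = crd (?q (h (\<kappa> ?v))) (a + 1)" using af by simp
  also have "\<dots> = crd (\<beta> (\<alpha> ?v)) (a + 1)" using h(2)[OF \<kappa>(1)[OF vK]] \<kappa>(2)[OF vK] by simp
  also have "\<dots> = crd (\<beta> (\<alpha> (unit_vec 0 a))) a"
    using lead[OF left_hom_comp[OF \<alpha>(1) \<beta>(1)], of "a + 1"] af by simp
  also have "\<dots> = crd (?e (\<beta> (\<alpha> (unit_vec 0 a)))) a" by simp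
  also have "\<dots> = 1" using \<beta>(2)[OF left_homD(1)[OF \<alpha>(1) unit_vec_P(1)]] \<alpha>(2)[OF unit_vec_P(1)] by simp
  finally have "f (a + 1) \<le> f a"
    using lead_le[OF left_hom_comp[OF \<kappa>h h(1)]] af fle by simp
  then show "f (a + 1) = f a" using fle by simp
qed

lemma proj_dim_simple_mod_eq_1: "proj_dim A (simple_mod a) = 1 \<longleftrightarrow> f (a + 1) = f a"
proof -
  have "proj_dim A (simple_mod a) = 1 \<longleftrightarrow> pd_le a 1 \<and> \<not> pd_le a 0"
    unfolding proj_dim_simple_mod one_enat_def Inf_enat_iff by auto
  \<comment> \<open>If \<open>f a = a + 1\<close>, the projective dimension is 0 and
    \<open>f (a + 1) > a + 1 = f a\<close>, so both sides fail.\<close>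
  also have "\<dots> \<longleftrightarrow> f (a + 1) = f a"
    using pd_le_1I[of a] pd_le_1D[of a] f_gt[of "a + 1"] by force
  finally show ?thesis .
qed

end

section \<open>From the bound path algebra to band matrices\<close>

lemma path_algebra_simps:
  "f \<in> carrier (path_algebra n) \<longleftrightarrow> finite {p. f p \<noteq> 0} \<and> (\<forall>a l. f (a, l) \<noteq> 0 \<longrightarrow> a < n)"
  "(f \<otimes>\<^bsub>path_algebra n\<^esub> g) (a, l) = (\<Sum>i\<le>l. f ((a + i) mod n, l - i) * g (a, i))"
  "\<one>\<^bsub>path_algebra n\<^esub> (a, l) = (if a < n \<and> l = 0 then 1 else 0)"
  "\<zero>\<^bsub>path_algebra n\<^esub> = (\<lambda>p. 0)"
  "f \<oplus>\<^bsub>path_algebra n\<^esub> g = (\<lambda>p. f p + g p)"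
  "c \<odot>\<^bsub>path_algebra n\<^esub> f = (\<lambda>p. c * f p)"
  by (simp_all add: path_algebra_def)

lemma path_support: "f \<in> carrier (path_algebra n) \<Longrightarrow> \<not> a < n \<Longrightarrow> f (a, l) = 0"
  by (auto simp: path_algebra_simps)

lemma path_mult_nonzero:
  assumes "(f \<otimes>\<^bsub>path_algebra n\<^esub> g) (a, l) \<noteq> 0"
  obtains i where "i \<le> l" "f ((a + i) mod n, l - i) \<noteq> 0" "g (a, i) \<noteq> 0"
proof -
  obtain i where "i \<in> {..l}" "f ((a + i) mod n, l - i) * g (a, i) \<noteq> 0"
    using assms unfolding path_algebra_simps(2) by (rule sum.not_neutral_contains_not_neutral)
  then show ?thesis using that by auto
qed

lemma path_algebra_ring:
  assumes n: "n \<ge> 1"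
  shows "ring (path_algebra n :: ('k::field, nat \<times> nat \<Rightarrow> 'k) module)"
proof (rule ringI)
  let ?R = "path_algebra n :: ('k, nat \<times> nat \<Rightarrow> 'k) module"
  have add: "f \<oplus>\<^bsub>?R\<^esub> g \<in> carrier ?R" if f: "f \<in> carrier ?R" and g: "g \<in> carrier ?R" for f g
  proof -
    have "finite ({p. f p \<noteq> 0} \<union> {p. g p \<noteq> 0})" using f g by (simp add: path_algebra_simps)
    then have "finite {p. f p + g p \<noteq> 0}" by (rule rev_finite_subset) auto
    then show ?thesis using path_support[OF f] path_support[OF g]
      unfolding path_algebra_simps by (metis add.left_neutral)
  qed
  show "abelian_group ?R"
  proof (rule abelian_groupI)
    fix f assume f: "f \<in> carrier ?R"
    then have "(\<lambda>p. - f p) \<in> carrier ?R" by (simp add: path_algebra_simps)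
    then show "\<exists>g\<in>carrier ?R. g \<oplus>\<^bsub>?R\<^esub> f = \<zero>\<^bsub>?R\<^esub>"
      by (intro bexI[of _ "\<lambda>p. - f p"]) (auto simp: path_algebra_simps)
  next
    show "\<zero>\<^bsub>?R\<^esub> \<in> carrier ?R" by (simp add: path_algebra_simps)
  qed (use add in \<open>auto simp: path_algebra_simps(4,5) add.assoc add.commute\<close>)
  show "monoid ?R"
  proof (rule monoidI)
    fix f g assume f: "f \<in> carrier ?R" and g: "g \<in> carrier ?R"
    \<comment> \<open>Every path in the support of a product is a concatenation of paths from the
      two supports.\<close>
    have sub: "{p. (f \<otimes>\<^bsub>?R\<^esub> g) p \<noteq> 0} \<subseteq> (\<lambda>((b, m), (a, i)). (a, i + m)) ` ({p. f p \<noteq> 0} \<times> {p. g p \<noteq> 0})"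
    proof
      fix p assume p: "p \<in> {p. (f \<otimes>\<^bsub>?R\<^esub> g) p \<noteq> 0}"
      obtain a l where al: "p = (a, l)" by (cases p)
      then obtain i where i: "i \<le> l" "f ((a + i) mod n, l - i) \<noteq> 0" "g (a, i) \<noteq> 0"
        using p path_mult_nonzero[of n f g a l] by blast
      have "(\<lambda>((b, m), (a, i)). (a, i + m)) (((a + i) mod n, l - i), (a, i)) = p" using al i by simp
      then show "p \<in> (\<lambda>((b, m), (a, i)). (a, i + m)) ` ({p. f p \<noteq> 0} \<times> {p. g p \<noteq> 0})"
        using i by (metis (mono_tags, lifting) SigmaI imageI mem_Collect_eq)
    qed
    have "finite {p. (f \<otimes>\<^bsub>?R\<^esub> g) p \<noteq> 0}"
      using f g finite_subset[OF sub] by (simp add: path_algebra_simps(1))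
    moreover have "a < n" if "(f \<otimes>\<^bsub>?R\<^esub> g) (a, l) \<noteq> 0" for a l
    proof -
      from that obtain i where "g (a, i) \<noteq> 0" by (rule path_mult_nonzero)
      then show ?thesis using g by (auto simp: path_algebra_simps)
    qed
    ultimately show "f \<otimes>\<^bsub>?R\<^esub> g \<in> carrier ?R" unfolding path_algebra_simps(1) by blast
  next
    have "{p. \<one>\<^bsub>?R\<^esub> p \<noteq> 0} \<subseteq> {..<n} \<times> {0}" by (auto simp: path_algebra_simps split: if_splits)
    then have "finite {p. \<one>\<^bsub>?R\<^esub> p \<noteq> 0}" by (rule finite_subset) simp
    then show "\<one>\<^bsub>?R\<^esub> \<in> carrier ?R" unfolding path_algebra_simps(1) by (auto simp: path_algebra_simps(3))
  next
    fix f g h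
    show "f \<otimes>\<^bsub>?R\<^esub> g \<otimes>\<^bsub>?R\<^esub> h = f \<otimes>\<^bsub>?R\<^esub> (g \<otimes>\<^bsub>?R\<^esub> h)"
    proof (rule ext)
      fix p :: "nat \<times> nat"
      obtain a l where p: "p = (a, l)" by (cases p)
      have "(f \<otimes>\<^bsub>?R\<^esub> g \<otimes>\<^bsub>?R\<^esub> h) (a, l) =
         (\<Sum>j\<le>l. \<Sum>k\<le>l - j. f ((a + j + k) mod n, l - j - k) * (g ((a + j) mod n, k) * h (a, j)))"
        by (simp add: path_algebra_simps sum_distrib_right mod_add_left_eq mult.assoc)
      also have "\<dots> = (\<Sum>i\<le>l. \<Sum>j\<le>i. f ((a + i) mod n, l - i) * (g ((a + j) mod n, i - j) * h (a, j)))"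
        unfolding sum.Sigma[OF finite_atMost ballI[OF finite_atMost]]
        by (rule sum.reindex_bij_witness[of _ "\<lambda>(i, j). (j, i - j)" "\<lambda>(j, k). (j + k, j)"]) (auto simp: add.assoc)
      also have "\<dots> = (f \<otimes>\<^bsub>?R\<^esub> (g \<otimes>\<^bsub>?R\<^esub> h)) (a, l)"
        by (simp add: path_algebra_simps sum_distrib_left)
      finally show "(f \<otimes>\<^bsub>?R\<^esub> g \<otimes>\<^bsub>?R\<^esub> h) p = (f \<otimes>\<^bsub>?R\<^esub> (g \<otimes>\<^bsub>?R\<^esub> h)) p" using p by simp
    qed
  next
    fix f assume f: "f \<in> carrier ?R"
    show "\<one>\<^bsub>?R\<^esub> \<otimes>\<^bsub>?R\<^esub> f = f"
    proof (rule ext)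
      fix p :: "nat \<times> nat"
      obtain a l where p: "p = (a, l)" by (cases p)
      have "(\<one>\<^bsub>?R\<^esub> \<otimes>\<^bsub>?R\<^esub> f) (a, l) = (\<Sum>i\<le>l. if i = l then f (a, l) else 0)"
        unfolding path_algebra_simps using n by (intro sum.cong) auto
      then show "(\<one>\<^bsub>?R\<^esub> \<otimes>\<^bsub>?R\<^esub> f) p = f p" using p by simp
    qed
    show "f \<otimes>\<^bsub>?R\<^esub> \<one>\<^bsub>?R\<^esub> = f"
    proof (rule ext)
      fix p :: "nat \<times> nat"
      obtain a l where p: "p = (a, l)" by (cases p)
      have "(f \<otimes>\<^bsub>?R\<^esub> \<one>\<^bsub>?R\<^esub>) (a, l) = (\<Sum>i\<le>l. if i = 0 then f (a, l) else 0)"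
        unfolding path_algebra_simps using path_support[OF f, of a] by (intro sum.cong) auto
      then show "(f \<otimes>\<^bsub>?R\<^esub> \<one>\<^bsub>?R\<^esub>) p = f p" using p by simp
    qed
  qed
qed (auto simp: path_algebra_def distrib_left distrib_right sum.distrib)

text \<open>\<open>bad n I a l\<close>: the path of length \<open>l\<close> starting at \<open>a\<close> contains a relation.\<close>

definition bad :: "nat \<Rightarrow> (nat \<times> nat) set \<Rightarrow> nat \<Rightarrow> nat \<Rightarrow> bool" where
  "bad n I a l \<longleftrightarrow> (\<exists>(b, m)\<in>I. \<exists>i. i + m \<le> l \<and> (a + i) mod n = b)"

lemma bad_left: "bad n I a i \<Longrightarrow> i \<le> l \<Longrightarrow> bad n I a l"
proof -
  assume "bad n I a i" "i \<le> l"
  then obtain b m k where "(b, m) \<in> I" "k + m \<le> i" "(a + k) mod n = b" unfolding bad_def by blast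
  then have "(b, m) \<in> I" "k + m \<le> l" "(a + k) mod n = b" using \<open>i \<le> l\<close> by auto
  then show ?thesis unfolding bad_def by blast
qed

lemma bad_right: "bad n I ((a + i) mod n) (l - i) \<Longrightarrow> i \<le> l \<Longrightarrow> bad n I a l"
proof -
  assume "bad n I ((a + i) mod n) (l - i)" "i \<le> l"
  then obtain b m k where "(b, m) \<in> I" "k + m \<le> l - i" "((a + i) mod n + k) mod n = b"
    unfolding bad_def by blast
  then have "(b, m) \<in> I" "(i + k) + m \<le> l" "(a + (i + k)) mod n = b"
    using \<open>i \<le> l\<close> by (auto simp: mod_add_left_eq add.assoc)
  then show ?thesis unfolding bad_def by blast
qed

context
  fixes n :: nat and I :: "(nat \<times> nat) set"
  assumes n: "n \<ge> 1" and I: "\<forall>(a, l)\<in>I. a < n \<and> l \<ge> 1"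
begin

lemma path_in: "a < n \<Longrightarrow> path (a, l) \<in> carrier (path_algebra n)"
  by (auto simp: path_algebra_simps path_def)

text \<open>Ideals are closed under ring multiplication, so a scalar multiple is obtained as a
  product with a multiple of the unit.\<close>

lemma scalar_path_mult:
  assumes f: "f \<in> carrier (path_algebra n)"
  shows "(\<lambda>p. c * (\<one>\<^bsub>path_algebra n\<^esub> p)) \<otimes>\<^bsub>path_algebra n\<^esub> f = (\<lambda>p. c * f p)"
proof (rule ext)
  fix p :: "nat \<times> nat"
  obtain a l where p: "p = (a, l)" by (cases p)
  have "((\<lambda>p. c * (\<one>\<^bsub>path_algebra n\<^esub> p)) \<otimes>\<^bsub>path_algebra n\<^esub> f) (a, l) = (\<Sum>i\<le>l. if i = l then c * f (a, l) else 0)"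
    unfolding path_algebra_simps using n by (intro sum.cong) auto
  then show "((\<lambda>p. c * (\<one>\<^bsub>path_algebra n\<^esub> p)) \<otimes>\<^bsub>path_algebra n\<^esub> f) p = c * f p" using p by simp
qed

lemma scale_in: "f \<in> carrier (path_algebra n) \<Longrightarrow> (\<lambda>p. c * f p) \<in> carrier (path_algebra n)"
proof -
  assume f: "f \<in> carrier (path_algebra n)"
  have "finite {p. c * f p \<noteq> 0}"
    by (rule finite_subset[of _ "{p. f p \<noteq> 0}"]) (use f in \<open>auto simp: path_algebra_simps\<close>)
  then show ?thesis using f by (auto simp: path_algebra_simps)
qed

lemma path_mult:
  assumes "a < n"
  shows "path ((a + i) mod n, m) \<otimes>\<^bsub>path_algebra n\<^esub> path (a, i) = path (a, i + m)"
proof (rule ext)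
  fix p :: "nat \<times> nat"
  obtain b l where p: "p = (b, l)" by (cases p)
  have "(path ((a + i) mod n, m) \<otimes>\<^bsub>path_algebra n\<^esub> path (a, i)) (b, l) =
     (\<Sum>j\<le>l. if j = i then (if b = a \<and> l - i = m then 1 else 0) else 0)"
    unfolding path_algebra_simps by (intro sum.cong) (auto simp: path_def)
  then show "(path ((a + i) mod n, m) \<otimes>\<^bsub>path_algebra n\<^esub> path (a, i)) p = path (a, i + m) p"
    using p by (auto simp: path_def)
qed

text \<open>The ideal is monomial. Combinations of bad paths form an ideal containing the
  generators; conversely a bad path is a relation multiplied by paths on both sides, and an element
  of finite support is a finite sum of scalar multiples of its paths.\<close>

lemma relation_ideal_eq:
  "(relation_ideal n I :: (nat \<times> nat \<Rightarrow> 'k::field) set) =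
     {f \<in> carrier (path_algebra n). \<forall>a l. f (a, l) \<noteq> 0 \<longrightarrow> bad n I a l}" (is "_ = ?uni")
proof (intro equalityI)
  let ?R = "path_algebra n :: ('k, nat \<times> nat \<Rightarrow> 'k) module"
  interpret R: ring ?R using path_algebra_ring[OF n] .
  have minus: "\<ominus>\<^bsub>?R\<^esub> f = (\<lambda>p. - f p)" if f: "f \<in> carrier ?R" for f
  proof (rule R.minus_equality)
    show "(\<lambda>p. - f p) \<in> carrier ?R" using f by (simp add: path_algebra_simps)
  qed (use f in \<open>auto simp: path_algebra_simps\<close>)
  have uni: "ideal ?uni ?R"
  proof (rule idealI[OF R.ring_axioms])
    show "subgroup ?uni (add_monoid ?R)"
    proof (rule R.add.subgroupI)
      show "?uni \<noteq> {}" using R.zero_closed by (auto simp: path_algebra_simps(4))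
      fix f assume f: "f \<in> ?uni"
      show "\<ominus>\<^bsub>?R\<^esub> f \<in> ?uni" using f R.a_inv_closed[of f] minus[of f] by auto
      fix g assume "g \<in> ?uni"
      then show "f \<oplus>\<^bsub>?R\<^esub> g \<in> ?uni"
        using f R.a_closed[of f g] by (auto simp: path_algebra_simps(5)) (metis add.right_neutral)
    qed auto
    fix f x assume f: "f \<in> ?uni" and x: "x \<in> carrier ?R"
    show "x \<otimes>\<^bsub>?R\<^esub> f \<in> ?uni"
      using f x R.m_closed[of x f] by (auto elim!: path_mult_nonzero intro: bad_left)
    show "f \<otimes>\<^bsub>?R\<^esub> x \<in> ?uni"
      using f x R.m_closed[of f x] by (auto elim!: path_mult_nonzero intro: bad_right)
  qed
  have gen: "path ` I \<subseteq> ?uni"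
  proof
    fix f :: "nat \<times> nat \<Rightarrow> 'k" assume "f \<in> path ` I"
    then obtain b m where bm: "(b, m) \<in> I" "f = path (b, m)" by auto
    have "b < n" using bm I by auto
    have "bad n I b m" unfolding bad_def using bm \<open>b < n\<close> by (auto intro!: bexI[of _ "(b, m)"] exI[of _ 0])
    then show "f \<in> ?uni" using bm path_in[OF \<open>b < n\<close>] by (auto simp: path_def)
  qed
  have gen_carrier: "path ` I \<subseteq> carrier ?R" using gen by auto
  show "relation_ideal n I \<subseteq> ?uni" unfolding relation_ideal_def using R.genideal_minimal[OF uni gen] .
  let ?G = "relation_ideal n I :: (nat \<times> nat \<Rightarrow> 'k) set"
  interpret G: ideal ?G ?R unfolding relation_ideal_def using R.genideal_ideal[OF gen_carrier] .
  have pathG: "path (a, l) \<in> ?G" if a: "a < n" and bad: "bad n I a l" for a l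
  proof -
    obtain b m i where b: "(b, m) \<in> I" "i + m \<le> l" "(a + i) mod n = b" using bad unfolding bad_def by blast
    have "path (b, m) \<in> ?G" using b R.genideal_self[OF gen_carrier] unfolding relation_ideal_def by blast
    then have "path (b, m) \<otimes>\<^bsub>?R\<^esub> path (a, i) \<in> ?G" using G.I_r_closed path_in[OF a] by blast
    moreover have "path ((a + i) mod n, m) \<otimes>\<^bsub>?R\<^esub> path (a, i) = path (a, i + m)" by (rule path_mult[OF a])
    ultimately have "path (a, i + m) \<in> ?G" using b(3) by simp
    then have "path ((a + (i + m)) mod n, l - (i + m)) \<otimes>\<^bsub>?R\<^esub> path (a, i + m) \<in> ?G"
      by (rule G.I_l_closed[OF _ path_in]) (use n in simp)
    moreover have "path ((a + (i + m)) mod n, l - (i + m)) \<otimes>\<^bsub>?R\<^esub> path (a, i + m) = path (a, i + m + (l - (i + m)))"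
      by (rule path_mult[OF a])
    ultimately show ?thesis using b(2) by simp
  qed
  show "?uni \<subseteq> ?G"
  proof
    fix f assume f: "f \<in> ?uni"
    have "(\<lambda>p. if p \<in> S then f p else 0) \<in> ?G" if "finite S" "S \<subseteq> {p. f p \<noteq> 0}" for S
      using that
    proof (induction S)
      case empty
      then show ?case using G.zero_closed by (simp add: path_algebra_simps)
    next
      case (insert p S)
      obtain a l where p: "p = (a, l)" by (cases p)
      have "f (a, l) \<noteq> 0" using insert.prems p by auto
      then have al: "a < n" "bad n I a l" using f by (auto simp: path_algebra_simps(1))
      have "(\<lambda>q. f p * (\<one>\<^bsub>?R\<^esub> q)) \<otimes>\<^bsub>?R\<^esub> path p \<in> ?G"
        using G.I_l_closed[OF pathG[OF al] scale_in[OF R.one_closed]] p by simp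
      moreover have "(\<lambda>q. f p * (\<one>\<^bsub>?R\<^esub> q)) \<otimes>\<^bsub>?R\<^esub> path p = (\<lambda>q. f p * path p q)"
        unfolding p by (rule scalar_path_mult[OF path_in[OF al(1)]])
      ultimately have "(\<lambda>q. f p * path p q) \<in> ?G" by simp
      then have "(\<lambda>q. f p * path p q) \<oplus>\<^bsub>?R\<^esub> (\<lambda>q. if q \<in> S then f q else 0) \<in> ?G"
        using G.a_closed insert by blast
      moreover have "(\<lambda>q. f p * path p q) \<oplus>\<^bsub>?R\<^esub> (\<lambda>q. if q \<in> S then f q else 0) =
          (\<lambda>q. if q \<in> insert p S then f q else 0)"
        using insert.hyps by (auto simp: path_algebra_simps path_def)
      ultimately show ?case by simp
    qed
    from this[of "{p. f p \<noteq> 0}"] have "(\<lambda>p. if p \<in> {p. f p \<noteq> 0} then f p else 0) \<in> ?G"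
      using f by (simp add: path_algebra_simps(1))
    moreover have "(\<lambda>p. if p \<in> {p. f p \<noteq> 0} then f p else 0) = f" by auto
    ultimately show "f \<in> ?G" by simp
  qed
qed

end

section \<open>Coefficients of elements of a Nakayama algebra\<close>

locale nakayama =
  fixes A :: "('k::field, 'a) module" and n :: nat and I :: "(nat \<times> nat) set"
    and \<phi> :: "(nat \<times> nat \<Rightarrow> 'k) set \<Rightarrow> 'a"
  assumes nak: "nakayama_algebra A n I \<phi>"
begin

lemma n1: "n \<ge> 1" and I1: "\<forall>(a, l)\<in>I. a < n \<and> l \<ge> 1"
  and A_alg: "k_algebra A" and A_fd: "fin_dim A (regular_module A)"
  and \<phi>_iso: "\<phi> \<in> ring_iso (bound_path_algebra n I) A"
  and \<phi>_scale: "\<And>c X. X \<in> carrier (bound_path_algebra n I) \<Longrightarrow>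
        \<phi> (c \<odot>\<^bsub>bound_path_algebra n I\<^esub> X) = c \<odot>\<^bsub>A\<^esub> \<phi> X"
  using nak unfolding nakayama_algebra_def by auto

abbreviation R :: "('k, nat \<times> nat \<Rightarrow> 'k) module" where "R \<equiv> path_algebra n"
abbreviation G :: "(nat \<times> nat \<Rightarrow> 'k) set" where "G \<equiv> relation_ideal n I"
abbreviation B :: "('k, (nat \<times> nat \<Rightarrow> 'k) set) module" where "B \<equiv> bound_path_algebra n I"

sublocale A: k_algebra A by (rule A_alg)
sublocale R: ring R by (rule path_algebra_ring[OF n1])

lemma G_eq: "G = {f \<in> carrier R. \<forall>a l. f (a, l) \<noteq> 0 \<longrightarrow> bad n I a l}"
  by (rule relation_ideal_eq[OF n1 I1])

lemma R_minus: "f \<in> carrier R \<Longrightarrow> \<ominus>\<^bsub>R\<^esub> f = (\<lambda>p. - f p)"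
  by (rule R.minus_equality) (auto simp: path_algebra_simps)

sublocale G: ideal G R
proof -
  have "path ` I \<subseteq> carrier R" using I1 by (auto intro!: path_in[OF n1 I1])
  then show "ideal G R" unfolding relation_ideal_def by (rule R.genideal_ideal)
qed

lemma B_simps:
  "carrier B = a_rcosets\<^bsub>R\<^esub> G" "X \<otimes>\<^bsub>B\<^esub> Y = rcoset_mult R G X Y" "\<one>\<^bsub>B\<^esub> = G +>\<^bsub>R\<^esub> \<one>\<^bsub>R\<^esub>"
  "X \<oplus>\<^bsub>B\<^esub> Y = set_add R X Y" "c \<odot>\<^bsub>B\<^esub> X = (\<Union>x\<in>X. G +>\<^bsub>R\<^esub> (c \<odot>\<^bsub>R\<^esub> x))"
  by (simp_all add: bound_path_algebra_def quotient_algebra_def FactRing_def ring.extend_def)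

lemma \<phi>_inj: "inj_on \<phi> (carrier B)" and \<phi>_surj: "\<phi> ` carrier B = carrier A"
  using ring_iso_memE(5)[OF \<phi>_iso] by (simp_all add: bij_betw_def)

definition \<Phi> :: "(nat \<times> nat \<Rightarrow> 'k) \<Rightarrow> 'a" where "\<Phi> p = \<phi> (G +>\<^bsub>R\<^esub> p)"

lemma coset_in: "p \<in> carrier R \<Longrightarrow> G +>\<^bsub>R\<^esub> p \<in> carrier B"
  unfolding B_simps by (auto simp: A_RCOSETS_def')

lemma \<Phi>_closed: "p \<in> carrier R \<Longrightarrow> \<Phi> p \<in> carrier A"
  unfolding \<Phi>_def using ring_iso_memE(1)[OF \<phi>_iso] coset_in by blast

lemma \<Phi>_mult: "p \<in> carrier R \<Longrightarrow> q \<in> carrier R \<Longrightarrow> \<Phi> (p \<otimes>\<^bsub>R\<^esub> q) = \<Phi> p \<otimes>\<^bsub>A\<^esub> \<Phi> q"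
  unfolding \<Phi>_def using ring_iso_memE(2)[OF \<phi>_iso coset_in coset_in, of p q] G.rcoset_mult_add[of p q]
  by (simp add: B_simps)

lemma \<Phi>_add: "p \<in> carrier R \<Longrightarrow> q \<in> carrier R \<Longrightarrow> \<Phi> (p \<oplus>\<^bsub>R\<^esub> q) = \<Phi> p \<oplus>\<^bsub>A\<^esub> \<Phi> q"
  unfolding \<Phi>_def using ring_iso_memE(3)[OF \<phi>_iso coset_in coset_in, of p q] G.a_rcos_sum[of p q]
  by (simp add: B_simps)

lemma \<Phi>_one: "\<Phi> \<one>\<^bsub>R\<^esub> = \<one>\<^bsub>A\<^esub>"
  unfolding \<Phi>_def using ring_iso_memE(4)[OF \<phi>_iso] by (simp add: B_simps)

lemma \<Phi>_surj: "r \<in> carrier A \<Longrightarrow> \<exists>p\<in>carrier R. \<Phi> p = r"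
proof -
  assume "r \<in> carrier A"
  then obtain X where X: "X \<in> carrier B" "\<phi> X = r" unfolding \<phi>_surj[symmetric] by blast
  then obtain p where "p \<in> carrier R" "X = G +>\<^bsub>R\<^esub> p" unfolding B_simps by (auto simp: A_RCOSETS_def')
  then show ?thesis using X by (auto simp: \<Phi>_def)
qed

text \<open>Equality in \<open>A\<close> is congruence modulo an ideal that is described
  coefficientwise. Coefficients of paths that are not bad are therefore well defined on
  \<open>A\<close>.\<close>

lemma \<Phi>_eq_iff:
  assumes p: "p \<in> carrier R" and q: "q \<in> carrier R"
  shows "\<Phi> p = \<Phi> q \<longleftrightarrow> (\<forall>a l. p (a, l) \<noteq> q (a, l) \<longrightarrow> bad n I a l)"
proof -
  have diff: "p \<ominus>\<^bsub>R\<^esub> q = (\<lambda>x. p x - q x)"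
    using R_minus[OF q] by (simp add: a_minus_def path_algebra_simps(5))
  have "\<Phi> p = \<Phi> q \<longleftrightarrow> G +>\<^bsub>R\<^esub> p = G +>\<^bsub>R\<^esub> q"
    unfolding \<Phi>_def by (rule inj_on_eq_iff[OF \<phi>_inj coset_in[OF p] coset_in[OF q]])
  also have "\<dots> \<longleftrightarrow> p \<ominus>\<^bsub>R\<^esub> q \<in> G" using R.quotient_eq_iff_same_a_r_cos[OF G.is_ideal p q] by simp
  also have "\<dots> \<longleftrightarrow> (\<forall>a l. p (a, l) \<noteq> q (a, l) \<longrightarrow> bad n I a l)"
    using R.minus_closed[OF p q] unfolding G_eq diff by auto
  finally show ?thesis .
qed

lemma \<Phi>_scale: "p \<in> carrier R \<Longrightarrow> \<Phi> (\<lambda>x. c * p x) = c \<odot>\<^bsub>A\<^esub> \<Phi> p"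
proof -
  assume p: "p \<in> carrier R"
  \<comment> \<open>The scalar action on the quotient is a union over representatives; all of them
    give the same coset.\<close>
  have "G +>\<^bsub>R\<^esub> (\<lambda>a. c * x a) = G +>\<^bsub>R\<^esub> (\<lambda>a. c * p a)" if x: "x \<in> G +>\<^bsub>R\<^esub> p" for x
  proof -
    have xc: "x \<in> carrier R" using x p G.a_subset R.a_r_coset_subset_G by blast
    have "G +>\<^bsub>R\<^esub> x = G +>\<^bsub>R\<^esub> p" using R.a_repr_independence[OF x p G.a_subgroup] by simp
    then have "\<Phi> x = \<Phi> p" by (simp add: \<Phi>_def)
    then have "\<Phi> (\<lambda>a. c * x a) = \<Phi> (\<lambda>a. c * p a)"
      using \<Phi>_eq_iff[OF xc p] \<Phi>_eq_iff[OF scale_in[OF n1 I1 xc] scale_in[OF n1 I1 p]] by auto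
    then show ?thesis
      using inj_on_eq_iff[OF \<phi>_inj coset_in[OF scale_in[OF n1 I1 xc]] coset_in[OF scale_in[OF n1 I1 p]]]
      by (simp add: \<Phi>_def)
  qed
  note const = this
  have "c \<odot>\<^bsub>B\<^esub> (G +>\<^bsub>R\<^esub> p) = (\<Union>x\<in>G +>\<^bsub>R\<^esub> p. G +>\<^bsub>R\<^esub> (\<lambda>a. c * x a))"
    by (simp only: B_simps path_algebra_simps)
  also have "\<dots> = (\<Union>x\<in>G +>\<^bsub>R\<^esub> p. G +>\<^bsub>R\<^esub> (\<lambda>a. c * p a))" by (rule SUP_cong[OF refl const])
  also have "\<dots> = G +>\<^bsub>R\<^esub> (\<lambda>a. c * p a)"
    using G.a_rcos_self[OF p] unfolding UN_constant by (metis empty_iff)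
  finally have "c \<odot>\<^bsub>B\<^esub> (G +>\<^bsub>R\<^esub> p) = G +>\<^bsub>R\<^esub> (\<lambda>a. c * p a)" .
  then show ?thesis unfolding \<Phi>_def using \<phi>_scale[OF coset_in[OF p], of c] by simp
qed

text \<open>Finitely many spanning elements have representatives of length below some
  \<open>L\<close>, so every element of \<open>A\<close> has one. A path of length \<open>L\<close>
  thus equals a combination of shorter paths in \<open>A\<close>, and comparing its own coefficient
  shows that it is bad.\<close>

lemma eventually_bad:
  assumes a: "a < n" shows "\<exists>l. bad n I a l"
proof -
  let ?M = "regular_module A"
  obtain S where S: "finite S" "S \<subseteq> carrier A"
    "\<And>x. x \<in> carrier A \<Longrightarrow> \<exists>c. x = finsum ?M (\<lambda>b. (c b \<odot>\<^bsub>A\<^esub> \<one>\<^bsub>A\<^esub>) \<odot>\<^bsub>?M\<^esub> b) S"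
    using A_fd unfolding fin_dim_def by (auto simp: regular_module_def)
  interpret M: algebra_module A ?M using A.regular_left_module by (rule A.algebra_moduleI)
  define W where "W L = {\<Phi> q | q. q \<in> carrier R \<and> (\<forall>b l. q (b, l) \<noteq> 0 \<longrightarrow> l < L)}" for L
  have "\<exists>L. S \<subseteq> W L" using S(1,2)
  proof (induction S)
    case (insert s S)
    then obtain L where L: "S \<subseteq> W L" by auto
    obtain p where p: "p \<in> carrier R" "\<Phi> p = s" using \<Phi>_surj insert.prems by blast
    have fin: "finite (snd ` {x. p x \<noteq> 0})" using p by (simp add: path_algebra_simps(1))
    define L' where "L' = Suc (Max (insert L (snd ` {x. p x \<noteq> 0})))"
    have "l < L'" if "p (b, l) \<noteq> 0" for b l
    proof -
      have "l \<le> Max (insert L (snd ` {x. p x \<noteq> 0}))" using fin that by (intro Max_ge) force+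
      then show ?thesis by (simp add: L'_def)
    qed
    then have "s \<in> W L'" using p by (auto simp: W_def)
    moreover have "L \<le> L'" using fin unfolding L'_def by (intro le_SucI Max_ge) auto
    then have "W L \<subseteq> W L'" unfolding W_def by (auto intro: less_le_trans)
    ultimately show ?case using L by blast
  qed simp
  then obtain L where L: "S \<subseteq> W L" by blast
  \<comment> \<open>With the zero functional, \<open>linear_on\<close> just says that
    \<open>W L\<close> is a subspace.\<close>
  have "M.linear_on (W L) (\<lambda>_. 0)"
    unfolding M.linear_on_def
  proof (intro conjI ballI allI)
    show "W L \<subseteq> carrier ?M" using \<Phi>_closed by (auto simp: W_def regular_module_def)
    have "\<Phi> (\<lambda>p. 0) = \<zero>\<^bsub>A\<^esub>"
      using \<Phi>_add[OF R.zero_closed R.zero_closed] \<Phi>_closed[OF R.zero_closed] A.add.l_cancel_one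
      by (simp add: path_algebra_simps)
    then show "\<zero>\<^bsub>?M\<^esub> \<in> W L" using R.zero_closed
      by (auto simp: W_def regular_module_def path_algebra_simps(4) intro!: exI[of _ "\<lambda>_. 0"])
    fix x assume "x \<in> W L"
    then obtain p where p: "x = \<Phi> p" "p \<in> carrier R" "\<And>b l. p (b, l) \<noteq> 0 \<Longrightarrow> l < L" by (auto simp: W_def)
    {
      fix y assume "y \<in> W L"
      then obtain q where q: "y = \<Phi> q" "q \<in> carrier R" "\<And>b l. q (b, l) \<noteq> 0 \<Longrightarrow> l < L" by (auto simp: W_def)
      have "(p \<oplus>\<^bsub>R\<^esub> q) (b, l) \<noteq> 0 \<Longrightarrow> l < L" for b l
        using p(3)[of b l] q(3)[of b l] by (cases "p (b, l) = 0") (auto simp: path_algebra_simps)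
      then have "\<Phi> (p \<oplus>\<^bsub>R\<^esub> q) \<in> W L" using R.a_closed[OF p(2) q(2)] unfolding W_def by blast
      then show "x \<oplus>\<^bsub>?M\<^esub> y \<in> W L"
        using \<Phi>_add[OF p(2) q(2)] p(1) q(1) by (simp add: regular_module_def)
    }
    fix c
    have "M.sc c x = \<Phi> (\<lambda>a. c * p a)"
      using \<Phi>_scale[OF p(2), of c] \<Phi>_closed[OF p(2)] p(1) A.scale_mult_left[OF A.one_closed]
      unfolding M.sc_def by (simp add: regular_module_def)
    moreover have "\<Phi> (\<lambda>a. c * p a) \<in> W L"
      using scale_in[OF n1 I1 p(2), of c] p(3) unfolding W_def by fastforce
    ultimately show "M.sc c x \<in> W L" by simp
  qed auto
  note lin = this
  have all: "x \<in> W L" if x: "x \<in> carrier A" for x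
  proof -
    obtain c where "x = finsum ?M (\<lambda>b. M.sc (c b) b) S" using S(3)[OF x] unfolding M.sc_def by blast
    then show ?thesis using M.linear_on_finsum[OF lin S(1) L] by simp
  qed
  have "\<Phi> (path (a, L)) \<in> W L" by (rule all[OF \<Phi>_closed[OF path_in[OF n1 I1 a]]])
  then obtain q where q: "\<Phi> (path (a, L)) = \<Phi> q" "q \<in> carrier R" "\<And>b l. q (b, l) \<noteq> 0 \<Longrightarrow> l < L"
    by (auto simp: W_def)
  have "q (a, L) = 0" using q(3)[of a L] by auto
  then have "path (a, L) (a, L) \<noteq> q (a, L)" by (simp add: path_def)
  then have "bad n I a L" using \<Phi>_eq_iff[OF path_in[OF n1 I1 a] q(2)] q(1) by blast
  then show ?thesis by blast
qed

text \<open>The length of P(a): exactly the paths of length \<open>0, ..., c a - 1\<close> from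
  \<open>a\<close> survive.\<close>

definition c :: "nat \<Rightarrow> nat" where "c a = (LEAST l. bad n I a l)"

lemma bad_iff: "a < n \<Longrightarrow> bad n I a l \<longleftrightarrow> c a \<le> l"
proof
  assume a: "a < n"
  show "bad n I a l \<Longrightarrow> c a \<le> l" unfolding c_def by (rule Least_le)
  have "bad n I a (c a)" unfolding c_def using eventually_bad[OF a] by (rule LeastI_ex)
  then show "c a \<le> l \<Longrightarrow> bad n I a l" by (rule bad_left)
qed

lemma c_pos: "a < n \<Longrightarrow> c a \<ge> 1"
  using bad_iff[of a 0] I1 by (fastforce simp: bad_def)

text \<open>Prefixing an arrow to a bad path gives a bad path. This is the Kupisch inequality behind
  the monotonicity of \<open>f\<close>.\<close>

lemma c_step: "a < n \<Longrightarrow> c a \<le> Suc (c (Suc a mod n))"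
proof -
  assume a: "a < n"
  have "Suc a mod n < n" using n1 by simp
  then have "bad n I ((a + 1) mod n) (Suc (c (Suc a mod n)) - 1)" using bad_iff by simp
  then have "bad n I a (Suc (c (Suc a mod n)))" by (rule bad_right) simp
  then show ?thesis using bad_iff[OF a] by simp
qed

lemmas residue_n = residue_less[OF n1] residue_shift[of n] residue_add[OF n1]
lemmas residue_n_int = residue_int[of _ n]
lemmas residue_n_eq = residue_eq_nat_iff[OF n1]

definition f :: "int \<Rightarrow> int" where "f z = z + int (c (residue n z))"

text \<open>Any representative may be chosen: two of them differ only on bad paths, and the band
  \<open>w \<le> z < f w\<close> consists of the others.\<close>

definition coeff :: "'a \<Rightarrow> int \<Rightarrow> int \<Rightarrow> 'k" where
  "coeff r w z = (if w \<le> z \<and> z < f w then (SOME p. p \<in> carrier R \<and> \<Phi> p = r) (residue n w, nat (z - w)) else 0)"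

lemma coeff_\<Phi>:
  assumes p: "p \<in> carrier R"
  shows "coeff (\<Phi> p) w z = (if w \<le> z \<and> z < f w then p (residue n w, nat (z - w)) else 0)"
proof -
  define q where "q = (SOME q. q \<in> carrier R \<and> \<Phi> q = \<Phi> p)"
  have "q \<in> carrier R \<and> \<Phi> q = \<Phi> p" unfolding q_def by (rule someI[of _ p]) (use p in simp)
  then have "q (a, l) = p (a, l)" if "\<not> bad n I a l" for a l
    using \<Phi>_eq_iff[of q p] p that by blast
  moreover have "\<not> bad n I (residue n w) (nat (z - w))" if "w \<le> z" "z < f w"
    using that bad_iff[OF residue_n(1)] by (auto simp: f_def)
  ultimately show ?thesis unfolding coeff_def q_def[symmetric] by auto
qed

lemma f_step: "f z \<le> f (z + 1)"
  using c_step[OF residue_n(1), of z] residue_n(3)[of z 1] by (simp add: f_def)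

sublocale kupisch_map n f
proof
  show "1 \<le> n" by (rule n1)
  show "f w \<le> f z" if "w \<le> z" for w z
    using that by (induction z rule: int_ge_induct) (use f_step order_trans in blast)+
  show "z < f z" for z using c_pos[OF residue_n(1), of z] by (simp add: f_def)
  show "f (z + int n) = f z + int n" for z using residue_n(2)[of z 1] by (simp add: f_def)
qed

sublocale band_algebra n f A coeff
proof
  fix r s :: 'a and w z k :: int and cc :: 'k
  assume r: "r \<in> carrier A"
  obtain p where p: "p \<in> carrier R" "r = \<Phi> p" using \<Phi>_surj[OF r] by blast
  show "coeff r w z = 0" if "\<not> (w \<le> z \<and> z < f w)" using that by (auto simp: coeff_def)
  show "coeff r (w + k * int n) (z + k * int n) = coeff r w z"
    unfolding p(2) coeff_\<Phi>[OF p(1)] using f_shift[of w k] by (simp add: residue_n(2))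
  have "cc \<odot>\<^bsub>A\<^esub> r = \<Phi> (\<lambda>x. cc * p x)" using \<Phi>_scale p by simp
  then show "coeff (cc \<odot>\<^bsub>A\<^esub> r) w z = cc * coeff r w z"
    using coeff_\<Phi>[OF scale_in[OF n1 I1 p(1)], of cc w z] coeff_\<Phi>[OF p(1), of w z] p(2) by simp
  assume s: "s \<in> carrier A"
  obtain q where q: "q \<in> carrier R" "s = \<Phi> q" using \<Phi>_surj[OF s] by blast
  show "coeff (r \<oplus>\<^bsub>A\<^esub> s) w z = coeff r w z + coeff s w z"
    unfolding p(2) q(2) \<Phi>_add[OF p(1) q(1), symmetric] coeff_\<Phi>[OF p(1)] coeff_\<Phi>[OF q(1)]
      coeff_\<Phi>[OF R.a_closed[OF p(1) q(1)]] by (simp add: path_algebra_simps)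
  show "r = s" if eq: "coeff r = coeff s"
    unfolding p(2) q(2) \<Phi>_eq_iff[OF p(1) q(1)]
  proof (intro allI impI)
    fix a l assume ne: "p (a, l) \<noteq> q (a, l)"
    then have a: "a < n" using p(1) q(1) path_support by metis
    show "bad n I a l"
    proof (rule ccontr)
      assume "\<not> bad n I a l"
      then have "int a + int l < f (int a)" using bad_iff[OF a] residue_n_int[OF a] by (simp add: f_def)
      then have "p (a, l) = q (a, l)"
        using fun_cong[OF fun_cong[OF eq], of "int a" "int a + int l"] residue_n_int[OF a]
        unfolding p(2) q(2) coeff_\<Phi>[OF p(1)] coeff_\<Phi>[OF q(1)] by simp
      then show False using ne by simp
    qed
  qed
  assume wz: "w \<le> z" "z < f w"
  have nd: "nat (z - (w + int i)) = nat (z - w) - i" for i by linarith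
  have "coeff (r \<otimes>\<^bsub>A\<^esub> s) w z = (\<Sum>i\<le>nat (z - w). p ((residue n w + i) mod n, nat (z - w) - i) * q (residue n w, i))"
    unfolding p(2) q(2) \<Phi>_mult[OF p(1) q(1), symmetric] coeff_\<Phi>[OF R.m_closed[OF p(1) q(1)]]
    using wz by (simp add: path_algebra_simps)
  also have "(\<Sum>i\<le>nat (z - w). p ((residue n w + i) mod n, nat (z - w) - i) * q (residue n w, i)) =
     (\<Sum>v\<in>{w..z}. p (residue n v, nat (z - v)) * q (residue n w, nat (v - w)))"
    by (rule sum.reindex_bij_witness[of _ "\<lambda>v. nat (v - w)" "\<lambda>i. w + int i"])
      (use wz residue_n(3) nd in \<open>auto simp: nat_le_iff\<close>)
  also have "\<dots> = (\<Sum>v\<in>{w..z}. coeff r v z * coeff s w v)"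
  proof (intro sum.cong refl)
    fix v assume v: "v \<in> {w..z}"
    then have "z < f v" "v < f w" using wz f_mono[of w v] by auto
    then show "p (residue n v, nat (z - v)) * q (residue n w, nat (v - w)) = coeff r v z * coeff s w v"
      unfolding p(2) q(2) coeff_\<Phi>[OF p(1)] coeff_\<Phi>[OF q(1)] using v by simp
  qed
  finally show "coeff (r \<otimes>\<^bsub>A\<^esub> s) w z = (\<Sum>v\<in>{w..z}. coeff r v z * coeff s w v)" .
next
  fix w z :: int assume "w \<le> z" "z < f w"
  then show "coeff \<one>\<^bsub>A\<^esub> w z = (if w = z then 1 else 0)"
    unfolding \<Phi>_one[symmetric] coeff_\<Phi>[OF R.one_closed] using residue_n(1) by (auto simp: path_algebra_simps)
next
  fix F :: "int \<Rightarrow> int \<Rightarrow> 'k"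
  assume out: "\<And>w z. \<not> (w \<le> z \<and> z < f w) \<Longrightarrow> F w z = 0"
    and per: "\<And>w z k. F (w + k * int n) (z + k * int n) = F w z"
  \<comment> \<open>Rows 0 to \<open>n - 1\<close> of the matrix become the coefficients of the
    paths from these vertices; the band makes the support finite.\<close>
  define p where "p = (\<lambda>(a, l). if a < n then F (int a) (int a + int l) else 0)"
  have "{x. p x \<noteq> 0} \<subseteq> (SIGMA a:{..<n}. {..<c a})"
  proof
    fix x assume x: "x \<in> {x. p x \<noteq> 0}"
    obtain a l where al: "x = (a, l)" by (cases x)
    then have "a < n" "F (int a) (int a + int l) \<noteq> 0" using x by (auto simp: p_def split: if_splits)
    moreover from this have "int a + int l < f (int a)" using out by blast
    ultimately show "x \<in> (SIGMA a:{..<n}. {..<c a})" using al residue_n_int by (simp add: f_def)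
  qed
  then have "finite {x. p x \<noteq> 0}" by (rule finite_subset) simp
  then have p: "p \<in> carrier R" by (auto simp: path_algebra_simps p_def split: if_splits)
  have "coeff (\<Phi> p) w z = F w z" for w z
  proof (cases "w \<le> z \<and> z < f w")
    case True
    obtain k where k: "w = int (residue n w) + k * int n" using residue_n_eq[OF residue_n(1), of w w] by blast
    have "coeff (\<Phi> p) w z = F (int (residue n w)) (int (residue n w) + (z - w))"
      unfolding coeff_\<Phi>[OF p] using True residue_n(1)[of w] by (simp add: p_def)
    also have "\<dots> = F w z" using per[of "int (residue n w)" k "int (residue n w) + (z - w)"] k by (simp add: algebra_simps)
    finally show ?thesis .
  qed (use out coeff_\<Phi>[OF p] in auto)
  then show "\<exists>r\<in>carrier A. coeff r = F" using \<Phi>_closed[OF p] by blast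
qed

lemma vertex_idempotent_eq:
  assumes a: "a < n" shows "vertex_idempotent n I \<phi> a = path_elem (int a) (int a)"
proof -
  have "\<Phi> (path (a, 0)) = path_elem (int a) (int a)"
  proof (rule coeff_inj)
    show "coeff (\<Phi> (path (a, 0))) = coeff (path_elem (int a) (int a))"
    proof (intro ext)
      fix w z
      show "coeff (\<Phi> (path (a, 0))) w z = coeff (path_elem (int a) (int a)) w z"
        unfolding coeff_\<Phi>[OF path_in[OF n1 I1 a]] path_elem(2)
        using residue_n_eq[OF a, of w] f_gt[of w] f_gt[of "int a"] by (auto simp: path_def)
    qed
  qed (rule \<Phi>_closed[OF path_in[OF n1 I1 a]], rule path_elem(1))
  then show ?thesis by (simp add: \<Phi>_def vertex_idempotent_def)
qed

end

section \<open>The theorem\<close>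

context nakayama begin

lemma proj_at_eq: "a < n \<Longrightarrow> proj_at A n I \<phi> a = proj_mod (int a)"
  by (simp add: proj_at_def proj_mod_def vertex_idempotent_eq)

lemma simple_at_eq: "a < n \<Longrightarrow> simple_at A n I \<phi> a = simple_mod (int a)"
  by (simp add: simple_at_def simple_mod_def proj_at_eq)

text \<open>The socle of P(a) is the simple module at \<open>f a - 1\<close>, and passing to the
  next vertex adds one.\<close>

lemma resolution_map_eq:
  assumes a: "a < n" shows "resolution_map A n I \<phi> a = nat (f (int a) mod int n)"
proof -
  let ?e = "f (int a) - 1"
  have "(b < n \<and> left_iso A (soc A (proj_at A n I \<phi> a)) (simple_at A n I \<phi> b)) \<longleftrightarrow> b = residue n ?e" for b
  proof (cases "b < n")
    case True
    have "left_iso A (soc A (proj_at A n I \<phi> a)) (simple_at A n I \<phi> b) \<longleftrightarrow> residue n ?e = residue n (int b)"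
      using soc_iso_iff[of "int a" "int b"] residue_eq_iff[OF n1, of ?e "int b"]
      by (simp add: proj_at_eq[OF a] simple_at_eq[OF True])
    then show ?thesis using True residue_n_int by auto
  next
    case False
    then show ?thesis using residue_n(1)[of ?e] by auto
  qed
  then have "resolution_map A n I \<phi> a = succ_vertex n (residue n ?e)" unfolding resolution_map_def by simp
  also have "\<dots> = residue n (f (int a))" using residue_n(3)[of ?e 1] by (simp add: succ_vertex_def)
  finally show ?thesis by (simp add: residue_def)
qed

lemma black_iff: "black A n I \<phi> (residue n z) \<longleftrightarrow> f z \<noteq> f (z + 1)"
proof -
  obtain k where k: "int (residue n z) = z + k * int n" using int_residue[OF n1] by blast
  have "red A n I \<phi> (residue n z) \<longleftrightarrow> f (int (residue n z) + 1) = f (int (residue n z))"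
    unfolding red_def simple_at_eq[OF residue_n(1)] by (rule proj_dim_simple_mod_eq_1)
  also have "\<dots> \<longleftrightarrow> f (z + 1) = f z"
    unfolding k using f_shift[of z k] f_shift[of "z + 1" k] by (simp add: algebra_simps)
  finally show ?thesis unfolding black_def by auto
qed

lemma even_minimal_auslander_gorenstein_iff:
  "(\<exists>d. even d \<and> minimal_auslander_gorenstein A d) \<longleftrightarrow> (\<exists>m. quiver_cond m)"
  unfolding auslander_gorenstein_iff quiver_iff_sequence resolution_iff_sequence[symmetric]
  by (metis dvd_triv_left evenE)

end

theorem theorem2:
  fixes A :: "('k::alg_closed_field, 'a) module"
    and n :: nat
    and I :: "(nat \<times> nat) set"
    and \<phi> :: "(nat \<times> nat \<Rightarrow> 'k) set \<Rightarrow> 'a"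
  assumes "nakayama_algebra A n I \<phi>"
  shows "(\<exists>d. even d \<and> minimal_auslander_gorenstein A d) \<longleftrightarrow>
    (let \<gamma> = resolution_map A n I \<phi> in
       (max_dist n \<gamma> > 0 \<and> (\<forall>a<n. leaf n \<gamma> a \<longrightarrow> vertex_dist \<gamma> a = max_dist n \<gamma>)) \<and>
       (\<forall>a<n. \<not> cyclic_vertex \<gamma> a \<longrightarrow> card (predecessors n \<gamma> a) \<le> 1) \<and>
       (\<forall>a<n. cyclic_vertex \<gamma> a \<longrightarrow> card (predecessors n \<gamma> a) \<le> 2) \<and>
       (\<forall>a<n. cyclic_vertex \<gamma> a \<longrightarrow> black A n I \<phi> a))"
proof -
  interpret nakayama A n I \<phi> by (rule nakayama.intro) (rule assms)
  show ?thesis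
    unfolding Let_def even_minimal_auslander_gorenstein_iff
    using quiver_cond_iff[OF resolution_map_eq black_iff] by simp
qed

end
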